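(* Let $L$ satisfy assumptions i)–viii) of the context, let $c\in\mathbb{R}^d$ and $\varepsilon>0$, and let $V_\varepsilon$ be the discounted value function. For every (Fréchet) differentiability point $M\in L^2(I;\mathbb{R}^d)$ of $V_\varepsilon$, there exists a unique minimizer $\mathbf{x}^*\in C^1([0,\infty),L^2(I;\mathbb{R}^d))$ of $$V_{\varepsilon}(M)=\inf_{\mathbf{x}}\Big\{\int_0^\infty e^{-\varepsilon t}L_c(\mathbf{x},\dot{\mathbf{x}})\,dt\;:\;\mathbf{x}\in AC^2_{loc}((0,\infty);L^2(I;\mathbb{R}^d)),\ \mathbf{x}(0)=M\Big\}$$ with the initial condition $\mathbf{x}^*(0)=M$. Furthermore, $\dot{\mathbf{x}}^*(0)=-D_pH_c(M,\nabla V_\varepsilon(M))$ and $\mathbf{x}^*$ solves the Euler–Lagrange equation, that is, $$\frac{d}{ds}\left(e^{-\varepsilon s}D_vL_c(\mathbf{x}^*,\dot{\mathbf{x}}^* )\right)=e^{-\varepsilon s}D_xL_c(\mathbf{x}^*,\dot{\mathbf{x}}^* ).$$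
   Context: Let $d\ge 1$, $I=[0,1]^d$, and let $\lambda_0$ be Lebesgue measure on $I$. $L^2(I;\mathbb{R}^d)$ is taken with respect to $\lambda_0$, with its inner product $\langle\cdot,\cdot\rangle$ and norm $\|\cdot\|$. $L^2(I;\mathbb{Z}^d)$ is the set of $M\in L^2(I;\mathbb{R}^d)$ with $M(z)\in\mathbb{Z}^d$ for $\lambda_0$-a.e. $z$. $\mathcal{G}$ is the group of bijections $G:I\to I$ such that $G$ and $G^{-1}$ are Borel measurable and push $\lambda_0$ forward to itself. The Lagrangian $L:L^2(I;\mathbb{R}^d)\times L^2(I;\mathbb{R}^d)\to\mathbb{R}$ satisfies, for some constants $C,K_L,\gamma>0$ and all $M,N,H_1,H_2\in L^2(I;\mathbb{R}^d)$, $G\in\mathcal{G}$, $Z\in L^2(I;\mathbb{Z}^d)$: i) $L(M+Z,N)=L(M,N)$; ii) $L(M\circ G,N\circ G)=L(M,N)$; iii) $L\ge 0$; iv) $L$ is $C^1$ in the Fréchet sense and $L,DL$ are locally uniformly continuous ($DL$ is the full Fréchet derivative); v) $L(M,N)\le C(1+\|M\|^2+\|N\|^2)$ and $|L(M,0)|\le C$; vi) $\|DL\|\le C+CL$; vii) $L(M+H_1,N+H_2)-L(M,N)-\langle D_xL(M,N),H_1\rangle-\langle D_vL(M,N),H_2\rangle\ge\gamma\|H_2\|^2-K_L\|H_1\|^2$; viii) $L(M+H_1,N+H_2)-L(M,N)-\langle D_xL(M,N),H_1\rangle-\langle D_vL(M,N),H_2\rangle\le K_L\|H_2\|^2+K_L\|H_1\|^2$.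 Here $D_x,D_v$ are the partial Fréchet derivatives in the first and second variable. For $c\in\mathbb{R}^d$ (also viewed as a constant function on $I$), $L_c(M,N)=L(M,N)+\int_I c\cdot N\,d\lambda_0$. The Hamiltonian is $H(M,P)=\sup_{N\in L^2(I;\mathbb{R}^d)}\{-\langle P,N\rangle-L(M,N)\}$ and $H_c(M,P)=H(M,P+c)$; under the assumptions $H$ is $C^1$, and $D_p$ denotes its derivative in the second variable. A curve $\sigma:(0,T)\to L^2(I;\mathbb{R}^d)$ is in $AC^2(0,T;L^2(I;\mathbb{R}^d))$ if there is $\beta\in L^2(0,T)$ with $\|\sigma_t-\sigma_s\|\le\int_s^t\beta(u)\,du$ for all $s<t$ in $(0,T)$; $AC^2_{loc}((0,\infty);L^2(I;\mathbb{R}^d))$ is the set of curves on $(0,\infty)$ whose restriction to $(0,T)$ is in $AC^2(0,T;L^2(I;\mathbb{R}^d))$ for all $T>0$. $\dot{\mathbf{x}}$ is the a.e. derivative, and $\mathbf{x}(0)$ is understood through the continuous extension. The discounted value function is $V_{\varepsilon}(M)=\inf\{\int_0^\infty e^{-\varepsilon t}L_c(\mathbf{x},\dot{\mathbf{x}})\,dt:\mathbf{x}\in AC^2_{loc}((0,\infty);L^2(I;\mathbb{R}^d)),\ \mathbf{x}(0)=M\}$, and $\nabla V_\varepsilon(M)$ is its Fréchet gradient at $M$. *)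

theory Defs
  imports "HOL-Analysis.Analysis"
begin

section \<open>The Hilbert space of square integrable maps from the unit cube to Euclidean space\<close>

text \<open>The dimension is the cardinality of the index type. On \<open>real ^ 'd\<close> the constant \<open>1\<close> is the
  all-ones vector, so \<open>cube\<close> is the unit cube. The measure lives on the trace Borel sigma-algebra;
  every Lebesgue measurable map agrees a.e. with a Borel one, so the space of classes below is the
  usual one.\<close>

abbreviation cube :: "(real ^ 'd) set"
  where "cube \<equiv> cbox 0 1"

definition cube_measure :: "(real ^ 'd) measure"
  where "cube_measure = restrict_space lborel cube"

lemma sets_cube_measure [measurable_cong]: "sets cube_measure = sets (restrict_space borel cube)"
  by (simp add: cube_measure_def sets_restrict_space)

lemma space_cube_measure [simp]: "space cube_measure = cube"
  by (simp add: cube_measure_def space_restrict_space)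

lemma finite_measure_cube_measure: "finite_measure cube_measure"
proof (rule finite_measureI)
  show "emeasure cube_measure (space cube_measure) \<noteq> \<infinity>"
    by (simp add: cube_measure_def space_restrict_space emeasure_restrict_space
        emeasure_lborel_cbox_eq)
qed

definition square_integrable :: "(real ^ 'd \<Rightarrow> real ^ 'd) \<Rightarrow> bool"
  where "square_integrable f \<longleftrightarrow>
    f \<in> borel_measurable cube_measure \<and> integrable cube_measure (\<lambda>z. (norm (f z))\<^sup>2)"

definition l2_rel :: "(real ^ 'd \<Rightarrow> real ^ 'd) \<Rightarrow> (real ^ 'd \<Rightarrow> real ^ 'd) \<Rightarrow> bool"
  where "l2_rel f g \<longleftrightarrow>
    square_integrable f \<and> square_integrable g \<and> (AE z in cube_measure. f z = g z)"

lemma square_integrable_const: "square_integrable (\<lambda>_. c)"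
proof -
  interpret finite_measure cube_measure by (rule finite_measure_cube_measure)
  show ?thesis by (simp add: square_integrable_def)
qed

lemma square_integrable_measurable:
  "square_integrable f \<Longrightarrow> f \<in> borel_measurable cube_measure"
  by (simp add: square_integrable_def)

lemma square_integrable_scaleR:
  assumes "square_integrable f"
  shows "square_integrable (\<lambda>z. r *\<^sub>R f z)"
  using assms unfolding square_integrable_def by (auto simp: power_mult_distrib)

lemma square_integrable_add:
  assumes f: "square_integrable f" and g: "square_integrable g"
  shows "square_integrable (\<lambda>z. f z + g z)"
proof -
  have [measurable]: "f \<in> borel_measurable cube_measure" "g \<in> borel_measurable cube_measure"
    using f g by (simp_all add: square_integrable_def)
  have "integrable cube_measure (\<lambda>z. 2 * (norm (f z))\<^sup>2 + 2 * (norm (g z))\<^sup>2)"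
    using f g by (simp add: square_integrable_def)
  then have "integrable cube_measure (\<lambda>z. (norm (f z + g z))\<^sup>2)"
  proof (rule Bochner_Integration.integrable_bound)
    show "AE z in cube_measure. norm ((norm (f z + g z))\<^sup>2)
        \<le> norm (2 * (norm (f z))\<^sup>2 + 2 * (norm (g z))\<^sup>2)"
    proof (rule AE_I2)
      fix z
      have "(norm (f z + g z))\<^sup>2 \<le> (norm (f z) + norm (g z))\<^sup>2"
        by (intro power_mono norm_triangle_ineq) simp
      also have "\<dots> \<le> 2 * (norm (f z))\<^sup>2 + 2 * (norm (g z))\<^sup>2"
        using sum_squares_bound[of "norm (f z)" "norm (g z)"] by (simp add: power2_sum)
      finally show "norm ((norm (f z + g z))\<^sup>2)
          \<le> norm (2 * (norm (f z))\<^sup>2 + 2 * (norm (g z))\<^sup>2)" by simp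
    qed
  qed measurable
  then show ?thesis by (simp add: square_integrable_def)
qed

lemma square_integrable_minus:
  assumes "square_integrable f"
  shows "square_integrable (\<lambda>z. - f z)"
  using square_integrable_scaleR[OF assms, of "- 1"] by simp

lemma square_integrable_diff:
  assumes "square_integrable f" and "square_integrable g"
  shows "square_integrable (\<lambda>z. f z - g z)"
  using square_integrable_add[OF assms(1) square_integrable_minus[OF assms(2)]] by simp

lemma integrable_inner_square_integrable:
  assumes f: "square_integrable f" and g: "square_integrable g"
  shows "integrable cube_measure (\<lambda>z. f z \<bullet> g z)"
proof -
  have [measurable]: "f \<in> borel_measurable cube_measure" "g \<in> borel_measurable cube_measure"
    using f g by (simp_all add: square_integrable_def)
  have "integrable cube_measure (\<lambda>z. (norm (f z))\<^sup>2 + (norm (g z))\<^sup>2)"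
    using f g by (simp add: square_integrable_def)
  then show ?thesis
  proof (rule Bochner_Integration.integrable_bound)
    show "AE z in cube_measure. norm (f z \<bullet> g z) \<le> norm ((norm (f z))\<^sup>2 + (norm (g z))\<^sup>2)"
    proof (rule AE_I2)
      fix z
      have "\<bar>f z \<bullet> g z\<bar> \<le> norm (f z) * norm (g z)" by (rule Cauchy_Schwarz_ineq2)
      also have "\<dots> \<le> (norm (f z))\<^sup>2 + (norm (g z))\<^sup>2"
        using sum_squares_bound[of "norm (f z)" "norm (g z)"]
          mult_nonneg_nonneg[OF norm_ge_zero[of "f z"] norm_ge_zero[of "g z"]] by linarith
      finally show "norm (f z \<bullet> g z) \<le> norm ((norm (f z))\<^sup>2 + (norm (g z))\<^sup>2)" by simp
    qed
  qed measurable
qed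

quotient_type 'd l2 = "real ^ 'd \<Rightarrow> real ^ 'd" / partial: "l2_rel"
proof (rule part_equivpI)
  show "\<exists>f. l2_rel f f"
    using square_integrable_const by (auto simp: l2_rel_def)
  show "symp l2_rel"
    by (auto simp: symp_def l2_rel_def)
  show "transp l2_rel"
    by (auto simp: transp_def l2_rel_def)
qed

instantiation l2 :: (finite) real_vector
begin

lift_definition zero_l2 :: "'a l2" is "\<lambda>_. 0"
  by (simp add: l2_rel_def square_integrable_const)

lift_definition plus_l2 :: "'a l2 \<Rightarrow> 'a l2 \<Rightarrow> 'a l2" is "\<lambda>f g z. f z + g z"
  by (auto simp: l2_rel_def square_integrable_add)

lift_definition minus_l2 :: "'a l2 \<Rightarrow> 'a l2 \<Rightarrow> 'a l2" is "\<lambda>f g z. f z - g z"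
  by (auto simp: l2_rel_def square_integrable_diff)

lift_definition uminus_l2 :: "'a l2 \<Rightarrow> 'a l2" is "\<lambda>f z. - f z"
  by (auto simp: l2_rel_def square_integrable_minus)

lift_definition scaleR_l2 :: "real \<Rightarrow> 'a l2 \<Rightarrow> 'a l2" is "\<lambda>r f z. r *\<^sub>R f z"
  by (auto simp: l2_rel_def square_integrable_scaleR)

instance
proof
  fix M N P :: "'a l2" and r s :: real
  show "M + N + P = M + (N + P)"
    by transfer (auto simp: l2_rel_def add.assoc intro!: square_integrable_add)
  show "M + N = N + M"
    by transfer (auto simp: l2_rel_def add.commute intro!: square_integrable_add)
  show "0 + M = M"
    by transfer (auto simp: l2_rel_def)
  show "- M + M = 0"
    by transfer (auto simp: l2_rel_def square_integrable_const)
  show "M - N = M + - N"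
    by transfer (auto simp: l2_rel_def square_integrable_diff
        intro!: square_integrable_add square_integrable_minus)
  show "r *\<^sub>R (M + N) = r *\<^sub>R M + r *\<^sub>R N"
    by transfer (auto simp: l2_rel_def scaleR_add_right
        intro!: square_integrable_add square_integrable_scaleR)
  show "(r + s) *\<^sub>R M = r *\<^sub>R M + s *\<^sub>R M"
    by transfer (auto simp: l2_rel_def scaleR_add_left
        intro!: square_integrable_add square_integrable_scaleR)
  show "r *\<^sub>R s *\<^sub>R M = (r * s) *\<^sub>R M"
    by transfer (auto simp: l2_rel_def intro!: square_integrable_scaleR)
  show "1 *\<^sub>R M = M"
    by transfer (auto simp: l2_rel_def)
qed

end

instantiation l2 :: (finite) real_inner
begin

lift_definition inner_l2 :: "'a l2 \<Rightarrow> 'a l2 \<Rightarrow> real"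
  is "\<lambda>f g. \<integral>z. f z \<bullet> g z \<partial>cube_measure"
proof -
  fix f f' g g' :: "real ^ 'a \<Rightarrow> real ^ 'a"
  assume A: "l2_rel f f'" "l2_rel g g'"
  then have "AE z in cube_measure. f z = f' z" "AE z in cube_measure. g z = g' z"
    by (auto simp: l2_rel_def)
  then have "AE z in cube_measure. f z \<bullet> g z = f' z \<bullet> g' z"
    by eventually_elim simp
  moreover have "(\<lambda>z. f z \<bullet> g z) \<in> borel_measurable cube_measure"
    "(\<lambda>z. f' z \<bullet> g' z) \<in> borel_measurable cube_measure"
    using A by (auto simp: l2_rel_def intro!: borel_measurable_inner square_integrable_measurable)
  ultimately show "(\<integral>z. f z \<bullet> g z \<partial>cube_measure) = (\<integral>z. f' z \<bullet> g' z \<partial>cube_measure)"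
    by (intro integral_cong_AE)
qed

definition norm_l2 :: "'a l2 \<Rightarrow> real"
  where "norm_l2 M = sqrt (inner M M)"

definition sgn_l2 :: "'a l2 \<Rightarrow> 'a l2"
  where "sgn_l2 M = M /\<^sub>R norm M"

definition dist_l2 :: "'a l2 \<Rightarrow> 'a l2 \<Rightarrow> real"
  where "dist_l2 M N = norm (M - N)"

definition uniformity_l2 :: "('a l2 \<times> 'a l2) filter"
  where "uniformity_l2 = (INF e\<in>{0<..}. principal {(M, N). dist M N < e})"

definition open_l2 :: "'a l2 set \<Rightarrow> bool"
  where "open_l2 U \<longleftrightarrow> (\<forall>M\<in>U. eventually (\<lambda>(M', N). M' = M \<longrightarrow> N \<in> U) uniformity)"

instance
proof
  fix M N P :: "'a l2" and r :: real
  show "dist M N = norm (M - N)"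
    by (rule dist_l2_def)
  show "sgn M = M /\<^sub>R norm M"
    by (rule sgn_l2_def)
  show "(uniformity :: ('a l2 \<times> 'a l2) filter) =
      (INF e\<in>{0<..}. principal {(M, N). dist M N < e})"
    by (rule uniformity_l2_def)
  show "open U \<longleftrightarrow> (\<forall>M\<in>U. eventually (\<lambda>(M', N). M' = M \<longrightarrow> N \<in> U) uniformity)"
    for U :: "'a l2 set"
    by (rule open_l2_def)
  show "inner M N = inner N M"
    by transfer (simp add: inner_commute)
  show "inner (M + N) P = inner M P + inner N P"
    by transfer (simp add: l2_rel_def inner_add_left integrable_inner_square_integrable)
  show "inner (r *\<^sub>R M) N = r * inner M N"
    by transfer (simp add: l2_rel_def)
  show "0 \<le> inner M M"
    by transfer simp
  show "inner M M = 0 \<longleftrightarrow> M = 0"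
  proof transfer
    fix f :: "real ^ 'a \<Rightarrow> real ^ 'a"
    assume "l2_rel f f"
    then have f: "square_integrable f" by (simp add: l2_rel_def)
    have "(\<integral>z. f z \<bullet> f z \<partial>cube_measure) = 0 \<longleftrightarrow> (AE z in cube_measure. f z \<bullet> f z = 0)"
      by (intro integral_nonneg_eq_0_iff_AE integrable_inner_square_integrable f) simp
    then show "(\<integral>z. f z \<bullet> f z \<partial>cube_measure) = 0 \<longleftrightarrow> l2_rel f (\<lambda>_. 0)"
      using f by (simp add: l2_rel_def square_integrable_const)
  qed
  show "norm M = sqrt (inner M M)"
    by (rule norm_l2_def)
qed

end

lift_definition const_l2 :: "real ^ 'd::finite \<Rightarrow> 'd l2" is "\<lambda>c z. c"
  by (simp add: l2_rel_def square_integrable_const)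

definition integer_valued :: "'d::finite l2 \<Rightarrow> bool"
  where "integer_valued Z \<longleftrightarrow> (AE z in cube_measure. \<forall>i. rep_l2 Z z $ i \<in> \<int>)"

definition cube_automorphisms :: "(real ^ 'd \<Rightarrow> real ^ 'd) set"
  where "cube_automorphisms = {G.
    bij_betw G cube cube \<and>
    G \<in> measurable cube_measure cube_measure \<and>
    the_inv_into cube G \<in> measurable cube_measure cube_measure \<and>
    distr cube_measure cube_measure G = cube_measure \<and>
    distr cube_measure cube_measure (the_inv_into cube G) = cube_measure}"

text \<open>For \<open>G\<close> in \<open>cube_automorphisms\<close> the class of the composition does not depend on the
  representative, because \<open>G\<close> preserves null sets.\<close>

definition compose_l2 :: "'d::finite l2 \<Rightarrow> (real ^ 'd \<Rightarrow> real ^ 'd) \<Rightarrow> 'd l2"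
  where "compose_l2 M G = abs_l2 (rep_l2 M \<circ> G)"

lemma square_integrable_compose:
  assumes G: "G \<in> cube_automorphisms" and f: "square_integrable f"
  shows "square_integrable (f \<circ> G)"
proof -
  have [measurable]: "G \<in> measurable cube_measure cube_measure"
    "f \<in> borel_measurable cube_measure"
    using G f by (simp_all add: cube_automorphisms_def square_integrable_def)
  have D: "distr cube_measure cube_measure G = cube_measure"
    using G by (simp add: cube_automorphisms_def)
  have "integrable (distr cube_measure cube_measure G) (\<lambda>z. (norm (f z))\<^sup>2)"
    using f by (simp add: D square_integrable_def)
  then show ?thesis
    by (simp add: square_integrable_def integrable_distr_eq)
qed

lemma abs_l2_compose:
  assumes G: "G \<in> cube_automorphisms" and f: "square_integrable f"
  shows "compose_l2 (abs_l2 f) G = abs_l2 (f \<circ> G)"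
proof -
  have G' [measurable]: "G \<in> measurable cube_measure cube_measure"
    using G by (simp add: cube_automorphisms_def)
  have D: "distr cube_measure cube_measure G = cube_measure"
    using G by (simp add: cube_automorphisms_def)
  have "l2_rel f f" using f by (simp add: l2_rel_def)
  then have R: "l2_rel (rep_l2 (abs_l2 f)) f"
    by (rule rep_abs_rsp_left[OF Quotient3_l2])
  then have "AE z in distr cube_measure cube_measure G. rep_l2 (abs_l2 f) z = f z"
    unfolding D by (simp add: l2_rel_def)
  then have "AE z in cube_measure. rep_l2 (abs_l2 f) (G z) = f (G z)"
    by (rule AE_distrD[OF G'])
  then have "l2_rel (rep_l2 (abs_l2 f) \<circ> G) (f \<circ> G)"
    using R square_integrable_compose[OF G] by (simp add: l2_rel_def)
  then show ?thesis
    unfolding compose_l2_def by (rule Quotient3_rel_abs[OF Quotient3_l2])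
qed

section \<open>Gradients, Lagrangian and Hamiltonian\<close>

definition grad :: "('a::real_inner \<Rightarrow> real) \<Rightarrow> 'a \<Rightarrow> 'a"
  where "grad f x = (THE D. GDERIV f x :> D)"

lemma grad_eq:
  assumes "GDERIV f x :> D"
  shows "grad f x = D"
  unfolding grad_def
proof (rule the_equality[of _ D])
  show "GDERIV f x :> D" by (rule assms)
  fix E assume "GDERIV f x :> E"
  then have "(\<lambda>h. h \<bullet> E) = (\<lambda>h. h \<bullet> D)"
    using assms unfolding gderiv_def by (rule has_derivative_unique)
  then have "(E - D) \<bullet> (E - D) = 0"
    by (metis inner_diff_right diff_self)
  then show "E = D" by simp
qed

definition D_x :: "('d::finite l2 \<Rightarrow> 'd l2 \<Rightarrow> real) \<Rightarrow> 'd l2 \<Rightarrow> 'd l2 \<Rightarrow> 'd l2"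
  where "D_x L M N = grad (\<lambda>M'. L M' N) M"

definition D_v :: "('d::finite l2 \<Rightarrow> 'd l2 \<Rightarrow> real) \<Rightarrow> 'd l2 \<Rightarrow> 'd l2 \<Rightarrow> 'd l2"
  where "D_v L M N = grad (\<lambda>N'. L M N') N"

definition locally_uniformly_continuous :: "('a::metric_space \<Rightarrow> 'b::metric_space) \<Rightarrow> bool"
  where "locally_uniformly_continuous f \<longleftrightarrow>
    (\<forall>x. \<exists>r>0. uniformly_continuous_on (ball x r) f)"

definition tilted :: "('d::finite l2 \<Rightarrow> 'd l2 \<Rightarrow> real) \<Rightarrow> real ^ 'd \<Rightarrow> 'd l2 \<Rightarrow> 'd l2 \<Rightarrow> real"
  where "tilted L c M N = L M N + (\<integral>z. c \<bullet> rep_l2 N z \<partial>cube_measure)"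

text \<open>A real supremum: for the Lagrangians considered here \<open>L M\<close> grows quadratically, so the set
  is bounded above.\<close>

definition hamiltonian :: "('d::finite l2 \<Rightarrow> 'd l2 \<Rightarrow> real) \<Rightarrow> 'd l2 \<Rightarrow> 'd l2 \<Rightarrow> real"
  where "hamiltonian L M P = (SUP N. - (P \<bullet> N) - L M N)"

definition shifted_hamiltonian ::
    "('d::finite l2 \<Rightarrow> 'd l2 \<Rightarrow> real) \<Rightarrow> real ^ 'd \<Rightarrow> 'd l2 \<Rightarrow> 'd l2 \<Rightarrow> real"
  where "shifted_hamiltonian L c M P = hamiltonian L M (P + const_l2 c)"

definition D_p :: "('d::finite l2 \<Rightarrow> 'd l2 \<Rightarrow> real) \<Rightarrow> 'd l2 \<Rightarrow> 'd l2 \<Rightarrow> 'd l2"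
  where "D_p H M P = grad (\<lambda>P'. H M P') P"

section \<open>Curves and the discounted value function\<close>

definition AC2 :: "real \<Rightarrow> (real \<Rightarrow> 'a::real_normed_vector) \<Rightarrow> bool"
  where "AC2 T x \<longleftrightarrow> (\<exists>\<beta>::real \<Rightarrow> real.
    set_borel_measurable lborel {0<..<T} \<beta> \<and>
    set_integrable lborel {0<..<T} (\<lambda>u. (\<beta> u)\<^sup>2) \<and>
    (\<forall>s t. 0 < s \<and> s < t \<and> t < T \<longrightarrow> norm (x t - x s) \<le> (LINT u:{s..t}|lborel. \<beta> u)))"

definition AC2_loc :: "(real \<Rightarrow> 'a::real_normed_vector) \<Rightarrow> bool"
  where "AC2_loc x \<longleftrightarrow> (\<forall>T>0. AC2 T x)"

text \<open>A curve is a total function of which only the values at positive times matter; its initial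
  value is the limit at \<open>0\<close>.\<close>

definition admissible :: "'a::real_normed_vector \<Rightarrow> (real \<Rightarrow> 'a) set"
  where "admissible M = {x. AC2_loc x \<and> (x \<longlongrightarrow> M) (at_right 0)}"

text \<open>The integral of the integrand over the positive half-line may be \<open>+\<infinity>\<close>, hence positive minus
  negative part instead of the Bochner integral. Under the assumptions on the Lagrangian the tilted
  Lagrangian is bounded below, so the negative part has a finite integral.\<close>

definition discounted_cost ::
    "real \<Rightarrow> ('d::finite l2 \<Rightarrow> 'd l2 \<Rightarrow> real) \<Rightarrow> (real \<Rightarrow> 'd l2) \<Rightarrow> ereal"
  where "discounted_cost \<epsilon> L x =
    (let f = (\<lambda>t. exp (- (\<epsilon> * t)) * L (x t) (vector_derivative x (at t)))
     in enn2ereal (\<integral>\<^sup>+t\<in>{0<..}. ennreal (f t) \<partial>lborel)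
        - enn2ereal (\<integral>\<^sup>+t\<in>{0<..}. ennreal (- f t) \<partial>lborel))"

definition value_ereal :: "real \<Rightarrow> ('d::finite l2 \<Rightarrow> 'd l2 \<Rightarrow> real) \<Rightarrow> 'd l2 \<Rightarrow> ereal"
  where "value_ereal \<epsilon> L M = (INF x\<in>admissible M. discounted_cost \<epsilon> L x)"

text \<open>Under the assumptions on the Lagrangian the infimum is finite: the cost is bounded below, and
  constant curves have finite cost.\<close>

definition value_fn :: "real \<Rightarrow> ('d::finite l2 \<Rightarrow> 'd l2 \<Rightarrow> real) \<Rightarrow> 'd l2 \<Rightarrow> real"
  where "value_fn \<epsilon> L M = real_of_ereal (value_ereal \<epsilon> L M)"

definition is_minimizer ::
    "real \<Rightarrow> ('d::finite l2 \<Rightarrow> 'd l2 \<Rightarrow> real) \<Rightarrow> 'd l2 \<Rightarrow> (real \<Rightarrow> 'd l2) \<Rightarrow> bool"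
  where "is_minimizer \<epsilon> L M x \<longleftrightarrow> x \<in> admissible M \<and> discounted_cost \<epsilon> L x = value_ereal \<epsilon> L M"

end

theory Submission
  imports Defs
begin

text \<open>The two quadratic estimates on the Lagrangian say that its gradient is globally Lipschitz and
  that its velocity gradient is strongly monotone. So the relation between velocity and momentum can
  be inverted by a Lipschitz map, and the Euler-Lagrange equation becomes a globally Lipschitz system
  for position and momentum. Its solution \<open>x\<close> with initial position \<open>M\<close> and initial momentum
  \<open>- \<nabla>V(M)\<close> is the candidate for the minimizer (\<open>euler_lagrange_flow\<close>).

  In infinite dimensions there is no compactness that would let minimizing sequences converge.
  Differentiability of the value function at \<open>M\<close> replaces it. Let \<open>y\<close> start at \<open>M\<close> and have cost at
  most \<open>V(M) + \<delta>\<close>, and let \<open>\<psi>\<close> be a variation that vanishes after time \<open>T\<close>. The curve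
  \<open>y - r \<psi>\<close> starts at \<open>M - r \<psi>(0)\<close>, so its cost is at least
  \<open>V(M) - r \<langle>\<nabla>V(M), \<psi>(0)\<rangle> - o(r)\<close>; by the upper quadratic estimate it is at most
  \<open>V(M) + \<delta> - r \<ell>\<^sub>y(\<psi>) + O(r\<^sup>2)\<close>, where \<open>\<ell>\<^sub>y\<close> is the first variation of the cost at \<open>y\<close>. For the
  extremal \<open>x\<close>, integration by parts gives exactly \<open>\<ell>\<^sub>x(\<psi>) = \<langle>\<nabla>V(M), \<psi>(0)\<rangle>\<close>. Therefore
  \<open>\<ell>\<^sub>y(\<psi>) - \<ell>\<^sub>x(\<psi>)\<close> is at most \<open>\<delta>/r + o(1)\<close>. Now choose \<open>\<psi>\<close> with \<open>\<psi>' = exp(- \<mu> t) (y' - x')\<close>. Strong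
  monotonicity makes the difference of first variations at least a multiple of
  \<open>J = \<integral>\<^sub>0\<^sup>T exp(- \<mu> t) \<bar>y' - x'\<bar>\<^sup>2 dt\<close>, once \<open>\<mu>\<close> is so large that the lower order terms are
  absorbed (\<open>value_along_variation\<close>). Optimizing over \<open>r\<close> shows that \<open>J\<close> tends to \<open>0\<close> with \<open>\<delta>\<close>
  (\<open>near_minimizers_converge\<close>). Passing to the limit along near-minimizers, \<open>x\<close> has cost at most
  \<open>V(M)\<close>; a minimizer \<open>y\<close> has \<open>J = 0\<close> for every \<open>T\<close> and hence equals \<open>x\<close>.

  The cost involves the pointwise derivative of an absolutely continuous curve, and all integrations
  by parts need the fundamental theorem of calculus for such curves. Both rest on \<open>ae_derivative\<close>:
  for curves in a Hilbert space, the dyadic difference quotients form a martingale that is bounded in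
  the mean square, hence converges, and a maximal inequality turns this into differentiability almost
  everywhere. The formula for the initial velocity is the first order condition in the supremum that
  defines the Hamiltonian (\<open>GDERIV_hamiltonian\<close>).\<close>

section \<open>Completeness of the space of square integrable maps\<close>

lemma convergent_if_eventually_geometric_steps:
  fixes f :: "nat \<Rightarrow> 'a::banach"
  assumes "\<forall>\<^sub>F k in sequentially. norm (f (Suc k) - f k) \<le> (1/2) ^ k"
  shows "convergent f"
proof -
  have "summable (\<lambda>k. f (Suc k) - f k)"
    by (rule summable_comparison_test_ev[OF assms summable_geometric]) simp
  then have "convergent (\<lambda>n. \<Sum>k<n. f (Suc k) - f k)"
    unfolding summable_iff_convergent .
  then have "convergent (\<lambda>n. f n - f 0)"
    unfolding sum_lessThan_telescope .
  from convergent_add[OF this convergent_const[of "f 0"]] show ?thesis by simp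
qed

text \<open>Along a subsequence whose steps have mean square below \<open>(1/8)^n\<close>, Markov's inequality and
  Borel-Cantelli bound almost every step by \<open>(1/2)^n\<close>.\<close>

lemma (in finite_measure) AE_convergent_subseq_L2:
  fixes u :: "nat \<Rightarrow> 'a \<Rightarrow> 'b::banach"
  assumes int: "\<And>m n. integrable M (\<lambda>t. (norm (u m t - u n t))\<^sup>2)"
    and cauchy: "\<And>e. e > 0 \<Longrightarrow> \<exists>N. \<forall>m\<ge>N. \<forall>n\<ge>N. (\<integral>t. (norm (u m t - u n t))\<^sup>2 \<partial>M) < e"
  obtains r where "strict_mono r" "AE t in M. convergent (\<lambda>k. u (r k) t)"
proof -
  have "\<exists>r. \<forall>n. (\<forall>i\<ge>r n. \<forall>j\<ge>r n. (\<integral>t. (norm (u i t - u j t))\<^sup>2 \<partial>M) < (1/8) ^ n) \<and> r n < r (Suc n)"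
  proof (intro dependent_nat_choice, goal_cases)
    case 1
    show ?case using cauchy[of "(1/8) ^ 0"] by auto
  next
    case (2 x n)
    obtain N where N: "\<forall>i\<ge>N. \<forall>j\<ge>N. (\<integral>t. (norm (u i t - u j t))\<^sup>2 \<partial>M) < (1/8) ^ Suc n"
      using cauchy[of "(1/8) ^ Suc n"] by auto
    show ?case by (rule exI[of _ "max N (Suc x)"]) (use N in auto)
  qed
  then obtain r where r': "\<forall>n. (\<forall>i\<ge>r n. \<forall>j\<ge>r n. (\<integral>t. (norm (u i t - u j t))\<^sup>2 \<partial>M) < (1/8) ^ n) \<and> r n < r (Suc n)"
    by blast
  then have r: "\<And>n i j. i \<ge> r n \<Longrightarrow> j \<ge> r n \<Longrightarrow> (\<integral>t. (norm (u i t - u j t))\<^sup>2 \<partial>M) < (1/8) ^ n"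
    by blast
  have sm: "strict_mono r" using r' by (simp add: strict_mono_Suc_iff)
  define A where "A k = {t \<in> space M. (1/4) ^ k \<le> (norm (u (r (Suc k)) t - u (r k) t))\<^sup>2}" for k
  have A_meas: "A k \<in> sets M" for k
    using borel_measurable_integrable[OF int] unfolding A_def by measurable
  have A_le: "measure M (A k) \<le> (1/2) ^ k" for k
  proof -
    have "measure M (A k) \<le> (\<integral>t. (norm (u (r (Suc k)) t - u (r k) t))\<^sup>2 \<partial>M) / (1/4) ^ k"
      unfolding A_def by (rule integral_Markov_inequality_measure[OF int, where A = "space M"]) auto
    also have "\<dots> \<le> (1/8) ^ k / (1/4) ^ k"
      using r[of k "r (Suc k)" "r k"] sm
      by (intro divide_right_mono less_imp_le) (auto simp: strict_mono_less_eq)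
    also have "\<dots> = (1/2) ^ k"
      unfolding power_divide[symmetric] by simp
    finally show ?thesis .
  qed
  have "AE t in M. eventually (\<lambda>k. t \<in> space M - A k) sequentially"
  proof (rule borel_cantelli_AE1)
    show "summable (\<lambda>n. measure M (A n))"
      by (rule summable_comparison_test'[OF summable_geometric[of "1/2::real"], where N = 0])
         (use A_le in auto)
  qed (use A_meas in \<open>auto simp: emeasure_eq_measure\<close>)
  then have "AE t in M. convergent (\<lambda>k. u (r k) t)"
  proof eventually_elim
    case (elim t)
    then have "\<forall>\<^sub>F k in sequentially. norm (u (r (Suc k)) t - u (r k) t) \<le> (1/2) ^ k"
    proof eventually_elim
      case (elim k)
      then have "(norm (u (r (Suc k)) t - u (r k) t))\<^sup>2 \<le> ((1/2) ^ k)\<^sup>2"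
        unfolding A_def power_mult[symmetric] mult.commute[of k] unfolding power_mult
        by (auto simp: power2_eq_square[of "1/2"])
      then show ?case by (rule power2_le_imp_le) simp
    qed
    then show ?case by (rule convergent_if_eventually_geometric_steps)
  qed
  then show ?thesis using sm that by blast
qed

text \<open>The Riesz-Fischer theorem. It is stated through the real functions \<open>norm (u m t - u n t)\<close>
  because differences of Borel maps into a nonseparable space may fail to be Borel. The limit \<open>v\<close> is the everywhere limit of the subsequence, modified
  to \<open>u 0\<close> off the measurable set \<open>D\<close> of convergence. Fatou's lemma gives the convergence in mean square.\<close>

lemma (in finite_measure) L2_Cauchy_imp_limit:
  fixes u :: "nat \<Rightarrow> 'a \<Rightarrow> 'b::banach"
  assumes meas: "\<And>m n. (\<lambda>t. norm (u m t - u n t)) \<in> borel_measurable M"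
    and int: "\<And>m n. integrable M (\<lambda>t. (norm (u m t - u n t))\<^sup>2)"
    and cauchy: "\<And>e. e > 0 \<Longrightarrow> \<exists>N. \<forall>m\<ge>N. \<forall>n\<ge>N. (\<integral>t. (norm (u m t - u n t))\<^sup>2 \<partial>M) < e"
  obtains r D v where "strict_mono r" "D \<in> sets M" "AE t in M. t \<in> D"
    "\<And>t. t \<in> space M \<Longrightarrow> (\<lambda>k. if t \<in> D then u (r k) t else u 0 t) \<longlonglongrightarrow> v t"
    "\<And>n. (\<lambda>t. norm (u n t - v t)) \<in> borel_measurable M"
    "\<And>n. integrable M (\<lambda>t. (norm (u n t - v t))\<^sup>2)"
    "(\<lambda>n. \<integral>t. (norm (u n t - v t))\<^sup>2 \<partial>M) \<longlonglongrightarrow> 0"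
proof -
  obtain r where r: "strict_mono r" and conv: "AE t in M. convergent (\<lambda>k. u (r k) t)"
    using AE_convergent_subseq_L2[OF int cauchy] by blast
  define D where "D = {t \<in> space M. convergent (\<lambda>k. u (r k) t)}"
  (* Off D the constant sequence u 0 makes the modified sequence converge everywhere. *)
  define w where "w k t = (if t \<in> D then u (r k) t else u 0 t)" for k t
  define v where "v t = lim (\<lambda>k. w k t)" for t
  have "D = {t \<in> space M. \<forall>j::nat. \<exists>N. \<forall>m\<ge>N. \<forall>n\<ge>N. norm (u (r m) t - u (r n) t) < inverse (Suc j)}"
    unfolding D_def Cauchy_convergent_iff[symmetric] Cauchy_def dist_norm
  proof safe
    fix t j assume "\<forall>e>0. \<exists>N. \<forall>m\<ge>N. \<forall>n\<ge>N. norm (u (r m) t - u (r n) t) < e"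
    then show "\<exists>N. \<forall>m\<ge>N. \<forall>n\<ge>N. norm (u (r m) t - u (r n) t) < inverse (real (Suc j))" 
      by (rule allE[of _ "inverse (real (Suc j))"]) simp
  next
    fix t and e :: real assume *: "\<forall>j. \<exists>N. \<forall>m\<ge>N. \<forall>n\<ge>N. norm (u (r m) t - u (r n) t) < inverse (real (Suc j))" "e > 0"
    then obtain j where "inverse (real (Suc j)) < e" using reals_Archimedean by blast
    then show "\<exists>N. \<forall>m\<ge>N. \<forall>n\<ge>N. norm (u (r m) t - u (r n) t) < e" 
      using *(1) by (meson less_trans)
  qed
  then have D: "D \<in> sets M" using meas by simp
  have AE_D: "AE t in M. t \<in> D" using conv AE_space by eventually_elim (simp add: D_def)
  have lim_w: "(\<lambda>k. w k t) \<longlonglongrightarrow> v t" for t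
  proof -
    have "convergent (\<lambda>k. w k t)"
      by (cases "t \<in> D") (auto simp: w_def convergent_const D_def)
    then show ?thesis unfolding v_def by (simp add: convergent_LIMSEQ_iff)
  qed
  have meas_w: "(\<lambda>t. norm (u n t - w k t)) \<in> borel_measurable M" for n k
  proof -
    have "(\<lambda>t. if t \<in> D then norm (u n t - u (r k) t) else norm (u n t - u 0 t)) \<in> borel_measurable M"
      by (rule measurable_If_set) (use meas D sets.sets_into_space[OF D] in \<open>auto simp: Int_absorb2\<close>)
    also have "(\<lambda>t. if t \<in> D then norm (u n t - u (r k) t) else norm (u n t - u 0 t)) = (\<lambda>t. norm (u n t - w k t))"
      by (auto simp: w_def)
    finally show ?thesis .
  qed
  have meas_v: "(\<lambda>t. norm (u n t - v t)) \<in> borel_measurable M" for n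
    by (rule borel_measurable_LIMSEQ_real[OF tendsto_norm[OF tendsto_diff[OF tendsto_const lim_w]] meas_w])
  have bound: "(\<integral>\<^sup>+t. ennreal ((norm (u n t - v t))\<^sup>2) \<partial>M) \<le> ennreal e"
    if n: "n \<ge> N" and N: "\<forall>m\<ge>N. \<forall>n\<ge>N. (\<integral>t. (norm (u m t - u n t))\<^sup>2 \<partial>M) < e" for n N e
  proof -
    have "(\<integral>\<^sup>+t. ennreal ((norm (u n t - v t))\<^sup>2) \<partial>M) 
        = (\<integral>\<^sup>+t. liminf (\<lambda>k. ennreal ((norm (u n t - w k t))\<^sup>2)) \<partial>M)"
      by (intro nn_integral_cong lim_imp_Liminf[symmetric] tendsto_intros tendsto_ennrealI lim_w) auto
    also have "\<dots> \<le> liminf (\<lambda>k. \<integral>\<^sup>+t. ennreal ((norm (u n t - w k t))\<^sup>2) \<partial>M)"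
      by (rule nn_integral_liminf) (use meas_w in measurable)
    also have "\<dots> \<le> ennreal e"
    proof (rule Liminf_le)
      show "\<forall>\<^sub>F k in sequentially. (\<integral>\<^sup>+t. ennreal ((norm (u n t - w k t))\<^sup>2) \<partial>M) \<le> ennreal e"
        using eventually_ge_at_top[of N]
      proof eventually_elim
        case (elim k)
        have "(\<integral>\<^sup>+t. ennreal ((norm (u n t - w k t))\<^sup>2) \<partial>M) = (\<integral>\<^sup>+t. ennreal ((norm (u n t - u (r k) t))\<^sup>2) \<partial>M)"
          by (rule nn_integral_cong_AE, use AE_D in eventually_elim) (simp add: w_def)
        also have "\<dots> = ennreal (\<integral>t. (norm (u n t - u (r k) t))\<^sup>2 \<partial>M)"
          by (rule nn_integral_eq_integral[OF int]) auto
        also have "\<dots> \<le> ennreal e"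
          using N n elim seq_suble[OF r, of k] by (intro ennreal_leI less_imp_le) auto
        finally show ?case .
      qed
    qed auto
    finally show ?thesis .
  qed
  have int_big: "integrable M (\<lambda>t. (norm (u n t - v t))\<^sup>2)" 
    if n: "n \<ge> N" and N: "\<forall>m\<ge>N. \<forall>n\<ge>N. (\<integral>t. (norm (u m t - u n t))\<^sup>2 \<partial>M) < e" for n N e
    by (rule integrableI_bounded)
       (use meas_v bound[OF that] in \<open>auto intro: le_less_trans\<close>)
  have int_v: "integrable M (\<lambda>t. (norm (u n t - v t))\<^sup>2)" for n
  proof -
    obtain N where N: "\<forall>m\<ge>N. \<forall>n\<ge>N. (\<integral>t. (norm (u m t - u n t))\<^sup>2 \<partial>M) < 1" using cauchy[of 1] by auto
    have "integrable M (\<lambda>t. 2 * (norm (u n t - u N t))\<^sup>2 + 2 * (norm (u N t - v t))\<^sup>2)"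
      using int int_big[OF _ N] by auto
    then show ?thesis
    proof (rule Bochner_Integration.integrable_bound)
      show "AE t in M. norm ((norm (u n t - v t))\<^sup>2) \<le> norm (2 * (norm (u n t - u N t))\<^sup>2 + 2 * (norm (u N t - v t))\<^sup>2)"
      proof (rule AE_I2)
        fix t
        have "norm (u n t - v t) \<le> norm (u n t - u N t) + norm (u N t - v t)"
          by (metis norm_diff_triangle_ineq norm_triangle_le add_diff_eq diff_add_cancel order_refl)
        then have "(norm (u n t - v t))\<^sup>2 \<le> (norm (u n t - u N t) + norm (u N t - v t))\<^sup>2"
          by (rule power_mono) simp
        also have "\<dots> \<le> 2 * (norm (u n t - u N t))\<^sup>2 + 2 * (norm (u N t - v t))\<^sup>2"
          using sum_squares_bound[of "norm (u n t - u N t)" "norm (u N t - v t)"] by (simp add: power2_sum)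
        finally show "norm ((norm (u n t - v t))\<^sup>2) \<le> norm (2 * (norm (u n t - u N t))\<^sup>2 + 2 * (norm (u N t - v t))\<^sup>2)"
          by simp
      qed
    qed (use meas_v in measurable)
  qed
  have "(\<lambda>n. \<integral>t. (norm (u n t - v t))\<^sup>2 \<partial>M) \<longlonglongrightarrow> 0"
  proof (rule LIMSEQ_I)
    fix e :: real assume "e > 0"
    then obtain N where N: "\<forall>m\<ge>N. \<forall>n\<ge>N. (\<integral>t. (norm (u m t - u n t))\<^sup>2 \<partial>M) < e / 2" 
      using cauchy[of "e / 2"] by auto
    have *: "(\<integral>t. (norm (u n t - v t))\<^sup>2 \<partial>M) \<le> e / 2" if "n \<ge> N" for n
      using bound[OF that N] \<open>e > 0\<close>
      by (subst (asm) nn_integral_eq_integral[OF int_v]) auto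
    show "\<exists>no. \<forall>n\<ge>no. norm ((\<integral>t. (norm (u n t - v t))\<^sup>2 \<partial>M) - 0) < e"
    proof (intro exI[of _ N] allI impI)
      fix n assume "n \<ge> N"
      moreover have "0 \<le> (\<integral>t. (norm (u n t - v t))\<^sup>2 \<partial>M)" by simp
      ultimately show "norm ((\<integral>t. (norm (u n t - v t))\<^sup>2 \<partial>M) - 0) < e"
        using *[OF \<open>n \<ge> N\<close>] \<open>e > 0\<close> unfolding real_norm_def by linarith
    qed
  qed
  with that[OF r D AE_D, of v] lim_w meas_v int_v show ?thesis by (simp add: w_def)
qed

lemma square_integrable_rep_l2: "square_integrable (rep_l2 M)"
  using Quotient3_rel_rep[OF Quotient3_l2, of M M] by (simp add: l2_rel_def)

lemma abs_rep_l2: "abs_l2 (rep_l2 M) = M"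
  by (rule Quotient3_abs_rep[OF Quotient3_l2])

lemma inner_abs_l2:
  assumes "square_integrable f" "square_integrable g"
  shows "abs_l2 f \<bullet> abs_l2 g = (\<integral>z. f z \<bullet> g z \<partial>cube_measure)"
  using assms by (subst inner_l2.abs_eq) (auto simp: l2_rel_def)

lemma norm_abs_l2_diff:
  assumes "square_integrable f" "square_integrable g"
  shows "(norm (abs_l2 f - abs_l2 g))\<^sup>2 = (\<integral>z. (norm (f z - g z))\<^sup>2 \<partial>cube_measure)"
proof -
  have "abs_l2 f - abs_l2 g = abs_l2 (\<lambda>z. f z - g z)"
    using assms by (subst minus_l2.abs_eq) (auto simp: l2_rel_def)
  then show ?thesis
    using assms by (simp add: power2_norm_eq_inner inner_abs_l2 square_integrable_diff)
qed

instance l2 :: (finite) complete_space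
proof
  fix X :: "nat \<Rightarrow> 'a l2"
  assume X: "Cauchy X"
  interpret finite_measure "cube_measure :: (real ^ 'a) measure" by (rule finite_measure_cube_measure)
  let ?M = "cube_measure :: (real ^ 'a) measure"
  define u where "u n = rep_l2 (X n)" for n
  have u: "square_integrable (u n)" for n by (simp add: u_def square_integrable_rep_l2)
  have [measurable]: "u n \<in> borel_measurable ?M" for n using u square_integrable_measurable by blast
  have normX: "(norm (X m - X n))\<^sup>2 = (\<integral>z. (norm (u m z - u n z))\<^sup>2 \<partial>?M)" for m n
    using norm_abs_l2_diff[OF u u, of m n] by (simp add: u_def abs_rep_l2)
  have int: "integrable ?M (\<lambda>z. (norm (u m z - u n z))\<^sup>2)" for m n
    using square_integrable_diff[OF u u] by (simp add: square_integrable_def)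
  have meas: "(\<lambda>z. norm (u m z - u n z)) \<in> borel_measurable ?M" for m n by measurable
  have cau: "\<exists>N. \<forall>m\<ge>N. \<forall>n\<ge>N. (\<integral>z. (norm (u m z - u n z))\<^sup>2 \<partial>?M) < e" if "e > 0" for e :: real
  proof -
    obtain N where "\<forall>m\<ge>N. \<forall>n\<ge>N. norm (X m - X n) < sqrt e"
      using CauchyD[OF X, of "sqrt e"] \<open>e > 0\<close> real_sqrt_gt_zero by blast
    then have "\<forall>m\<ge>N. \<forall>n\<ge>N. (norm (X m - X n))\<^sup>2 < (sqrt e)\<^sup>2"
      by (auto intro!: power_strict_mono)
    then show ?thesis using that by (intro exI[of _ N]) (simp add: normX)
  qed
  obtain r D v where rDv: "strict_mono r" "D \<in> sets ?M" "AE t in ?M. t \<in> D"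
    "\<And>t. t \<in> space ?M \<Longrightarrow> (\<lambda>k. if t \<in> D then u (r k) t else u 0 t) \<longlonglongrightarrow> v t"
    "\<And>n. (\<lambda>t. norm (u n t - v t)) \<in> borel_measurable ?M"
    "\<And>n. integrable ?M (\<lambda>t. (norm (u n t - v t))\<^sup>2)"
    "(\<lambda>n. \<integral>t. (norm (u n t - v t))\<^sup>2 \<partial>?M) \<longlonglongrightarrow> 0"
    using L2_Cauchy_imp_limit[OF meas int cau] by blast
  have [measurable]: "v \<in> borel_measurable ?M"
    by (rule borel_measurable_LIMSEQ_metric[OF _ rDv(4)]) (use rDv(2) in measurable)
  have "square_integrable (\<lambda>z. u 0 z - v z)"
    using rDv(6)[of 0] unfolding square_integrable_def by simp
  from square_integrable_diff[OF u[of 0] this] have v: "square_integrable v" by simp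
  have "(\<lambda>n. (norm (X n - abs_l2 v))\<^sup>2) \<longlonglongrightarrow> 0"
    using rDv(7) norm_abs_l2_diff[OF u v] by (simp add: u_def abs_rep_l2)
  then have "(\<lambda>n. sqrt ((norm (X n - abs_l2 v))\<^sup>2)) \<longlonglongrightarrow> sqrt 0"
    by (intro tendsto_real_sqrt) 
  then have "X \<longlonglongrightarrow> abs_l2 v"
    by (simp add: tendsto_norm_zero_iff LIM_zero_iff)
  then show "convergent X" by (auto simp: convergent_def)
qed

instance l2 :: (finite) banach ..

lemma inner_const_l2: "const_l2 c \<bullet> N = (\<integral>z. c \<bullet> rep_l2 N z \<partial>cube_measure)"
proof -
  have "const_l2 c = abs_l2 (\<lambda>z. c)" by (simp add: const_l2.abs_eq)
  then show ?thesis using inner_abs_l2[OF square_integrable_const square_integrable_rep_l2, of c N]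
    by (simp add: abs_rep_l2)
qed

section \<open>The Riesz representation theorem\<close>

text \<open>A minimizing sequence of \<open>norm x ^ 2 - 2 f x\<close> is Cauchy by the parallelogram law, and the first order
  condition at its limit is the representation.\<close>

lemma riesz_representation:
  fixes f :: "'a::{real_inner, complete_space} \<Rightarrow> real"
  assumes f: "bounded_linear f"
  shows "\<exists>q. \<forall>x. f x = x \<bullet> q"
proof -
  interpret bounded_linear f by (rule f)
  obtain B where B: "\<And>x. \<bar>f x\<bar> \<le> norm x * B" "B > 0" using pos_bounded by auto
  define E where "E x = (norm x)\<^sup>2 - 2 * f x" for x
  have E_lower: "- (B\<^sup>2) \<le> E x" for x
  proof -
    have "f x \<le> norm x * B" using B(1)[of x] by linarith
    moreover have "0 \<le> (norm x - B)\<^sup>2" by simp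
    ultimately show ?thesis unfolding E_def power2_diff by linarith
  qed
  then have bdd: "bdd_below (range E)" by (auto intro!: bdd_belowI)
  define m where "m = Inf (range E)"
  have m: "m \<le> E x" for x unfolding m_def by (rule cInf_lower) (auto simp: bdd)
  have "\<exists>x. E x < m + inverse (Suc n)" for n
  proof -
    have "\<exists>y\<in>range E. y < m + inverse (Suc n)" unfolding m_def
      by (subst cInf_less_iff[symmetric]) (auto simp: bdd)
    then show ?thesis by auto
  qed
  then obtain X where X: "\<And>n. E (X n) < m + inverse (Suc n)" by metis
  have par: "(norm (x - y))\<^sup>2 \<le> 2 * (E x - m) + 2 * (E y - m)" for x y
  proof -
    have "4 * m \<le> 4 * E ((1/2) *\<^sub>R (x + y))" using m by simp
    also have "\<dots> = (norm (x + y))\<^sup>2 - 4 * (f x + f y)"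
      by (simp only: E_def scaleR add norm_scaleR power_mult_distrib real_scaleR_def) (simp add: power2_eq_square, argo?)
    finally show ?thesis
      unfolding E_def by (simp add: power2_norm_eq_inner inner_simps inner_commute algebra_simps)
  qed
  have "Cauchy X"
  proof (rule CauchyI)
    fix e :: real assume "e > 0"
    then have "e\<^sup>2 / 4 > 0" by simp
    then obtain N where N: "inverse (real (Suc N)) < e\<^sup>2 / 4" using reals_Archimedean by blast
    have *: "norm (X i - X j) < e" if "i \<ge> N" "j \<ge> N" for i j
    proof -
      have "inverse (real (Suc i)) \<le> inverse (real (Suc N))" "inverse (real (Suc j)) \<le> inverse (real (Suc N))"
        using that by (simp_all add: le_imp_inverse_le)
      then have "(norm (X i - X j))\<^sup>2 < e\<^sup>2"
        using par[of "X i" "X j"] X[of i] X[of j] N by argo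
      then show ?thesis using \<open>e > 0\<close> by (simp add: power2_less_imp_less)
    qed
    show "\<exists>N. \<forall>m\<ge>N. \<forall>n\<ge>N. norm (X m - X n) < e" using * by blast
  qed
  then obtain q where q: "X \<longlonglongrightarrow> q" using Cauchy_convergent_iff convergent_def by blast
  have "(\<lambda>n. E (X n)) \<longlonglongrightarrow> E q" unfolding E_def by (intro tendsto_intros q tendsto)
  moreover have "(\<lambda>n. m + inverse (Suc n)) \<longlonglongrightarrow> m + 0"
    by (intro tendsto_add tendsto_const LIMSEQ_inverse_real_of_nat)
  ultimately have "E q \<le> m + 0" using X by (intro LIMSEQ_le) (auto intro: less_imp_le)
  then have min: "E q \<le> E x" for x using m[of x] by linarith
  have "f x = x \<bullet> q" for x
  proof -
    define d where "d = f x - x \<bullet> q"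
    have "2 * s * d \<le> s\<^sup>2 * (norm x)\<^sup>2" for s
    proof -
      have "E (q + s *\<^sub>R x) = E q + 2 * s * (x \<bullet> q) + s\<^sup>2 * (norm x)\<^sup>2 - 2 * s * f x"
        unfolding E_def power2_norm_eq_inner
        by (simp add: add scaleR inner_simps inner_commute algebra_simps power2_eq_square)
      then show ?thesis using min[of "q + s *\<^sub>R x"] by (simp add: d_def algebra_simps)
    qed
    note opt = this
    define n where "n = (norm x)\<^sup>2"
    have "n \<ge> 0" by (simp add: n_def)
    then have "2 * (d / (n + 1)) * d * (n + 1)\<^sup>2 \<le> (d / (n + 1))\<^sup>2 * n * (n + 1)\<^sup>2"
      using opt[of "d / (n + 1)"] by (intro mult_right_mono) (simp_all add: n_def)
    then have "2 * d\<^sup>2 * (n + 1) \<le> d\<^sup>2 * n"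
      using \<open>n \<ge> 0\<close> by (simp add: power2_eq_square)
    then have "n * d\<^sup>2 + 2 * d\<^sup>2 \<le> 0" by (simp add: algebra_simps)
    moreover have "0 \<le> n * d\<^sup>2" using \<open>n \<ge> 0\<close> by simp
    ultimately have "d\<^sup>2 \<le> 0" by linarith
    then have "d = 0" by simp
    then show ?thesis by (simp add: d_def)
  qed
  then show ?thesis by blast
qed

lemma GDERIV_grad:
  fixes f :: "'a::{real_inner, complete_space} \<Rightarrow> real"
  assumes "f differentiable (at x)" shows "GDERIV f x :> grad f x"
proof -
  obtain f' where f': "(f has_derivative f') (at x)" using assms by (auto simp: differentiable_def)
  obtain q where "\<forall>x. f' x = x \<bullet> q" using riesz_representation has_derivative_bounded_linear[OF f'] by blast
  then have "f' = (\<lambda>x. x \<bullet> q)" by auto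
  then have "GDERIV f x :> q" using f' by (simp add: gderiv_def)
  then show ?thesis using grad_eq by metis
qed

section \<open>Integral inequalities on the real line\<close>

text \<open>The nonnegative quadratic polynomial \<open>\<integral> (f - r g)\<^sup>2\<close> in \<open>r\<close> has nonpositive discriminant.\<close>

lemma Cauchy_Schwarz_integral:
  fixes f g :: "'a::euclidean_space \<Rightarrow> real"
  assumes f: "(\<lambda>t. (f t)\<^sup>2) integrable_on S" and g: "(\<lambda>t. (g t)\<^sup>2) integrable_on S"
    and fg: "(\<lambda>t. f t * g t) integrable_on S"
  shows "(integral S (\<lambda>t. f t * g t))\<^sup>2 \<le> integral S (\<lambda>t. (f t)\<^sup>2) * integral S (\<lambda>t. (g t)\<^sup>2)"
proof -
  define A B D where "A = integral S (\<lambda>t. (f t)\<^sup>2)" and "B = integral S (\<lambda>t. f t * g t)"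
    and "D = integral S (\<lambda>t. (g t)\<^sup>2)"
  have quad: "0 \<le> A - 2 * r * B + r\<^sup>2 * D" for r
  proof -
    have "((\<lambda>t. (f t)\<^sup>2 - 2 * r * (f t * g t) + r\<^sup>2 * (g t)\<^sup>2) has_integral A - 2 * r * B + r\<^sup>2 * D) S"
      unfolding A_def B_def D_def
      by (rule has_integral_add[OF has_integral_diff[OF integrable_integral[OF f]
            has_integral_mult_right[OF integrable_integral[OF fg]]]
            has_integral_mult_right[OF integrable_integral[OF g]]])
    then show ?thesis
    proof (rule has_integral_nonneg)
      fix t
      have "(f t)\<^sup>2 - 2 * r * (f t * g t) + r\<^sup>2 * (g t)\<^sup>2 = (f t - r * g t)\<^sup>2"
        by (simp add: power2_eq_square algebra_simps)
      then show "0 \<le> (f t)\<^sup>2 - 2 * r * (f t * g t) + r\<^sup>2 * (g t)\<^sup>2"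
        by (metis zero_le_power2)
    qed
  qed
  have "D \<ge> 0" unfolding D_def by (rule integral_nonneg[OF g]) auto
  have "B\<^sup>2 \<le> A * D"
  proof (cases "D = 0")
    case True
    have "B = 0"
    proof (rule ccontr)
      assume "B \<noteq> 0"
      then show False using quad[of "(A + 1) / (2 * B)"] True by simp
    qed
    then show ?thesis using True by simp
  next
    case False
    then have "D > 0" using \<open>D \<ge> 0\<close> by simp
    have eq: "A - 2 * (B / D) * B + (B / D)\<^sup>2 * D = A - B\<^sup>2 / D"
      using False by (simp add: power2_eq_square)
    have "B\<^sup>2 / D \<le> A" using quad[of "B / D"] unfolding eq by simp
    then show ?thesis using \<open>D > 0\<close> by (simp add: pos_divide_le_eq)
  qed
  then show ?thesis unfolding A_def B_def D_def .
qed

lemma has_integral_step: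
  fixes H :: "nat \<Rightarrow> real"
  assumes "h > 0"
  shows "((\<lambda>t. H (nat \<lfloor>t / h\<rfloor>)) has_integral (\<Sum>j<m. h * H j)) {0..real m * h}"
proof (induction m)
  case 0
  show ?case by (simp add: has_integral_refl)
next
  case (Suc m)
  have "((\<lambda>t. H m) has_integral h * H m) {real m * h..real (Suc m) * h}"
    using has_integral_const_real[of "H m" "real m * h" "real (Suc m) * h"] \<open>h > 0\<close>
    by (simp add: algebra_simps content_real)
  then have "((\<lambda>t. H (nat \<lfloor>t / h\<rfloor>)) has_integral h * H m) {real m * h..real (Suc m) * h}"
  proof (rule has_integral_spike_finite[rotated 2])
    show "H (nat \<lfloor>t / h\<rfloor>) = H m" if "t \<in> {real m * h..real (Suc m) * h} - {real (Suc m) * h}" for t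
    proof -
      have "real m \<le> t / h" "t / h < real m + 1"
        using that \<open>h > 0\<close> by (auto simp: field_simps)
      then have "\<lfloor>t / h\<rfloor> = int m" by (simp add: floor_eq_iff)
      then show ?thesis by simp
    qed
  qed auto
  from has_integral_combine[OF _ _ Suc.IH this] show ?case
    using \<open>h > 0\<close> by (simp add: mult_right_mono)
qed

lemma integral_Union_disjoint_subintervals_le:
  fixes f :: "real \<Rightarrow> real"
  assumes f: "f integrable_on {a..b}" and nonneg: "\<And>t. f t \<ge> 0" and "finite I"
    and sub: "\<And>i. i \<in> I \<Longrightarrow> {u i..v i} \<subseteq> {a..b}"
    and disj: "\<And>i j. i \<in> I \<Longrightarrow> j \<in> I \<Longrightarrow> i \<noteq> j \<Longrightarrow> {u i..v i} \<inter> {u j..v j} = {}"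
  shows "(\<Sum>i\<in>I. integral {u i..v i} f) \<le> integral {a..b} f"
proof -
  define \<phi> where "\<phi> i t = (if t \<in> {u i..v i} then f t else 0)" for i t
  have "(\<phi> i has_integral integral {u i..v i} f) {a..b}" if "i \<in> I" for i
    unfolding \<phi>_def using sub[OF that]
    by (subst has_integral_restrict) (auto intro!: integrable_integral integrable_on_subinterval[OF f])
  then have "((\<lambda>t. \<Sum>i\<in>I. \<phi> i t) has_integral (\<Sum>i\<in>I. integral {u i..v i} f)) {a..b}"
    by (rule has_integral_sum[OF \<open>finite I\<close>])
  moreover have "(\<Sum>i\<in>I. \<phi> i t) \<le> f t" for t
  proof (cases "\<exists>i\<in>I. t \<in> {u i..v i}")
    case True
    then obtain i where i: "i \<in> I" "t \<in> {u i..v i}" by blast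
    then have "\<phi> j t = 0" if "j \<in> I - {i}" for j
      using disj[of i j] that by (auto simp: \<phi>_def)
    then have "(\<Sum>j\<in>I. \<phi> j t) = \<phi> i t"
      using \<open>finite I\<close> i by (simp add: sum.remove[of I i])
    then show ?thesis using i by (simp add: \<phi>_def)
  next
    case False
    then have "(\<Sum>i\<in>I. \<phi> i t) = 0" by (intro sum.neutral) (auto simp: \<phi>_def)
    then show ?thesis using nonneg by simp
  qed
  ultimately show ?thesis
    by (intro has_integral_le[OF _ integrable_integral[OF f]]) auto
qed

text \<open>The weak type estimate for the maximal function: the intervals on which the mean of \<open>f\<close> exceeds
  \<open>\<alpha>\<close> are thinned out to a disjoint family by Vitali's covering lemma, at the price of the factor 5.\<close>

lemma maximal_inequality:
  fixes f :: "real \<Rightarrow> real"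
  assumes f: "f integrable_on {a..b}" and nonneg: "\<And>t. f t \<ge> 0" and "\<alpha> > 0"
  obtains W where "W \<in> lmeasurable" "measure lebesgue W \<le> 5 / \<alpha> * integral {a..b} f"
    "\<And>s t. t \<in> {a..b} - W \<Longrightarrow> s \<in> {a..b} \<Longrightarrow> integral {min s t..max s t} f \<le> \<alpha> * \<bar>s - t\<bar>"
proof -
  define K where "K = {(u, v). a \<le> u \<and> u < v \<and> v \<le> b \<and> \<alpha> * (v - u) < integral {u..v} f}"
  define m where "m i = (fst i + snd i) / 2" for i :: "real \<times> real"
  define r where "r i = (snd i - fst i) / 2" for i :: "real \<times> real"
  have cball_mr: "cball (m i) (r i) = {fst i..snd i}" for i
  proof -
    have "m i - r i = fst i" "m i + r i = snd i"
      by (simp_all add: m_def r_def add_divide_distrib diff_divide_distrib)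
    then show ?thesis by (simp add: cball_eq_atLeastAtMost)
  qed
  obtain C where C: "countable C" "C \<subseteq> K"
    and disj: "pairwise (\<lambda>i j. disjnt (cball (m i) (r i)) (cball (m j) (r j))) C"
    and cover: "(\<Union>i\<in>K. cball (m i) (r i)) \<subseteq> (\<Union>i\<in>C. cball (m i) (5 * r i))"
  proof (rule Vitali_covering_lemma_cballs[where a = m and r = r and K = K and B = "(b - a) / 2"
        and S = "\<Union>i\<in>K. cball (m i) (r i)"])
    show "0 < r i \<and> r i \<le> (b - a) / 2" if "i \<in> K" for i using that by (auto simp: K_def r_def)
  qed auto
  define W where "W = (\<Union>i\<in>C. cball (m i) (5 * r i))"
  have fin: "measure lebesgue (\<Union>i\<in>I. cball (m i) (5 * r i)) \<le> 5 / \<alpha> * integral {a..b} f"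
    if "I \<subseteq> C" "finite I" for I
  proof -
    have IK: "I \<subseteq> K" using that C by blast
    have "measure lebesgue (\<Union>i\<in>I. cball (m i) (5 * r i)) \<le> (\<Sum>i\<in>I. measure lebesgue (cball (m i) (5 * r i)))"
      by (rule measure_UNION_le[OF \<open>finite I\<close>]) auto
    also have "\<dots> \<le> (\<Sum>i\<in>I. 5 / \<alpha> * integral {fst i..snd i} f)"
    proof (rule sum_mono)
      fix i assume "i \<in> I"
      then have i: "fst i < snd i" "\<alpha> * (snd i - fst i) < integral {fst i..snd i} f"
        using IK by (auto simp: K_def)
      have rpos: "0 < r i" using i by (simp add: r_def)
      have "measure lebesgue (cball (m i) (5 * r i)) = 2 * (5 * r i)"
        using rpos by (simp add: cball_eq_atLeastAtMost)
      also have "\<dots> = 5 * (snd i - fst i)" by (simp add: r_def)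
      also have "\<dots> \<le> 5 / \<alpha> * integral {fst i..snd i} f"
        using i \<open>\<alpha> > 0\<close> by (simp add: field_simps)
      finally show "measure lebesgue (cball (m i) (5 * r i)) \<le> 5 / \<alpha> * integral {fst i..snd i} f" .
    qed
    also have "\<dots> = 5 / \<alpha> * (\<Sum>i\<in>I. integral {fst i..snd i} f)" by (rule sum_distrib_left[symmetric])
    also have "\<dots> \<le> 5 / \<alpha> * integral {a..b} f"
    proof (intro mult_left_mono integral_Union_disjoint_subintervals_le[OF f nonneg \<open>finite I\<close>])
      show "{fst i..snd i} \<subseteq> {a..b}" if "i \<in> I" for i using that IK by (auto simp: K_def)
      show "{fst i..snd i} \<inter> {fst j..snd j} = {}" if "i \<in> I" "j \<in> I" "i \<noteq> j" for i j
        using pairwiseD[OF disj, of i j] that \<open>I \<subseteq> C\<close> unfolding cball_mr disjnt_def by blast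
    qed (use \<open>\<alpha> > 0\<close> in auto)
    finally show ?thesis .
  qed
  show ?thesis
  proof (rule that[of W])
    show "W \<in> lmeasurable" unfolding W_def
      by (rule fmeasurable_UN_bound[OF C(1) _ fin]) auto
    show "measure lebesgue W \<le> 5 / \<alpha> * integral {a..b} f" unfolding W_def
      by (rule measure_UN_bound[OF C(1) _ fin]) auto
    fix s t assume t: "t \<in> {a..b} - W" and s: "s \<in> {a..b}"
    show "integral {min s t..max s t} f \<le> \<alpha> * \<bar>s - t\<bar>"
    proof (rule ccontr)
      assume *: "\<not> ?thesis"
      then have "s \<noteq> t" by auto
      have "(min s t, max s t) \<in> K"
      proof (cases "s < t")
        case True
        then show ?thesis using * s t by (simp add: K_def min_def max_def)
      next
        case False
        then have "t < s" using \<open>s \<noteq> t\<close> by simp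
        then show ?thesis using * s t by (simp add: K_def min_def max_def)
      qed
      moreover have "t \<in> cball (m (min s t, max s t)) (r (min s t, max s t))"
        unfolding cball_mr by simp
      ultimately have "t \<in> W" unfolding W_def using cover by blast
      then show False using t by simp
    qed
  qed
qed

text \<open>Replacing increments by their averages over blocks of length \<open>r\<close> is an orthogonal projection, so
  the square of the distance is the difference of the squares.\<close>

lemma sum_norm_diff_block_average:
  fixes e :: "nat \<Rightarrow> 'a::real_inner"
  assumes "r > 0"
  shows "(\<Sum>j<N * r. (norm ((e (Suc j) - e j) - (1 / real r) *\<^sub>R (e ((j div r + 1) * r) - e ((j div r) * r))))\<^sup>2)
    = (\<Sum>j<N * r. (norm (e (Suc j) - e j))\<^sup>2) - (1 / real r) * (\<Sum>k<N. (norm (e ((k + 1) * r) - e (k * r)))\<^sup>2)"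
proof -
  have block: "(\<Sum>j=k * r..<k * r + r. (norm ((e (Suc j) - e j) - (1 / real r) *\<^sub>R (e ((j div r + 1) * r) - e ((j div r) * r))))\<^sup>2)
      = (\<Sum>j=k * r..<k * r + r. (norm (e (Suc j) - e j))\<^sup>2) - (1 / real r) * (norm (e ((k + 1) * r) - e (k * r)))\<^sup>2" for k
  proof -
    define a where "a = e ((k + 1) * r) - e (k * r)"
    have "(\<Sum>j=k * r..<k * r + r. e (Suc j) - e j) = a"
      by (subst sum_Suc_diff') (auto simp: a_def algebra_simps)
    then have tele: "(\<Sum>j=k * r..<k * r + r. (e (Suc j) - e j) \<bullet> a) = (norm a)\<^sup>2"
      by (simp add: power2_norm_eq_inner inner_sum_left[symmetric])
    have "(\<Sum>j=k * r..<k * r + r. (norm ((e (Suc j) - e j) - (1 / real r) *\<^sub>R (e ((j div r + 1) * r) - e ((j div r) * r))))\<^sup>2)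
        = (\<Sum>j=k * r..<k * r + r. (norm (e (Suc j) - e j))\<^sup>2 - 2 / real r * ((e (Suc j) - e j) \<bullet> a) + (norm a)\<^sup>2 / (real r)\<^sup>2)"
    proof (rule sum.cong[OF refl])
      fix j assume "j \<in> {k * r..<k * r + r}"
      then have "j div r = k" by (intro div_nat_eqI) (auto simp: algebra_simps)
      then have "e ((j div r + 1) * r) - e ((j div r) * r) = a" by (simp add: a_def)
      moreover have "(norm (d - (1 / real r) *\<^sub>R a))\<^sup>2 = (norm d)\<^sup>2 - 2 / real r * (d \<bullet> a) + (norm a)\<^sup>2 / (real r)\<^sup>2" for d
        unfolding power2_norm_eq_inner
        by (simp add: inner_simps inner_commute power2_eq_square algebra_simps)
      ultimately show "(norm ((e (Suc j) - e j) - (1 / real r) *\<^sub>R (e ((j div r + 1) * r) - e ((j div r) * r))))\<^sup>2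
         = (norm (e (Suc j) - e j))\<^sup>2 - 2 / real r * ((e (Suc j) - e j) \<bullet> a) + (norm a)\<^sup>2 / (real r)\<^sup>2" by simp
    qed
    also have "\<dots> = (\<Sum>j=k * r..<k * r + r. (norm (e (Suc j) - e j))\<^sup>2) - 2 / real r * (norm a)\<^sup>2
        + real r * ((norm a)\<^sup>2 / (real r)\<^sup>2)"
      by (simp only: sum.distrib sum_subtractf sum_distrib_left[symmetric] tele) simp
    also have "\<dots> = (\<Sum>j=k * r..<k * r + r. (norm (e (Suc j) - e j))\<^sup>2) - (1 / real r) * (norm a)\<^sup>2"
      using \<open>r > 0\<close> by (simp add: power2_eq_square field_simps)
    finally show ?thesis by (simp add: a_def)
  qed
  show ?thesis
    unfolding sum.nat_group[symmetric] block sum_subtractf sum_distrib_left ..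
qed

section \<open>Almost everywhere differentiability of absolutely continuous curves\<close>

lemma borel_measurable_lebesgue_onI:
  fixes f :: "real \<Rightarrow> real"
  assumes "f \<in> borel_measurable borel"
  shows "f \<in> borel_measurable (lebesgue_on S)"
  using assms by (intro measurable_restrict_space1 measurable_completion) simp

lemma integrable_lebesgue_on_iff:
  fixes f :: "real \<Rightarrow> real"
  assumes "S \<in> sets lebesgue"
  shows "integrable (lebesgue_on S) f \<longleftrightarrow> f absolutely_integrable_on S"
  using assms by (simp add: set_integrable_def integrable_restrict_space)

lemma borel_measurable_floor_pair:
  fixes F :: "nat \<Rightarrow> nat \<Rightarrow> real"
  shows "(\<lambda>t::real. F (nat \<lfloor>t / a\<rfloor>) (nat \<lfloor>t / b\<rfloor>)) \<in> borel_measurable borel"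
proof -
  have nf: "(\<lambda>t::real. nat \<lfloor>t / c\<rfloor>) \<in> measurable borel (count_space UNIV)" for c
    by measurable
  show ?thesis
    by (rule measurable_compose_countable[OF measurable_compose_countable[OF _ nf] nf]) simp
qed

locale L2_curve =
  fixes x :: "real \<Rightarrow> 'a::{real_inner, banach}" and \<beta> :: "real \<Rightarrow> real" and T :: real
  assumes T_pos: "T > 0"
    and \<beta>_nonneg: "\<And>t. 0 \<le> \<beta> t"
    and \<beta>_int: "\<beta> integrable_on {0..T}"
    and \<beta>2_int: "(\<lambda>t. (\<beta> t)\<^sup>2) integrable_on {0..T}"
    and x_le: "\<And>s t. 0 \<le> s \<Longrightarrow> s \<le> t \<Longrightarrow> t \<le> T \<Longrightarrow> norm (x t - x s) \<le> integral {s..t} \<beta>"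
begin

definition mesh :: "nat \<Rightarrow> real"
  where "mesh n = T / 2 ^ n"

definition slope :: "nat \<Rightarrow> nat \<Rightarrow> 'a"
  where "slope n j = (1 / mesh n) *\<^sub>R (x (real (Suc j) * mesh n) - x (real j * mesh n))"

definition dquot :: "nat \<Rightarrow> real \<Rightarrow> 'a"
  where "dquot n t = slope n (nat \<lfloor>t / mesh n\<rfloor>)"

definition energy :: "nat \<Rightarrow> real"
  where "energy n = (\<Sum>k<2 ^ n. mesh n * (norm (slope n k))\<^sup>2)"

lemma mesh_pos: "mesh n > 0"
  using T_pos by (simp add: mesh_def)

lemma mesh_total: "real (2 ^ n) * mesh n = T"
  by (simp add: mesh_def)

lemma mesh_refine: "n \<le> m \<Longrightarrow> mesh n = real (2 ^ (m - n)) * mesh m"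
proof -
  assume "n \<le> m"
  then have "(2::real) ^ m = 2 ^ (m - n) * 2 ^ n" by (simp flip: power_add)
  then show ?thesis by (simp add: mesh_def)
qed

lemma index_refine:
  assumes "n \<le> m" "0 \<le> t"
  shows "nat \<lfloor>t / mesh n\<rfloor> = nat \<lfloor>t / mesh m\<rfloor> div 2 ^ (m - n)"
proof -
  have "t / mesh n = (t / mesh m) / real_of_int (2 ^ (m - n))"
    using mesh_refine[OF assms(1)] by simp
  then have "\<lfloor>t / mesh n\<rfloor> = \<lfloor>t / mesh m\<rfloor> div 2 ^ (m - n)"
    by (simp only: floor_divide_real_eq_div[OF zero_le_power[OF zero_le_numeral]])
  moreover have "0 \<le> \<lfloor>t / mesh m\<rfloor>" using assms mesh_pos[of m] by simp
  ultimately show ?thesis by (simp add: nat_div_distrib nat_power_eq)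
qed

text \<open>The martingale property in integrated form: the coarse quotients are cell averages of the fine ones.\<close>

lemma energy_refine:
  assumes "n \<le> m"
  shows "(\<Sum>j<2 ^ m. mesh m * (norm (slope m j - slope n (j div 2 ^ (m - n))))\<^sup>2) = energy m - energy n"
proof -
  define r where "r = (2::nat) ^ (m - n)"
  define e where "e j = x (real j * mesh m)" for j
  have r: "r > 0" "2 ^ m = 2 ^ n * r" "mesh n = real r * mesh m"
    using assms mesh_refine[OF assms] by (simp_all add: r_def power_add[symmetric])
  have s1: "slope m j = (1 / mesh m) *\<^sub>R (e (Suc j) - e j)" for j
    by (simp add: slope_def e_def)
  have s2: "slope n k = (1 / mesh m) *\<^sub>R ((1 / real r) *\<^sub>R (e ((k + 1) * r) - e (k * r)))" for k
  proof -
    have "real (Suc k) * mesh n = real ((k + 1) * r) * mesh m" "real k * mesh n = real (k * r) * mesh m"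
      by (simp_all add: r(3) algebra_simps)
    then have "slope n k = (1 / mesh n) *\<^sub>R (e ((k + 1) * r) - e (k * r))"
      unfolding slope_def e_def by (simp only:)
    then show ?thesis by (simp add: r(3) mult.commute)
  qed
  have "(\<Sum>j<2 ^ m. mesh m * (norm (slope m j - slope n (j div r)))\<^sup>2)
      = (\<Sum>j<2 ^ n * r. (1 / mesh m) * (norm ((e (Suc j) - e j) - (1 / real r) *\<^sub>R (e ((j div r + 1) * r) - e ((j div r) * r))))\<^sup>2)"
    unfolding s1 s2 r(2) scaleR_diff_right[symmetric]
    using mesh_pos[of m] by (intro sum.cong) (simp_all add: power_mult_distrib power2_eq_square[of "1 / mesh m"] power2_eq_square[of "mesh m"] power_divide)
  also have "\<dots> = (1 / mesh m) * ((\<Sum>j<2 ^ n * r. (norm (e (Suc j) - e j))\<^sup>2)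
       - (1 / real r) * (\<Sum>k<2 ^ n. (norm (e ((k + 1) * r) - e (k * r)))\<^sup>2))"
    unfolding sum_distrib_left[symmetric] sum_norm_diff_block_average[OF r(1)] ..
  also have "\<dots> = energy m - energy n"
  proof -
    have "energy m = (1 / mesh m) * (\<Sum>j<2 ^ n * r. (norm (e (Suc j) - e j))\<^sup>2)"
      unfolding energy_def s1 r(2) sum_distrib_left
      using mesh_pos[of m] by (intro sum.cong) (simp_all add: power_divide power2_eq_square[of "mesh m"])
    moreover have "energy n = (1 / mesh m) * ((1 / real r) * (\<Sum>k<2 ^ n. (norm (e ((k + 1) * r) - e (k * r)))\<^sup>2))"
      unfolding energy_def s2 sum_distrib_left r(3)
      using mesh_pos[of m] r(1) by (intro sum.cong) (simp_all add: power_divide power2_eq_square[of "mesh m * real r"])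
    ultimately show ?thesis by (simp add: right_diff_distrib)
  qed
  finally show ?thesis by (simp add: r_def)
qed

lemma dquot_diff_has_integral:
  assumes "n \<le> m"
  shows "((\<lambda>t. (norm (dquot m t - dquot n t))\<^sup>2) has_integral energy m - energy n) {0..T}"
proof -
  define H where "H j = (norm (slope m j - slope n (j div 2 ^ (m - n))))\<^sup>2" for j
  have "((\<lambda>t. H (nat \<lfloor>t / mesh m\<rfloor>)) has_integral (\<Sum>j<2 ^ m. mesh m * H j)) {0..real (2 ^ m) * mesh m}"
    by (rule has_integral_step[OF mesh_pos])
  then have "((\<lambda>t. H (nat \<lfloor>t / mesh m\<rfloor>)) has_integral energy m - energy n) {0..T}"
    unfolding mesh_total H_def energy_refine[OF assms] .
  then show ?thesis
  proof (rule has_integral_eq[rotated])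
    fix t assume "t \<in> {0..T}"
    then show "H (nat \<lfloor>t / mesh m\<rfloor>) = (norm (dquot m t - dquot n t))\<^sup>2"
      using index_refine[OF assms, of t] by (simp add: H_def dquot_def)
  qed
qed

lemma integral_grid:
  assumes "f integrable_on {0..T}" "real m * h \<le> T" "h \<ge> 0"
  shows "(\<Sum>k<m. integral {real k * h..real (Suc k) * h} f) = integral {0..real m * h} (f :: real \<Rightarrow> real)"
  using assms(2)
proof (induction m)
  case (Suc m)
  have le: "real m * h \<le> real (Suc m) * h" using \<open>h \<ge> 0\<close> by (simp add: mult_right_mono)
  have "integral {0..real m * h} f + integral {real m * h..real (Suc m) * h} f = integral {0..real (Suc m) * h} f"
    using Suc.prems \<open>h \<ge> 0\<close> le
    by (intro Henstock_Kurzweil_Integration.integral_combine integrable_on_subinterval[OF assms(1)]) auto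
  then show ?case using Suc le by simp
qed simp

text \<open>Jensen's inequality on each cell bounds the energies uniformly in \<open>n\<close>.\<close>

lemma energy_le: "energy n \<le> integral {0..T} (\<lambda>t. (\<beta> t)\<^sup>2)"
proof -
  have "energy n \<le> (\<Sum>k<2 ^ n. integral {real k * mesh n..real (Suc k) * mesh n} (\<lambda>t. (\<beta> t)\<^sup>2))"
    unfolding energy_def
  proof (rule sum_mono)
    fix k assume "k \<in> {..<(2::nat) ^ n}"
    then have "real (Suc k) \<le> real (2 ^ n)" by (subst of_nat_le_iff) auto
    then have "real (Suc k) * mesh n \<le> real (2 ^ n) * mesh n"
      using mesh_pos[of n] by (intro mult_right_mono) auto
    then have kT: "real (Suc k) * mesh n \<le> T" by (simp only: mesh_total)
    have k0: "0 \<le> real k * mesh n" "real k * mesh n \<le> real (Suc k) * mesh n"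
      using mesh_pos[of n] by (auto intro: mult_right_mono)
    define J where "J = {real k * mesh n..real (Suc k) * mesh n}"
    have J: "J \<subseteq> {0..T}" using kT k0 by (auto simp: J_def)
    have "integral J (\<lambda>t. \<beta> t * 1) \<le> sqrt (integral J (\<lambda>t. (\<beta> t)\<^sup>2) * integral J (\<lambda>t. 1\<^sup>2))"
    proof (rule real_le_rsqrt, rule Cauchy_Schwarz_integral)
      show "(\<lambda>t. (\<beta> t)\<^sup>2) integrable_on J" "(\<lambda>t. \<beta> t * 1) integrable_on J"
        using J \<beta>_int \<beta>2_int unfolding J_def by (auto intro: integrable_on_subinterval)
    qed (simp add: J_def integrable_const_ivl)
    also have "integral J (\<lambda>t. 1\<^sup>2) = mesh n"
      using k0 by (simp add: J_def algebra_simps content_real)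
    finally have "norm (x (real (Suc k) * mesh n) - x (real k * mesh n)) \<le> sqrt (integral J (\<lambda>t. (\<beta> t)\<^sup>2) * mesh n)"
      using x_le[OF k0 kT] by (simp add: J_def)
    then have "(norm (x (real (Suc k) * mesh n) - x (real k * mesh n)))\<^sup>2 \<le> (sqrt (integral J (\<lambda>t. (\<beta> t)\<^sup>2) * mesh n))\<^sup>2"
      by (rule power_mono) simp
    also have "\<dots> = integral J (\<lambda>t. (\<beta> t)\<^sup>2) * mesh n"
      using mesh_pos[of n] J \<beta>2_int unfolding J_def
      by (intro real_sqrt_pow2 mult_nonneg_nonneg integral_nonneg integrable_on_subinterval[OF \<beta>2_int]) auto
    finally have "mesh n * (norm (slope n k))\<^sup>2 \<le> integral J (\<lambda>t. (\<beta> t)\<^sup>2)"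
      using mesh_pos[of n] by (simp add: slope_def power_divide power2_eq_square[of "mesh n"] divide_le_eq)
    then show "mesh n * (norm (slope n k))\<^sup>2 \<le> integral {real k * mesh n..real (Suc k) * mesh n} (\<lambda>t. (\<beta> t)\<^sup>2)"
      by (simp add: J_def)
  qed
  also have "\<dots> = integral {0..real (2 ^ n) * mesh n} (\<lambda>t. (\<beta> t)\<^sup>2)"
    using mesh_pos[of n] by (intro integral_grid[OF \<beta>2_int]) (simp_all only: mesh_total order_refl less_imp_le)
  finally show ?thesis by (simp only: mesh_total)
qed

lemma measurable_dquot_diff: "(\<lambda>t. norm (dquot m t - dquot n t)) \<in> borel_measurable (lebesgue_on {0..T})"
  unfolding dquot_def by (intro borel_measurable_lebesgue_onI borel_measurable_floor_pair)

lemma measurable_dquot: "(\<lambda>t. F (dquot n t)) \<in> borel_measurable (lebesgue_on {0..T})" for F :: "'a \<Rightarrow> real"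
  unfolding dquot_def
  by (intro borel_measurable_lebesgue_onI borel_measurable_floor_pair[of "\<lambda>i j. F (slope n i)" "mesh n" 1])

lemma dquot_diff_integrable: "(\<lambda>t. (norm (dquot m t - dquot n t))\<^sup>2) absolutely_integrable_on {0..T}"
proof -
  have "(\<lambda>t. (norm (dquot m t - dquot n t))\<^sup>2) integrable_on {0..T}" if "n \<le> m" for m n
    using dquot_diff_has_integral[OF that] by blast
  from this[of n m] this[of m n] show ?thesis
    by (intro nonnegative_absolutely_integrable_1) (auto simp: norm_minus_commute intro: le_cases[of n m])
qed

text \<open>The energies increase and are bounded, and their differences are the mean square distances.\<close>

lemma dquot_Cauchy:
  assumes "e > 0"
  shows "\<exists>N. \<forall>m\<ge>N. \<forall>n\<ge>N. integral\<^sup>L (lebesgue_on {0..T}) (\<lambda>t. (norm (dquot m t - dquot n t))\<^sup>2) < e"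
proof -
  have eq: "integral\<^sup>L (lebesgue_on {0..T}) (\<lambda>t. (norm (dquot m t - dquot n t))\<^sup>2) = energy m - energy n"
    if "n \<le> m" for m n
    using dquot_diff_has_integral[OF that] dquot_diff_integrable[of m n]
    by (subst lebesgue_integral_eq_integral) (auto simp: integrable_lebesgue_on_iff)
  have "incseq energy"
  proof (rule incseq_SucI)
    fix n show "energy n \<le> energy (Suc n)"
      using has_integral_nonneg[OF dquot_diff_has_integral[of n "Suc n"]] by simp
  qed
  then have "convergent energy"
    using energy_le incseq_convergent[of energy] by (metis convergentI)
  then have "Cauchy energy" by (rule convergent_Cauchy)
  then obtain N where N: "\<And>m n. m \<ge> N \<Longrightarrow> n \<ge> N \<Longrightarrow> norm (energy m - energy n) < e"
    using CauchyD[of energy e] assms by blast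
  have "integral\<^sup>L (lebesgue_on {0..T}) (\<lambda>t. (norm (dquot m t - dquot n t))\<^sup>2) < e" if "m \<ge> N" "n \<ge> N" for m n
  proof (cases "n \<le> m")
    case True
    then show ?thesis using eq[OF True] N[OF that] by simp
  next
    case False
    then show ?thesis using eq[of m n] N[OF that(2,1)] by (simp add: norm_minus_commute)
  qed
  then show ?thesis by blast
qed

end

lemma integrable_of_square_integrable:
  fixes f :: "real \<Rightarrow> real"
  assumes f: "f \<in> borel_measurable (lebesgue_on {a..b})" and f2: "(\<lambda>t. (f t)\<^sup>2) integrable_on {a..b}"
  shows "f absolutely_integrable_on {a..b}"
proof (rule measurable_bounded_by_integrable_imp_absolutely_integrable[OF f, of "\<lambda>t. 1 + (f t)\<^sup>2"])
  show "(\<lambda>t. 1 + (f t)\<^sup>2) integrable_on {a..b}"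
    by (rule integrable_add[OF integrable_const_ivl f2])
  show "norm (f t) \<le> 1 + (f t)\<^sup>2" for t
    using sum_squares_bound[of "\<bar>f t\<bar>" 1] by simp
qed simp

context L2_curve
begin

lemma finite_measure_interval: "finite_measure (lebesgue_on {0..T})"
  by (intro finite_measure_lebesgue_on) auto

lemma continuous_on_curve: "continuous_on {0..T} x"
proof -
  have cont: "continuous_on {0..T} (\<lambda>t. integral {0..t} \<beta>)"
    by (rule indefinite_integral_continuous_1[OF \<beta>_int])
  have le: "dist (x s) (x t) \<le> dist (integral {0..s} \<beta>) (integral {0..t} \<beta>)"
    if "s \<in> {0..T}" "t \<in> {0..T}" for s t
  proof -
    have *: "norm (x t - x s) \<le> \<bar>integral {0..t} \<beta> - integral {0..s} \<beta>\<bar>" if "0 \<le> s" "s \<le> t" "t \<le> T" for s t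
    proof -
      have "integral {0..s} \<beta> + integral {s..t} \<beta> = integral {0..t} \<beta>"
        using that by (intro Henstock_Kurzweil_Integration.integral_combine integrable_on_subinterval[OF \<beta>_int]) auto
      then show ?thesis using x_le[OF that] by linarith
    qed
    show ?thesis
      using *[of s t] *[of t s] that
      by (cases "s \<le> t") (auto simp: dist_norm norm_minus_commute abs_minus_commute)
  qed
  show ?thesis
    unfolding continuous_on_iff
  proof (intro ballI allI impI)
    fix t e :: real assume "t \<in> {0..T}" "e > 0"
    then obtain d where "d > 0" "\<forall>s\<in>{0..T}. dist s t < d \<longrightarrow> dist (integral {0..s} \<beta>) (integral {0..t} \<beta>) < e"
      using cont unfolding continuous_on_iff by blast
    then show "\<exists>d>0. \<forall>s\<in>{0..T}. dist s t < d \<longrightarrow> dist (x s) (x t) < e"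
      using le \<open>t \<in> {0..T}\<close> by (meson le_less_trans)
  qed
qed

text \<open>Integrating the step function up to a grid point telescopes.\<close>

lemma integral_dquot_inner:
  assumes "real k * mesh n \<le> T"
  shows "((\<lambda>t. dquot n t \<bullet> w) has_integral (x (real k * mesh n) - x 0) \<bullet> w) {0..real k * mesh n}"
proof -
  have "((\<lambda>t. dquot n t \<bullet> w) has_integral (\<Sum>j<k. mesh n * (slope n j \<bullet> w))) {0..real k * mesh n}"
    unfolding dquot_def by (rule has_integral_step[OF mesh_pos])
  also have "(\<Sum>j<k. mesh n * (slope n j \<bullet> w)) = (\<Sum>j<k. x (real (Suc j) * mesh n) - x (real j * mesh n)) \<bullet> w"
    unfolding inner_sum_left using mesh_pos[of n] by (intro sum.cong) (simp_all add: slope_def)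
  also have "(\<Sum>j<k. x (real (Suc j) * mesh n) - x (real j * mesh n)) = x (real k * mesh n) - x 0"
    using sum_lessThan_telescope[of "\<lambda>j. x (real j * mesh n)" k] by simp
  finally show ?thesis .
qed

text \<open>Measurability of the limit \<open>g\<close> is expressed through real functions \<open>F (g t)\<close>; these are limits of
  real step functions.\<close>

lemma limit_slope_exists:
  obtains r g N where "strict_mono r" "negligible N"
    "\<And>t. t \<in> {0..T} - N \<Longrightarrow> (\<lambda>k. dquot (r k) t) \<longlonglongrightarrow> g t"
    "\<And>F. continuous_on UNIV F \<Longrightarrow> (\<lambda>t. F (g t) :: real) \<in> borel_measurable (lebesgue_on {0..T})"
    "\<And>n. (\<lambda>t. (norm (dquot n t - g t))\<^sup>2) integrable_on {0..T}"
    "(\<lambda>n. integral {0..T} (\<lambda>t. (norm (dquot n t - g t))\<^sup>2)) \<longlonglongrightarrow> 0"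
proof -
  let ?M = "lebesgue_on {0..T}"
  have I: "integrable ?M (\<lambda>t. (norm (dquot m t - dquot n t))\<^sup>2)" for m n
    using dquot_diff_integrable by (subst integrable_lebesgue_on_iff) auto
  obtain r D g where r: "strict_mono r" and D: "D \<in> sets ?M" "AE t in ?M. t \<in> D"
    and lim: "\<And>t. t \<in> space ?M \<Longrightarrow> (\<lambda>k. if t \<in> D then dquot (r k) t else dquot 0 t) \<longlonglongrightarrow> g t"
    and "\<And>n. (\<lambda>t. norm (dquot n t - g t)) \<in> borel_measurable ?M"
    and int: "\<And>n. integrable ?M (\<lambda>t. (norm (dquot n t - g t))\<^sup>2)"
    and to0: "(\<lambda>n. \<integral>t. (norm (dquot n t - g t))\<^sup>2 \<partial>?M) \<longlonglongrightarrow> 0"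
    by (rule finite_measure.L2_Cauchy_imp_limit[OF finite_measure_interval measurable_dquot_diff I dquot_Cauchy])
      (assumption, rule that, assumption, assumption, assumption, blast, blast, blast, assumption)
  obtain N where N: "\<And>t. t \<in> space ?M - N \<Longrightarrow> t \<in> D" "N \<in> null_sets ?M"
    using D(2) by (rule AE_E3) blast
  have "negligible N"
    using N(2) by (simp add: negligible_iff_null_sets null_sets_restrict_space)
  show ?thesis
  proof (rule that[OF r \<open>negligible N\<close>])
    show "(\<lambda>k. dquot (r k) t) \<longlonglongrightarrow> g t" if "t \<in> {0..T} - N" for t
      using lim[of t] N(1)[of t] that by simp
    show "(\<lambda>t. F (g t) :: real) \<in> borel_measurable ?M" if F: "continuous_on UNIV F" for F
    proof (rule borel_measurable_LIMSEQ_real)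
      show "(\<lambda>k. F (if t \<in> D then dquot (r k) t else dquot 0 t)) \<longlonglongrightarrow> F (g t)" if "t \<in> space ?M" for t
        using lim[OF that] F by (intro continuous_on_tendsto_compose[OF F]) auto
      have "(\<lambda>t. if t \<in> D then F (dquot (r k) t) else F (dquot 0 t)) \<in> borel_measurable ?M" for k
        by (rule measurable_If_set[OF measurable_dquot measurable_dquot])
           (use D(1) sets.sets_into_space[OF D(1)] in \<open>simp add: Int_absorb2\<close>)
      moreover have "(\<lambda>t. if t \<in> D then F (dquot (r k) t) else F (dquot 0 t)) = (\<lambda>t. F (if t \<in> D then dquot (r k) t else dquot 0 t))" for k
        by auto
      ultimately show "(\<lambda>t. F (if t \<in> D then dquot (r k) t else dquot 0 t)) \<in> borel_measurable ?M" for k by simp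
    qed
    have abs: "(\<lambda>t. (norm (dquot n t - g t))\<^sup>2) absolutely_integrable_on {0..T}" for n
      using int[of n] by (subst (asm) integrable_lebesgue_on_iff) auto
    then show "(\<lambda>t. (norm (dquot n t - g t))\<^sup>2) integrable_on {0..T}" for n
      using set_lebesgue_integral_eq_integral(1) by blast
    have "(\<integral>t. (norm (dquot n t - g t))\<^sup>2 \<partial>?M) = integral {0..T} (\<lambda>t. (norm (dquot n t - g t))\<^sup>2)" for n
      using int[of n] by (intro lebesgue_integral_eq_integral) auto
    then show "(\<lambda>n. integral {0..T} (\<lambda>t. (norm (dquot n t - g t))\<^sup>2)) \<longlonglongrightarrow> 0"
      using to0 by simp
  qed
qed

end

lemma small_subsequence:
  fixes a e :: "nat \<Rightarrow> real"
  assumes "a \<longlonglongrightarrow> 0" "\<And>k. e k > 0"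
  obtains s where "strict_mono s" "\<And>k. a (s k) < e k"
proof -
  have "\<exists>s. \<forall>n. a (s n) < e n \<and> s n < s (Suc n)"
  proof (intro dependent_nat_choice, goal_cases)
    case 1
    have "\<forall>\<^sub>F n in sequentially. a n < e 0" using order_tendstoD(2)[OF assms] .
    then show ?case by (auto simp: eventually_sequentially)
  next
    case (2 m n)
    have "\<forall>\<^sub>F i in sequentially. a i < e (Suc n)" using order_tendstoD(2)[OF assms] .
    then obtain N where "\<And>i. i \<ge> N \<Longrightarrow> a i < e (Suc n)" by (auto simp: eventually_sequentially)
    then show ?case by (intro exI[of _ "max N (Suc m)"]) auto
  qed
  then obtain s where "\<forall>n. a (s n) < e n \<and> s n < s (Suc n)" by blast
  then show ?thesis by (intro that[of s]) (auto simp: strict_mono_Suc_iff)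
qed

lemma floor_step_locally_constant:
  fixes t h :: real
  assumes "h > 0" "t / h \<notin> \<int>"
  obtains d where "d > 0" "\<And>s. \<bar>s - t\<bar> < d \<Longrightarrow> \<lfloor>s / h\<rfloor> = \<lfloor>t / h\<rfloor>"
proof -
  define f where "f = real_of_int \<lfloor>t / h\<rfloor>"
  have "f \<noteq> t / h" using assms(2) unfolding f_def by (metis Ints_of_int)
  then have f: "f < t / h" "t / h < f + 1"
    using of_int_floor_le[of "t / h"] floor_correct[of "t / h"] unfolding f_def by linarith+
  then have *: "f * h < t" "t < (f + 1) * h" using \<open>h > 0\<close> by (simp_all add: field_simps)
  show ?thesis
  proof (rule that[of "min (t - f * h) ((f + 1) * h - t)"])
    fix s assume "\<bar>s - t\<bar> < min (t - f * h) ((f + 1) * h - t)"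
    then have "f * h < s" "s < (f + 1) * h" by auto
    then have "f < s / h" "s / h < f + 1" using \<open>h > 0\<close> by (simp_all add: field_simps)
    then show "\<lfloor>s / h\<rfloor> = \<lfloor>t / h\<rfloor>" unfolding f_def by (simp add: floor_eq_iff)
  qed (use * in simp)
qed

context L2_curve
begin

lemma integral_split:
  fixes f :: "real \<Rightarrow> real"
  assumes "f integrable_on {0..T}" "0 \<le> s" "s \<le> t" "t \<le> T"
  shows "integral {s..t} f = integral {0..t} f - integral {0..s} f"
  using Henstock_Kurzweil_Integration.integral_combine[of 0 s t f]
    integrable_on_subinterval[OF assms(1), of 0 t] assms by auto

text \<open>The weak fundamental theorem for the limit \<open>g\<close> of the difference quotients gives
  \<open>norm (x t - x s - (t - s) q) \<le> \<integral>\<^sub>s\<^sup>t norm (g - q)\<close> for every constant \<open>q\<close>. Near a point that is not on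
  the grid, \<open>q\<close> may be taken to be the locally constant value of the step function, so the right side is
  controlled by the maximal function of the error \<open>norm (dquot n - g)\<close>. By the maximal inequality and
  Borel-Cantelli these maximal functions tend to \<open>0\<close> almost everywhere along a subsequence.\<close>

theorem ae_derivative:
  obtains g N where "negligible N"
    "\<And>t. t \<in> {0<..<T} - N \<Longrightarrow> (x has_vector_derivative g t) (at t)"
    "(\<lambda>t. (norm (g t))\<^sup>2) integrable_on {0..T}"
    "\<And>F. continuous_on UNIV F \<Longrightarrow> (\<lambda>t. F (g t) :: real) \<in> borel_measurable (lebesgue_on {0..T})"
    "\<And>t w. t \<in> {0..T} \<Longrightarrow> ((\<lambda>s. g s \<bullet> w) has_integral (x t - x 0) \<bullet> w) {0..t}"
proof -
  obtain r g N where r: "strict_mono r" and N: "negligible N"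
    and lim: "\<And>t. t \<in> {0..T} - N \<Longrightarrow> (\<lambda>k. dquot (r k) t) \<longlonglongrightarrow> g t"
    and meas: "\<And>F. continuous_on UNIV F \<Longrightarrow> (\<lambda>t. F (g t) :: real) \<in> borel_measurable (lebesgue_on {0..T})"
    and sq: "\<And>n. (\<lambda>t. (norm (dquot n t - g t))\<^sup>2) integrable_on {0..T}"
    and to0: "(\<lambda>n. integral {0..T} (\<lambda>t. (norm (dquot n t - g t))\<^sup>2)) \<longlonglongrightarrow> 0"
    by (rule limit_slope_exists) blast
  define \<rho> where "\<rho> n t = norm (dquot n t - g t)" for n t
  have \<rho>_meas: "\<rho> n \<in> borel_measurable (lebesgue_on {0..T})" for n
  proof -
    have "(\<lambda>t. (\<rho> n t)\<^sup>2) \<in> borel_measurable (lebesgue_on {0..T})"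
      unfolding \<rho>_def by (rule integrable_imp_measurable[OF sq])
    then have "(\<lambda>t. sqrt ((\<rho> n t)\<^sup>2)) \<in> borel_measurable (lebesgue_on {0..T})" by measurable
    then show ?thesis by (simp add: \<rho>_def[abs_def])
  qed
  have \<rho>_int: "\<rho> n integrable_on {0..T}" for n
    using integrable_of_square_integrable[OF \<rho>_meas] sq[of n] set_lebesgue_integral_eq_integral(1)
    unfolding \<rho>_def by blast
  have \<rho>_to0: "(\<lambda>n. integral {0..T} (\<rho> n)) \<longlonglongrightarrow> 0"
  proof (rule tendsto_sandwich[OF _ _ tendsto_const])
    show "\<forall>\<^sub>F n in sequentially. 0 \<le> integral {0..T} (\<rho> n)"
      by (intro always_eventually allI integral_nonneg \<rho>_int) (simp add: \<rho>_def)
    have "integral {0..T} (\<rho> n) \<le> sqrt (integral {0..T} (\<lambda>t. (norm (dquot n t - g t))\<^sup>2) * T)" for n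
    proof (rule real_le_rsqrt)
      have "(integral {0..T} (\<lambda>t. \<rho> n t * 1))\<^sup>2 \<le> integral {0..T} (\<lambda>t. (\<rho> n t)\<^sup>2) * integral {0..T} (\<lambda>t. 1\<^sup>2)"
      proof (rule Cauchy_Schwarz_integral)
        show "(\<lambda>t. (\<rho> n t)\<^sup>2) integrable_on {0..T}" unfolding \<rho>_def by (rule sq)
        show "(\<lambda>t. \<rho> n t * 1) integrable_on {0..T}" using \<rho>_int by simp
      qed (rule integrable_const_ivl)
      then show "(integral {0..T} (\<rho> n))\<^sup>2 \<le> integral {0..T} (\<lambda>t. (norm (dquot n t - g t))\<^sup>2) * T"
        using T_pos by (simp add: \<rho>_def[abs_def])
    qed
    then show "\<forall>\<^sub>F n in sequentially. integral {0..T} (\<rho> n) \<le> sqrt (integral {0..T} (\<lambda>t. (norm (dquot n t - g t))\<^sup>2) * T)"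
      by simp
    have "(\<lambda>n. sqrt (integral {0..T} (\<lambda>t. (norm (dquot n t - g t))\<^sup>2) * T)) \<longlonglongrightarrow> sqrt (0 * T)"
      by (intro tendsto_real_sqrt tendsto_mult_right to0)
    then show "(\<lambda>n. sqrt (integral {0..T} (\<lambda>t. (norm (dquot n t - g t))\<^sup>2) * T)) \<longlonglongrightarrow> 0" by simp
  qed
  have g2_int: "(\<lambda>t. (norm (g t))\<^sup>2) integrable_on {0..T}"
  proof (rule measurable_bounded_by_integrable_imp_integrable)
    show "(\<lambda>t. (norm (g t))\<^sup>2) \<in> borel_measurable (lebesgue_on {0..T})"
      by (rule meas) (intro continuous_intros)
    define B where "B = max (norm (slope 0 0)) (norm (slope 0 1))"
    show "(\<lambda>t. 2 * B\<^sup>2 + 2 * (\<rho> 0 t)\<^sup>2) integrable_on {0..T}"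
      unfolding \<rho>_def by (intro integrable_add integrable_const_ivl integrable_on_mult_right sq)
    fix t assume t: "t \<in> {0..T}"
    have "t / mesh 0 \<le> 1" "0 \<le> t / mesh 0" using t T_pos by (auto simp: mesh_def)
    then have "0 \<le> \<lfloor>t / mesh 0\<rfloor>" "\<lfloor>t / mesh 0\<rfloor> \<le> 1" by (simp, linarith)
    then have "nat \<lfloor>t / mesh 0\<rfloor> = 0 \<or> nat \<lfloor>t / mesh 0\<rfloor> = 1" by linarith
    then have dB: "norm (dquot 0 t) \<le> B" by (auto simp: dquot_def B_def)
    have "norm (g t) \<le> B + \<rho> 0 t"
      using norm_triangle_ineq4[of "dquot 0 t" "dquot 0 t - g t"] dB by (simp add: \<rho>_def)
    then have "(norm (g t))\<^sup>2 \<le> (B + \<rho> 0 t)\<^sup>2" by (rule power_mono) simp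
    also have "\<dots> \<le> 2 * B\<^sup>2 + 2 * (\<rho> 0 t)\<^sup>2"
      using sum_squares_bound[of B "\<rho> 0 t"] by (simp add: power2_sum)
    finally show "norm ((norm (g t))\<^sup>2) \<le> 2 * B\<^sup>2 + 2 * (\<rho> 0 t)\<^sup>2" by simp
  qed simp
  have norm_le: "norm (g t) \<le> 1 + (norm (g t))\<^sup>2" for t
    using sum_squares_bound[of "norm (g t)" 1] zero_le_power2[of "norm (g t)"] by (simp only: power_one mult_1_right)
  have gq_int: "(\<lambda>t. norm (g t - q)) integrable_on {0..T}" for q
  proof (rule measurable_bounded_by_integrable_imp_integrable)
    show "(\<lambda>t. norm (g t - q)) \<in> borel_measurable (lebesgue_on {0..T})"
      by (rule meas) (intro continuous_intros)
    show "(\<lambda>t. (1 + norm q) + (norm (g t))\<^sup>2) integrable_on {0..T}"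
      by (intro integrable_add integrable_const_ivl g2_int)
    show "norm (norm (g t - q)) \<le> (1 + norm q) + (norm (g t))\<^sup>2" for t
      using norm_triangle_ineq4[of "g t" q] norm_le[of t] by simp
  qed simp
  have gw_int: "(\<lambda>t. g t \<bullet> w) integrable_on {0..T}" for w
  proof (rule measurable_bounded_by_integrable_imp_integrable)
    show "(\<lambda>t. g t \<bullet> w) \<in> borel_measurable (lebesgue_on {0..T})"
      by (rule meas) (intro continuous_intros)
    show "(\<lambda>t. norm (g t - 0) * norm w) integrable_on {0..T}"
      by (intro integrable_on_mult_left gq_int)
    show "norm (g t \<bullet> w) \<le> norm (g t - 0) * norm w" for t
      using Cauchy_Schwarz_ineq2[of "g t" w] by simp
  qed simp
  have ftc: "((\<lambda>s. g s \<bullet> w) has_integral (x t - x 0) \<bullet> w) {0..t}" if t: "t \<in> {0..T}" for t w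
  proof -
    define k where "k n = nat \<lfloor>t / mesh n\<rfloor>" for n
    define \<tau> where "\<tau> n = real (k n) * mesh n" for n
    have k: "real (k n) \<le> t / mesh n" "t / mesh n \<le> real (k n) + 1" for n
    proof -
      have "0 \<le> t / mesh n" using t mesh_pos[of n] by simp
      then have "0 \<le> \<lfloor>t / mesh n\<rfloor>" by simp
      then have "real (k n) = of_int \<lfloor>t / mesh n\<rfloor>" by (simp add: k_def)
      then show "real (k n) \<le> t / mesh n" "t / mesh n \<le> real (k n) + 1" by linarith+
    qed
    have \<tau>: "0 \<le> \<tau> n" "\<tau> n \<le> t" "t \<le> \<tau> n + mesh n" for n
      using k[of n] mesh_pos[of n] by (simp_all add: \<tau>_def field_simps)
    have "mesh \<longlonglongrightarrow> 0"
    proof -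
      have "(\<lambda>n. T * (1 / 2) ^ n) \<longlonglongrightarrow> T * 0"
        by (intro tendsto_mult_left LIMSEQ_power_zero) simp
      then show ?thesis unfolding mesh_def by (simp add: power_divide)
    qed
    then have "(\<lambda>n. t - mesh n) \<longlonglongrightarrow> t - 0" by (intro tendsto_intros)
    then have \<tau>_lim: "\<tau> \<longlonglongrightarrow> t"
      by (intro tendsto_sandwich[OF _ _ _ tendsto_const, of "\<lambda>n. t - mesh n" \<tau>])
         (use \<tau> in \<open>auto intro!: always_eventually simp: algebra_simps\<close>)
    have close: "\<bar>integral {0..\<tau> n} (\<lambda>s. g s \<bullet> w) - (x (\<tau> n) - x 0) \<bullet> w\<bar> \<le> norm w * integral {0..T} (\<rho> n)" for n
    proof -
      have \<tau>T: "\<tau> n \<le> T" using \<tau>(2)[of n] t by simp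
      have sub: "{0..\<tau> n} \<subseteq> {0..T}" using \<tau>T by simp
      have d: "((\<lambda>s. dquot n s \<bullet> w) has_integral (x (\<tau> n) - x 0) \<bullet> w) {0..\<tau> n}"
        unfolding \<tau>_def by (rule integral_dquot_inner) (use \<tau>T in \<open>simp add: \<tau>_def\<close>)
      have gi: "(\<lambda>s. g s \<bullet> w) integrable_on {0..\<tau> n}"
        by (rule integrable_on_subinterval[OF gw_int sub])
      have \<rho>i: "\<rho> n integrable_on {0..\<tau> n}" by (rule integrable_on_subinterval[OF \<rho>_int sub])
      have "integral {0..\<tau> n} (\<lambda>s. g s \<bullet> w) - (x (\<tau> n) - x 0) \<bullet> w
          = integral {0..\<tau> n} (\<lambda>s. g s \<bullet> w - dquot n s \<bullet> w)"
        using d gi by (subst Henstock_Kurzweil_Integration.integral_diff) (auto simp: integral_unique)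
      also have "norm \<dots> \<le> integral {0..\<tau> n} (\<lambda>s. norm w * \<rho> n s)"
      proof (rule integral_norm_bound_integral)
        show "(\<lambda>s. g s \<bullet> w - dquot n s \<bullet> w) integrable_on {0..\<tau> n}"
          using gi d by (intro integrable_diff) auto
        show "(\<lambda>s. norm w * \<rho> n s) integrable_on {0..\<tau> n}"
          by (intro integrable_on_mult_right \<rho>i)
        fix s
        have "\<bar>(g s - dquot n s) \<bullet> w\<bar> \<le> norm (g s - dquot n s) * norm w" by (rule Cauchy_Schwarz_ineq2)
        then show "norm (g s \<bullet> w - dquot n s \<bullet> w) \<le> norm w * \<rho> n s"
          by (simp add: \<rho>_def inner_diff_left norm_minus_commute mult.commute)
      qed
      also have "\<dots> = norm w * integral {0..\<tau> n} (\<rho> n)" by simp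
      also have "\<dots> \<le> norm w * integral {0..T} (\<rho> n)"
        by (intro mult_left_mono integral_subset_le sub \<rho>i \<rho>_int) (simp_all add: \<rho>_def)
      finally show ?thesis by simp
    qed
    have "continuous_on {0..T} (\<lambda>t. integral {0..t} (\<lambda>s. g s \<bullet> w) - (x t - x 0) \<bullet> w)"
      by (intro continuous_intros indefinite_integral_continuous_1 gw_int continuous_on_curve)
    then have "(\<lambda>n. integral {0..\<tau> n} (\<lambda>s. g s \<bullet> w) - (x (\<tau> n) - x 0) \<bullet> w)
        \<longlonglongrightarrow> integral {0..t} (\<lambda>s. g s \<bullet> w) - (x t - x 0) \<bullet> w"
      by (rule continuous_on_tendsto_compose[OF _ \<tau>_lim t])
         (use \<tau> t order_trans in \<open>fastforce intro!: always_eventually\<close>)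
    moreover have "(\<lambda>n. integral {0..\<tau> n} (\<lambda>s. g s \<bullet> w) - (x (\<tau> n) - x 0) \<bullet> w) \<longlonglongrightarrow> 0"
    proof (rule Lim_null_comparison)
      show "\<forall>\<^sub>F n in sequentially. norm (integral {0..\<tau> n} (\<lambda>s. g s \<bullet> w) - (x (\<tau> n) - x 0) \<bullet> w) \<le> norm w * integral {0..T} (\<rho> n)"
        using close by simp
      show "(\<lambda>n. norm w * integral {0..T} (\<rho> n)) \<longlonglongrightarrow> 0"
        using tendsto_mult_left[OF \<rho>_to0, of "norm w"] by simp
    qed
    ultimately have "integral {0..t} (\<lambda>s. g s \<bullet> w) = (x t - x 0) \<bullet> w"
      using LIMSEQ_unique by fastforce
    moreover have "(\<lambda>s. g s \<bullet> w) integrable_on {0..t}"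
      using t by (intro integrable_on_subinterval[OF gw_int]) auto
    ultimately show ?thesis by (metis integrable_integral)
  qed
  have dev: "norm (x t - x s - (t - s) *\<^sub>R q) \<le> integral {s..t} (\<lambda>\<tau>. norm (g \<tau> - q))"
    if st: "0 \<le> s" "s \<le> t" "t \<le> T" for s t q
  proof -
    define v where "v = x t - x s - (t - s) *\<^sub>R q"
    have sub: "{s..t} \<subseteq> {0..T}" using st by auto
    have gi: "(\<lambda>\<tau>. g \<tau> \<bullet> v) integrable_on {s..t}" by (rule integrable_on_subinterval[OF gw_int sub])
    have ni: "(\<lambda>\<tau>. norm (g \<tau> - q)) integrable_on {s..t}" by (rule integrable_on_subinterval[OF gq_int sub])
    have "integral {s..t} (\<lambda>\<tau>. g \<tau> \<bullet> v) = (x t - x 0) \<bullet> v - (x s - x 0) \<bullet> v"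
      using integral_split[OF gw_int st, of v] integral_unique[OF ftc, of t v] integral_unique[OF ftc, of s v] st by simp
    then have "integral {s..t} (\<lambda>\<tau>. g \<tau> \<bullet> v - q \<bullet> v) = (x t - x 0) \<bullet> v - (x s - x 0) \<bullet> v - (t - s) * (q \<bullet> v)"
      using st gi by (subst Henstock_Kurzweil_Integration.integral_diff) (simp_all add: integrable_const_ivl)
    also have "\<dots> = (norm v)\<^sup>2"
    proof -
      have "v \<bullet> v = (x t - x s - (t - s) *\<^sub>R q) \<bullet> v" by (simp add: v_def)
      then show ?thesis by (simp add: power2_norm_eq_inner inner_diff_left)
    qed
    finally have eq: "integral {s..t} (\<lambda>\<tau>. g \<tau> \<bullet> v - q \<bullet> v) = (norm v)\<^sup>2" .
    have "norm (integral {s..t} (\<lambda>\<tau>. g \<tau> \<bullet> v - q \<bullet> v)) \<le> integral {s..t} (\<lambda>\<tau>. norm (g \<tau> - q) * norm v)"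
    proof (rule integral_norm_bound_integral)
      show "(\<lambda>\<tau>. g \<tau> \<bullet> v - q \<bullet> v) integrable_on {s..t}"
        by (rule integrable_diff[OF gi integrable_const_ivl])
      show "(\<lambda>\<tau>. norm (g \<tau> - q) * norm v) integrable_on {s..t}" by (rule integrable_on_mult_left[OF ni])
      show "norm (g \<tau> \<bullet> v - q \<bullet> v) \<le> norm (g \<tau> - q) * norm v" for \<tau>
        using Cauchy_Schwarz_ineq2[of "g \<tau> - q" v] by (simp add: inner_diff_left)
    qed
    then have "norm v * norm v \<le> integral {s..t} (\<lambda>\<tau>. norm (g \<tau> - q)) * norm v"
      using eq by (simp add: power2_eq_square)
    moreover have "0 \<le> integral {s..t} (\<lambda>\<tau>. norm (g \<tau> - q))" by (rule integral_nonneg[OF ni]) simp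
    ultimately have "norm v \<le> integral {s..t} (\<lambda>\<tau>. norm (g \<tau> - q))"
      by (cases "norm v = 0") auto
    then show ?thesis by (simp add: v_def)
  qed
  have "(\<lambda>k. integral {0..T} (\<rho> (r k))) \<longlonglongrightarrow> 0"
    using LIMSEQ_subseq_LIMSEQ[OF \<rho>_to0 r] by (simp add: o_def)
  then obtain s where s: "strict_mono s" and s_small: "\<And>k. integral {0..T} (\<rho> (r (s k))) < (1/4) ^ k"
    by (rule small_subsequence[where e = "\<lambda>k. (1/4) ^ k"]) auto
  define n where "n k = r (s k)" for k
  have "\<exists>W. W \<in> lmeasurable \<and> measure lebesgue W \<le> 5 / (1/2) ^ k * integral {0..T} (\<rho> (n k)) \<and>
      (\<forall>t \<in> {0..T} - W. \<forall>s\<in>{0..T}. integral {min s t..max s t} (\<rho> (n k)) \<le> (1/2) ^ k * \<bar>s - t\<bar>)" for k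
  proof (rule maximal_inequality[where f = "\<rho> (n k)" and a = 0 and b = T and \<alpha> = "(1/2) ^ k"])
    show "\<rho> (n k) integrable_on {0..T}" by (rule \<rho>_int)
    show "0 \<le> \<rho> (n k) t" for t by (simp add: \<rho>_def)
  qed (simp, blast)
  then obtain W where W: "\<And>k. W k \<in> lmeasurable"
    "\<And>k. measure lebesgue (W k) \<le> 5 / (1/2) ^ k * integral {0..T} (\<rho> (n k))"
    "\<And>k t s. t \<in> {0..T} - W k \<Longrightarrow> s \<in> {0..T} \<Longrightarrow> integral {min s t..max s t} (\<rho> (n k)) \<le> (1/2) ^ k * \<bar>s - t\<bar>"
    by metis
  have W_small: "measure lebesgue (W k) \<le> 5 * (1/2) ^ k" for k
  proof -
    have "5 / (1/2) ^ k * integral {0..T} (\<rho> (n k)) \<le> 5 / (1/2) ^ k * (1/4) ^ k"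
      using s_small[of k] by (intro mult_left_mono) (auto simp: n_def)
    also have "\<dots> = 5 * ((1/4) ^ k / (1/2) ^ k)" by simp
    also have "\<dots> = 5 * (1/2) ^ k" unfolding power_divide[symmetric] by simp
    finally show ?thesis using W(2)[of k] by linarith
  qed
  have "AE t in lebesgue. eventually (\<lambda>k. t \<in> space lebesgue - W k) sequentially"
  proof (rule borel_cantelli_AE1)
    show "W k \<in> sets lebesgue" for k using W(1) by (rule fmeasurableD)
    show "emeasure lebesgue (W k) < \<infinity>" for k using fmeasurableD2[OF W(1)[of k]] by (simp add: top.not_eq_extremum)
    show "summable (\<lambda>k. measure lebesgue (W k))"
      by (rule summable_comparison_test'[OF summable_mult[OF summable_geometric, of "1/2" 5], where N = 0])
         (use W_small in auto)
  qed
  then obtain N1 where N1: "negligible N1" "\<And>t. t \<notin> N1 \<Longrightarrow> eventually (\<lambda>k. t \<notin> W k) sequentially"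
  proof (rule AE_E3)
    fix N' assume "\<And>t. t \<in> space lebesgue - N' \<Longrightarrow> \<forall>\<^sub>F k in sequentially. t \<in> space lebesgue - W k" "N' \<in> null_sets lebesgue"
    then show thesis by (intro that[of N']) (auto simp: negligible_iff_null_sets)
  qed
  (* The step functions are locally constant off the countable set of grid points. *)
  define G where "G = (\<Union>n. \<Union>j::nat. {real j * mesh n})"
  have "countable G" unfolding G_def by (intro countable_UN) auto
  then have G: "negligible G" by (simp add: negligible_iff_null_sets null_sets_completionI countable_imp_null_set_lborel)
  have deriv: "(x has_vector_derivative g t) (at t)" if t: "t \<in> {0<..<T} - (N \<union> N1 \<union> G)" for t
    unfolding has_vector_derivative_def has_derivative_at_alt
  proof (intro conjI allI impI)
    show "bounded_linear (\<lambda>h. h *\<^sub>R g t)" by (rule bounded_linear_scaleR_left)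
    fix e :: real assume "e > 0"
    have "(\<lambda>k. dquot (n k) t) \<longlonglongrightarrow> g t"
      using LIMSEQ_subseq_LIMSEQ[OF lim s] t by (auto simp: n_def o_def)
    then have "\<forall>\<^sub>F k in sequentially. norm (dquot (n k) t - g t) < e / 2"
      using \<open>e > 0\<close> unfolding tendsto_iff dist_norm by (meson half_gt_zero)
    moreover have "\<forall>\<^sub>F k in sequentially. (1/2) ^ k < e / 2"
      using \<open>e > 0\<close> by (intro order_tendstoD(2)[OF LIMSEQ_power_zero]) auto
    moreover have "\<forall>\<^sub>F k in sequentially. t \<notin> W k" using N1 t by auto
    ultimately have "\<forall>\<^sub>F k in sequentially. norm (dquot (n k) t - g t) < e / 2 \<and> (1/2) ^ k < e / 2 \<and> t \<notin> W k"
      by eventually_elim simp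
    then obtain k where k: "norm (dquot (n k) t - g t) < e / 2" "(1/2) ^ k < e / 2" "t \<notin> W k"
      by (auto simp: eventually_sequentially)
    define q where "q = dquot (n k) t"
    have "t / mesh (n k) \<notin> \<int>"
    proof
      assume "t / mesh (n k) \<in> \<int>"
      then obtain i where i: "t / mesh (n k) = of_int i" by (auto elim: Ints_cases)
      have "t / mesh (n k) > 0" using t mesh_pos[of "n k"] by simp
      then have "t = real (nat i) * mesh (n k)" using i mesh_pos[of "n k"] by (simp add: field_simps)
      then show False using t by (auto simp: G_def)
    qed
    then obtain d where d: "d > 0" "\<And>s. \<bar>s - t\<bar> < d \<Longrightarrow> \<lfloor>s / mesh (n k)\<rfloor> = \<lfloor>t / mesh (n k)\<rfloor>"
      using floor_step_locally_constant[OF mesh_pos] by metis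
    have qd: "dquot (n k) s = q" if "\<bar>s - t\<bar> < d" for s using d(2)[OF that] by (simp add: q_def dquot_def)
    show "\<exists>d>0. \<forall>y. norm (y - t) < d \<longrightarrow> norm (x y - x t - (y - t) *\<^sub>R g t) \<le> e * norm (y - t)"
    proof (intro exI[of _ "min d (min t (T - t))"] conjI allI impI)
      show "min d (min t (T - t)) > 0" using d t by simp
      fix y assume y: "norm (y - t) < min d (min t (T - t))"
      then have yT: "y \<in> {0..T}" "\<bar>y - t\<bar> < d" by auto
      have "norm (x y - x t - (y - t) *\<^sub>R q) \<le> integral {min y t..max y t} (\<lambda>\<tau>. norm (g \<tau> - q))"
      proof (cases "t \<le> y")
        case True
        then show ?thesis using dev[of t y q] yT t by (simp add: min_def max_def)
      next
        case False
        then have "norm (x t - x y - (t - y) *\<^sub>R q) \<le> integral {y..t} (\<lambda>\<tau>. norm (g \<tau> - q))"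
          using dev[of y t q] yT t by simp
        moreover have "x t - x y - (t - y) *\<^sub>R q = - (x y - x t - (y - t) *\<^sub>R q)"
          by (simp add: algebra_simps)
        ultimately show ?thesis using False by (simp add: min_def max_def del: minus_diff_eq)
      qed
      also have "integral {min y t..max y t} (\<lambda>\<tau>. norm (g \<tau> - q)) = integral {min y t..max y t} (\<rho> (n k))"
      proof (rule integral_cong)
        fix \<tau> assume "\<tau> \<in> {min y t..max y t}"
        then have "\<bar>\<tau> - t\<bar> < d" using yT by auto
        then show "norm (g \<tau> - q) = \<rho> (n k) \<tau>" using qd[of \<tau>] by (simp add: \<rho>_def norm_minus_commute)
      qed
      also have "\<dots> \<le> (1/2) ^ k * \<bar>y - t\<bar>" using W(3)[of t k y] k t yT by simp
      also have "\<dots> \<le> e / 2 * \<bar>y - t\<bar>" using k by (intro mult_right_mono) auto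
      finally have 1: "norm (x y - x t - (y - t) *\<^sub>R q) \<le> e / 2 * \<bar>y - t\<bar>" .
      have "norm ((y - t) *\<^sub>R (q - g t)) \<le> \<bar>y - t\<bar> * (e / 2)"
        unfolding norm_scaleR using k by (intro mult_mono) (auto simp: q_def)
      then have 2: "norm ((y - t) *\<^sub>R (q - g t)) \<le> e / 2 * \<bar>y - t\<bar>" by (simp add: mult.commute)
      have eq: "x y - x t - (y - t) *\<^sub>R g t = (x y - x t - (y - t) *\<^sub>R q) + (y - t) *\<^sub>R (q - g t)"
        by (simp add: algebra_simps)
      have "norm (x y - x t - (y - t) *\<^sub>R g t) \<le> e / 2 * \<bar>y - t\<bar> + e / 2 * \<bar>y - t\<bar>"
        unfolding eq by (rule norm_triangle_le[OF add_mono[OF 1 2]])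
      then show "norm (x y - x t - (y - t) *\<^sub>R g t) \<le> e * norm (y - t)" by simp
    qed
  qed
  show ?thesis
    by (rule that[OF _ deriv g2_int meas ftc, of "N \<union> N1 \<union> G"]) (use N N1 G in \<open>simp_all add: negligible_Un\<close>)
qed

end

section \<open>Calculus of absolutely continuous curves\<close>

text \<open>The same curves as in \<open>AC2\<close>, on the closed interval and with a nonnegative Borel bound, so that
  initial values and integrals over all subintervals make sense.\<close>

definition L2_AC :: "real \<Rightarrow> (real \<Rightarrow> 'a::real_normed_vector) \<Rightarrow> bool"
  where "L2_AC T x \<longleftrightarrow> (\<exists>\<beta>. \<beta> \<in> borel_measurable borel \<and> (\<forall>t. 0 \<le> \<beta> t) \<and>
    \<beta> integrable_on {0..T} \<and> (\<lambda>t. (\<beta> t)\<^sup>2) integrable_on {0..T} \<and>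
    (\<forall>s t. 0 \<le> s \<and> s \<le> t \<and> t \<le> T \<longrightarrow> norm (x t - x s) \<le> integral {s..t} \<beta>))"

lemma L2_AC_E:
  assumes "L2_AC T x"
  obtains \<beta> where "\<beta> \<in> borel_measurable borel" "\<forall>t. 0 \<le> \<beta> t" "\<beta> integrable_on {0..T}"
    "(\<lambda>t. (\<beta> t)\<^sup>2) integrable_on {0..T}"
    "\<forall>s t. 0 \<le> s \<and> s \<le> t \<and> t \<le> T \<longrightarrow> norm (x t - x s) \<le> integral {s..t} \<beta>"
  using assms unfolding L2_AC_def by blast

lemma L2_AC_add:
  assumes "L2_AC T x" "L2_AC T y"
  shows "L2_AC T (\<lambda>t. x t + y t)"
proof -
  obtain \<beta> where \<beta>: "\<beta> \<in> borel_measurable borel" "\<forall>t. 0 \<le> \<beta> t" "\<beta> integrable_on {0..T}"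
    "(\<lambda>t. (\<beta> t)\<^sup>2) integrable_on {0..T}"
    "\<forall>s t. 0 \<le> s \<and> s \<le> t \<and> t \<le> T \<longrightarrow> norm (x t - x s) \<le> integral {s..t} \<beta>"
    using assms(1) by (rule L2_AC_E)
  obtain \<alpha> where \<alpha>: "\<alpha> \<in> borel_measurable borel" "\<forall>t. 0 \<le> \<alpha> t" "\<alpha> integrable_on {0..T}"
    "(\<lambda>t. (\<alpha> t)\<^sup>2) integrable_on {0..T}"
    "\<forall>s t. 0 \<le> s \<and> s \<le> t \<and> t \<le> T \<longrightarrow> norm (y t - y s) \<le> integral {s..t} \<alpha>"
    using assms(2) unfolding L2_AC_def by blast
  have meas: "(\<lambda>t. \<beta> t + \<alpha> t) \<in> borel_measurable borel" using \<beta>(1) \<alpha>(1) by measurable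
  have sq: "(\<lambda>t. (\<beta> t + \<alpha> t)\<^sup>2) integrable_on {0..T}"
  proof (rule measurable_bounded_by_integrable_imp_integrable)
    show "(\<lambda>t. (\<beta> t + \<alpha> t)\<^sup>2) \<in> borel_measurable (lebesgue_on {0..T})"
      by (rule borel_measurable_lebesgue_onI) (use meas in measurable)
    show "(\<lambda>t. 2 * (\<beta> t)\<^sup>2 + 2 * (\<alpha> t)\<^sup>2) integrable_on {0..T}"
      by (rule integrable_add[OF integrable_on_mult_right[OF \<beta>(4)] integrable_on_mult_right[OF \<alpha>(4)]])
    show "norm ((\<beta> t + \<alpha> t)\<^sup>2) \<le> 2 * (\<beta> t)\<^sup>2 + 2 * (\<alpha> t)\<^sup>2" for t
    proof -
      have "(\<beta> t + \<alpha> t)\<^sup>2 \<le> 2 * (\<beta> t)\<^sup>2 + 2 * (\<alpha> t)\<^sup>2"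
        using sum_squares_bound[of "\<beta> t" "\<alpha> t"] unfolding power2_sum by linarith
      then show ?thesis by simp
    qed
  qed simp
  have "norm (x t + y t - (x s + y s)) \<le> integral {s..t} (\<lambda>t. \<beta> t + \<alpha> t)"
    if "0 \<le> s" "s \<le> t" "t \<le> T" for s t
  proof -
    have sub: "{s..t} \<subseteq> {0..T}" using that by auto
    have "norm (x t + y t - (x s + y s)) \<le> norm (x t - x s) + norm (y t - y s)"
      using norm_triangle_ineq[of "x t - x s" "y t - y s"] by (simp add: algebra_simps)
    also have "\<dots> \<le> integral {s..t} \<beta> + integral {s..t} \<alpha>"
      using \<beta>(5) \<alpha>(5) that by (intro add_mono) auto
    also have "\<dots> = integral {s..t} (\<lambda>t. \<beta> t + \<alpha> t)"
      by (rule Henstock_Kurzweil_Integration.integral_add[symmetric, OF integrable_on_subinterval[OF \<beta>(3) sub] integrable_on_subinterval[OF \<alpha>(3) sub]])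
    finally show ?thesis .
  qed
  then show ?thesis unfolding L2_AC_def
    using meas sq \<beta>(2) \<alpha>(2) integrable_add[OF \<beta>(3) \<alpha>(3)]
    by (intro exI[of _ "\<lambda>t. \<beta> t + \<alpha> t"]) auto
qed

text \<open>The common source of the closure properties: scaling, primitives, products with Lipschitz
  functions.\<close>

lemma L2_AC_Lipschitz_bound:
  assumes x: "L2_AC T x" and "B \<ge> 0" "c \<ge> 0"
    and y: "\<And>s t. 0 \<le> s \<Longrightarrow> s \<le> t \<Longrightarrow> t \<le> T \<Longrightarrow> norm (y t - y s) \<le> c * norm (x t - x s) + B * (t - s)"
  shows "L2_AC T y"
proof -
  obtain \<beta> where \<beta>: "\<beta> \<in> borel_measurable borel" "\<forall>t. 0 \<le> \<beta> t" "\<beta> integrable_on {0..T}"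
    "(\<lambda>t. (\<beta> t)\<^sup>2) integrable_on {0..T}"
    "\<forall>s t. 0 \<le> s \<and> s \<le> t \<and> t \<le> T \<longrightarrow> norm (x t - x s) \<le> integral {s..t} \<beta>"
    using assms(1) by (rule L2_AC_E)
  have meas: "(\<lambda>t. c * \<beta> t + B) \<in> borel_measurable borel" using \<beta>(1) by measurable
  have sq: "(\<lambda>t. (c * \<beta> t + B)\<^sup>2) integrable_on {0..T}"
  proof -
    have "(\<lambda>t. c\<^sup>2 * (\<beta> t)\<^sup>2 + (2 * c * B) * \<beta> t + B\<^sup>2) integrable_on {0..T}"
      by (rule integrable_add[OF integrable_add[OF integrable_on_mult_right[OF \<beta>(4)] integrable_on_mult_right[OF \<beta>(3)]] integrable_const_ivl])
    then show ?thesis by (simp add: power2_eq_square algebra_simps)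
  qed
  have "norm (y t - y s) \<le> integral {s..t} (\<lambda>t. c * \<beta> t + B)"
    if "0 \<le> s" "s \<le> t" "t \<le> T" for s t
  proof -
    have sub: "{s..t} \<subseteq> {0..T}" using that by auto
    have "((\<lambda>t. c * \<beta> t + B) has_integral c * integral {s..t} \<beta> + B * (t - s)) {s..t}"
      using that has_integral_const_real[of B s t]
      by (intro has_integral_add[OF has_integral_mult_right[OF integrable_integral[OF integrable_on_subinterval[OF \<beta>(3) sub]]]])
         (simp add: mult.commute)
    then have "integral {s..t} (\<lambda>t. c * \<beta> t + B) = c * integral {s..t} \<beta> + B * (t - s)"
      by (rule integral_unique)
    moreover have "c * norm (x t - x s) \<le> c * integral {s..t} \<beta>"
      using \<beta>(5) that \<open>c \<ge> 0\<close> by (intro mult_left_mono) auto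
    ultimately show ?thesis using y[OF that] by linarith
  qed
  then show ?thesis unfolding L2_AC_def
    using meas sq \<beta>(2) integrable_add[OF integrable_on_mult_right[OF \<beta>(3), of c] integrable_const_ivl[of B]] assms(2,3)
    by (intro exI[of _ "\<lambda>t. c * \<beta> t + B"]) (auto intro!: add_nonneg_nonneg mult_nonneg_nonneg)
qed

lemma L2_AC_const: "L2_AC T (\<lambda>t. c)"
proof -
  have *: "(\<lambda>t::real. 0::real) integrable_on S" for S by (rule integrable_0)
  show ?thesis unfolding L2_AC_def by (rule exI[of _ "\<lambda>t. 0"]) (simp add: *)
qed

lemma L2_AC_Lipschitz:
  assumes "B \<ge> 0" "\<And>s t. 0 \<le> s \<Longrightarrow> s \<le> t \<Longrightarrow> t \<le> T \<Longrightarrow> norm (y t - y s) \<le> B * (t - s)"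
  shows "L2_AC T y"
  by (rule L2_AC_Lipschitz_bound[OF L2_AC_const[of T 0] assms(1) order_refl]) (use assms(2) in simp)

lemma L2_AC_scaleR: "L2_AC T x \<Longrightarrow> L2_AC T (\<lambda>t. a *\<^sub>R x t)"
  by (rule L2_AC_Lipschitz_bound[where x = x and B = 0 and c = "\<bar>a\<bar>"])
     (simp_all flip: scaleR_diff_right)

lemma L2_AC_diff:
  assumes "L2_AC T x" "L2_AC T y"
  shows "L2_AC T (\<lambda>t. x t - y t)"
  using L2_AC_add[OF assms(1) L2_AC_scaleR[OF assms(2), of "-1"]] by simp

lemma bounded_on_interval:
  fixes f :: "real \<Rightarrow> 'a::real_normed_vector"
  assumes "continuous_on {0..T} f"
  obtains B where "B > 0" "\<And>t. t \<in> {0..T} \<Longrightarrow> norm (f t) \<le> B"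
proof -
  have "bounded (f ` {0..T})"
    by (intro compact_imp_bounded compact_continuous_image assms compact_Icc)
  then show ?thesis using that unfolding bounded_pos by blast
qed

lemma C1_Lipschitz_on_interval:
  assumes x: "\<And>t. t \<in> {0..T} \<Longrightarrow> (x has_vector_derivative x' t) (at t within {0..T})"
    and x': "continuous_on {0..T} x'"
  obtains B where "B > 0" "\<And>s t. 0 \<le> s \<Longrightarrow> s \<le> t \<Longrightarrow> t \<le> T \<Longrightarrow> norm (x t - x s) \<le> B * (t - s)"
proof -
  obtain B where B: "B > 0" "\<And>t. t \<in> {0..T} \<Longrightarrow> norm (x' t) \<le> B"
    by (rule bounded_on_interval[OF x']) blast
  have "norm (x t - x s) \<le> B * (t - s)" if "0 \<le> s" "s \<le> t" "t \<le> T" for s t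
  proof -
    have "norm (x t - x s) \<le> B * norm (t - s)"
    proof (rule differentiable_bound[where f = x and f' = "\<lambda>t h. h *\<^sub>R x' t" and S = "{0..T}"])
      show "(x has_derivative (\<lambda>h. h *\<^sub>R x' t)) (at t within {0..T})" if "t \<in> {0..T}" for t
        using x[OF that] by (simp add: has_vector_derivative_def)
      show "onorm (\<lambda>h. h *\<^sub>R x' t) \<le> B" if "t \<in> {0..T}" for t
        by (rule onorm_le) (use B(2)[OF that] in \<open>simp add: mult.commute[of B] mult_left_mono\<close>)
    qed (use that in auto)
    then show ?thesis using that by simp
  qed
  with that B(1) show ?thesis by blast
qed

lemma L2_AC_C1:
  assumes "\<And>t. t \<in> {0..T} \<Longrightarrow> (x has_vector_derivative x' t) (at t within {0..T})"
    and "continuous_on {0..T} x'"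
  shows "L2_AC T x"
proof -
  obtain B where "B > 0" "\<And>s t. 0 \<le> s \<Longrightarrow> s \<le> t \<Longrightarrow> t \<le> T \<Longrightarrow> norm (x t - x s) \<le> B * (t - s)"
    by (rule C1_Lipschitz_on_interval[OF assms]) (assumption | blast)+
  then show ?thesis by (intro L2_AC_Lipschitz[of B]) auto
qed

lemma L2_AC_imp_AC2:
  assumes "L2_AC T x"
  shows "AC2 T x"
proof -
  obtain \<beta> where \<beta>: "\<beta> \<in> borel_measurable borel" "\<forall>t. 0 \<le> \<beta> t" "\<beta> integrable_on {0..T}"
    "(\<lambda>t. (\<beta> t)\<^sup>2) integrable_on {0..T}"
    "\<forall>s t. 0 \<le> s \<and> s \<le> t \<and> t \<le> T \<longrightarrow> norm (x t - x s) \<le> integral {s..t} \<beta>"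
    using assms(1) by (rule L2_AC_E)
  have [measurable]: "\<beta> \<in> borel_measurable borel" by (rule \<beta>(1))
  have leb: "set_integrable lborel S f" "integral S f = (LINT u:S|lborel. f u)"
    if "f integrable_on S" "\<forall>t. 0 \<le> f t" "f \<in> borel_measurable borel" "S \<in> sets borel"
    for f :: "real \<Rightarrow> real" and S
  proof -
    have 1: "f absolutely_integrable_on S" using that by (intro nonnegative_absolutely_integrable_1) auto
    have [measurable]: "f \<in> borel_measurable borel" "S \<in> sets borel" using that by auto
    have m: "(\<lambda>t. indicator S t *\<^sub>R f t) \<in> borel_measurable lborel" by simp
    show 2: "set_integrable lborel S f"
      using 1 integrable_completion[OF m] unfolding set_integrable_def by simp
    show "integral S f = (LINT u:S|lborel. f u)"
      using set_lebesgue_integral_eq_integral(2)[OF 1] integral_completion[OF m]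
      unfolding set_lebesgue_integral_def by simp
  qed
  show ?thesis unfolding AC2_def
  proof (intro exI[of _ \<beta>] conjI allI impI)
    show "set_borel_measurable lborel {0<..<T} \<beta>"
      unfolding set_borel_measurable_def by simp
    have "set_integrable lborel {0..T} (\<lambda>u. (\<beta> u)\<^sup>2)"
      by (rule leb(1)) (use \<beta>(4) in auto)
    then show "set_integrable lborel {0<..<T} (\<lambda>u. (\<beta> u)\<^sup>2)"
      by (rule set_integrable_subset) auto
    fix s t assume st: "0 < s \<and> s < t \<and> t < T"
    have "\<beta> integrable_on {s..t}" using st by (intro integrable_on_subinterval[OF \<beta>(3)]) auto
    then have "integral {s..t} \<beta> = (LINT u:{s..t}|lborel. \<beta> u)"
      by (rule leb(2)) (use \<beta>(2) in auto)
    then show "norm (x t - x s) \<le> (LINT u:{s..t}|lborel. \<beta> u)" using \<beta>(5)[rule_format, of s t] st by simp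
  qed
qed

text \<open>At time \<open>0\<close> the increment bound survives by passing to the limit; the larger interval \<open>(0,T')\<close> keeps
  the right end point inside the domain of the bound.\<close>

lemma AC2_imp_L2_AC:
  assumes x: "AC2 T' x" and "T < T'" and lim: "(x \<longlongrightarrow> M) (at_right 0)"
  shows "L2_AC T (x(0 := M))"
proof (cases "T > 0")
  case False
  have *: "(\<lambda>t::real. 0::real) integrable_on S" for S by (rule integrable_0)
  show ?thesis unfolding L2_AC_def
  proof (rule exI[of _ "\<lambda>t. 0"], intro conjI allI impI)
    fix s t :: real assume "0 \<le> s \<and> s \<le> t \<and> t \<le> T"
    then have "s = 0" "t = 0" using False by auto
    then show "norm ((x(0 := M)) t - (x(0 := M)) s) \<le> integral {s..t} (\<lambda>t. 0)" by simp
  qed (simp_all add: *)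
next
  case True
  obtain b where b: "set_borel_measurable lborel {0<..<T'} b"
    "set_integrable lborel {0<..<T'} (\<lambda>u. (b u)\<^sup>2)"
    "\<And>s t. 0 < s \<Longrightarrow> s < t \<Longrightarrow> t < T' \<Longrightarrow> norm (x t - x s) \<le> (LINT u:{s..t}|lborel. b u)"
    using x unfolding AC2_def by blast
  define \<beta> where "\<beta> t = \<bar>indicator {0<..<T'} t * b t\<bar>" for t :: real
  have meas: "\<beta> \<in> borel_measurable borel"
    using b(1) unfolding \<beta>_def set_borel_measurable_def by simp
  have "integrable lborel (\<lambda>t. (\<beta> t)\<^sup>2)"
  proof -
    have "(\<beta> t)\<^sup>2 = indicator {0<..<T'} t *\<^sub>R (b t)\<^sup>2" for t
      by (auto simp: \<beta>_def indicator_def)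
    then show ?thesis using b(2) by (simp add: set_integrable_def)
  qed
  then have sq: "(\<lambda>t. (\<beta> t)\<^sup>2) integrable_on S" if "S \<in> sets borel" for S
    using that by (intro set_borel_integral_eq_integral(1)) 
      (use integrable_mult_indicator[of S lborel "\<lambda>t. (\<beta> t)\<^sup>2"] in \<open>simp add: set_integrable_def\<close>)
  have int: "\<beta> integrable_on {0..T}"
    using integrable_of_square_integrable[OF borel_measurable_lebesgue_onI[OF meas] sq]
    by (intro set_lebesgue_integral_eq_integral(1)) auto
  have le: "norm (x t - x s) \<le> integral {s..t} \<beta>" if st: "0 < s" "s < t" "t \<le> T" for s t
  proof -
    have intst: "\<beta> integrable_on {s..t}" using st by (intro integrable_on_subinterval[OF int]) auto
    have "\<beta> absolutely_integrable_on {s..t}"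
      using intst by (intro nonnegative_absolutely_integrable_1) (auto simp: \<beta>_def)
    then have 1: "set_integrable lborel {s..t} \<beta>"
      unfolding set_integrable_def by (subst (asm) integrable_completion) (use meas in simp_all)
    have eq: "indicator {s..t} u *\<^sub>R \<bar>b u\<bar> = indicator {s..t} u *\<^sub>R \<beta> u" for u
      using st \<open>T < T'\<close> by (auto simp: \<beta>_def indicator_def)
    have eqb: "indicator {s..t} u *\<^sub>R b u = indicator {s..t} u *\<^sub>R (indicator {0<..<T'} u *\<^sub>R b u)" for u
      using st \<open>T < T'\<close> by (auto simp: indicator_def)
    have "norm (x t - x s) \<le> (LINT u:{s..t}|lborel. b u)" using b(3) st \<open>T < T'\<close> by simp
    also have "\<dots> \<le> (LINT u:{s..t}|lborel. \<beta> u)"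
      unfolding set_lebesgue_integral_def
    proof (rule integral_mono_AE)
      show "integrable lborel (\<lambda>u. indicator {s..t} u *\<^sub>R \<beta> u)" using 1 by (simp add: set_integrable_def)
      then show "integrable lborel (\<lambda>u. indicator {s..t} u *\<^sub>R b u)"
      proof (rule Bochner_Integration.integrable_bound)
        show "(\<lambda>u. indicator {s..t} u *\<^sub>R b u) \<in> borel_measurable lborel"
          unfolding eqb using b(1) unfolding set_borel_measurable_def by measurable
        show "AE u in lborel. norm (indicator {s..t} u *\<^sub>R b u) \<le> norm (indicator {s..t} u *\<^sub>R \<beta> u)"
          unfolding eq[symmetric] by (auto simp: indicator_def)
      qed
      show "AE u in lborel. indicator {s..t} u *\<^sub>R b u \<le> indicator {s..t} u *\<^sub>R \<beta> u"
        unfolding eq[symmetric] by (auto simp: indicator_def)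
    qed
    also have "\<dots> = integral {s..t} \<beta>" by (rule set_borel_integral_eq_integral(2)[OF 1])
    finally show ?thesis .
  qed
  have le0: "norm (x t - M) \<le> integral {0..t} \<beta>" if t: "0 < t" "t \<le> T" for t
  proof (rule tendsto_upperbound)
    show "((\<lambda>s. norm (x t - x s)) \<longlongrightarrow> norm (x t - M)) (at_right 0)"
      by (intro tendsto_intros lim)
    have "\<forall>\<^sub>F s in at_right 0. s \<in> {0<..<t}" by (rule eventually_at_right_real[OF t(1)])
    then show "\<forall>\<^sub>F s in at_right 0. norm (x t - x s) \<le> integral {0..t} \<beta>"
    proof eventually_elim
      case (elim s)
      have "norm (x t - x s) \<le> integral {s..t} \<beta>" using le elim t by simp
      also have "\<dots> \<le> integral {0..t} \<beta>"
        using elim t by (intro integral_subset_le integrable_on_subinterval[OF int]) (auto simp: \<beta>_def)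
      finally show ?case .
    qed
  qed simp
  show ?thesis unfolding L2_AC_def
  proof (rule exI[of _ \<beta>], intro conjI allI impI)
    show "(\<lambda>t. (\<beta> t)\<^sup>2) integrable_on {0..T}" by (rule sq) simp
    show "0 \<le> \<beta> t" for t by (simp add: \<beta>_def)
    fix s t assume st: "0 \<le> s \<and> s \<le> t \<and> t \<le> T"
    show "norm ((x(0 := M)) t - (x(0 := M)) s) \<le> integral {s..t} \<beta>"
    proof (cases "s = t")
      case False
      then show ?thesis using le[of s t] le0[of t] st by (cases "s = 0") auto
    qed simp
  qed (rule meas int)+
qed

text \<open>Version of \<open>ae_derivative\<close> for \<open>vector_derivative\<close>, which is the derivative that the cost refers to.\<close>

theorem L2_AC_derivative:
  fixes x :: "real \<Rightarrow> 'a::{real_inner, banach}"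
  assumes "L2_AC T x" "T > 0"
  shows "\<exists>N. negligible N \<and> (\<forall>t\<in>{0<..<T} - N. (x has_vector_derivative vector_derivative x (at t)) (at t))"
    and "(\<lambda>t. (norm (vector_derivative x (at t)))\<^sup>2) integrable_on {0..T}"
    and "t \<in> {0..T} \<Longrightarrow> ((\<lambda>s. vector_derivative x (at s) \<bullet> w) has_integral (x t - x 0) \<bullet> w) {0..t}"
    and "continuous_on {0..T} x"
proof -
  obtain \<beta> where \<beta>: "\<forall>t. 0 \<le> \<beta> t" "\<beta> integrable_on {0..T}" "(\<lambda>t. (\<beta> t)\<^sup>2) integrable_on {0..T}"
    "\<forall>s t. 0 \<le> s \<and> s \<le> t \<and> t \<le> T \<longrightarrow> norm (x t - x s) \<le> integral {s..t} \<beta>"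
    using assms(1) unfolding L2_AC_def by blast
  interpret L2_curve x \<beta> T
    by unfold_locales (use assms \<beta> in auto)
  show "continuous_on {0..T} x" by (rule continuous_on_curve)
  obtain g N where N: "negligible N" and d: "\<And>t. t \<in> {0<..<T} - N \<Longrightarrow> (x has_vector_derivative g t) (at t)"
    and g2: "(\<lambda>t. (norm (g t))\<^sup>2) integrable_on {0..T}"
    and ftc: "\<And>t w. t \<in> {0..T} \<Longrightarrow> ((\<lambda>s. g s \<bullet> w) has_integral (x t - x 0) \<bullet> w) {0..t}"
    by (rule ae_derivative) blast
  have eq: "vector_derivative x (at t) = g t" if "t \<in> {0<..<T} - N" for t
    by (rule vector_derivative_at[OF d[OF that]])
  show "\<exists>N. negligible N \<and> (\<forall>t\<in>{0<..<T} - N. (x has_vector_derivative vector_derivative x (at t)) (at t))"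
    using N d eq by auto
  have N': "negligible (N \<union> {0, T})" using N by simp
  show "(\<lambda>t. (norm (vector_derivative x (at t)))\<^sup>2) integrable_on {0..T}"
    by (rule integrable_spike[OF g2 N']) (use eq in auto)
  show "((\<lambda>s. vector_derivative x (at s) \<bullet> w) has_integral (x t - x 0) \<bullet> w) {0..t}" if "t \<in> {0..T}"
    by (rule has_integral_spike[OF N' _ ftc[OF that]]) (use eq that in auto)
qed

text \<open>Difference quotients of a continuous curve are continuous in time, so \<open>\<Psi>\<close> of the derivative is an
  almost everywhere limit of continuous functions.\<close>

lemma L2_AC_measurable_derivative:
  fixes x :: "real \<Rightarrow> 'a::{real_inner, banach}" and \<Psi> :: "real \<times> 'a \<Rightarrow> real"
  assumes x: "L2_AC T x" "T > 0" and \<Psi>: "continuous_on ({0..T} \<times> UNIV) \<Psi>"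
  shows "(\<lambda>t. \<Psi> (t, vector_derivative x (at t))) \<in> borel_measurable (lebesgue_on {0..T})"
proof -
  define S where "S = {0..T}"
  obtain N where N: "negligible N" "\<And>t. t \<in> {0<..<T} - N \<Longrightarrow> (x has_vector_derivative vector_derivative x (at t)) (at t)"
    using L2_AC_derivative(1)[OF x] by blast
  define y where "y t = x (max 0 (min T t))" for t
  have y: "continuous_on UNIV y" unfolding y_def
    using x(2) by (intro continuous_on_compose2[OF L2_AC_derivative(4)[OF x]] continuous_intros) auto
  define f where "f k t = \<Psi> (t, real (Suc k) *\<^sub>R (y (t + inverse (real (Suc k))) - y t))" for k t
  have fk: "f k \<in> borel_measurable (lebesgue_on S)" for k
  proof -
    have yc: "continuous_on A (\<lambda>t. y (h t))" if "continuous_on A h" for h A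
      by (rule continuous_on_compose2[OF y that]) simp
    have "continuous_on S (f k)" unfolding f_def S_def
      by (intro continuous_on_compose2[OF \<Psi>] continuous_intros yc) auto
    then show ?thesis by (intro continuous_imp_measurable_on_sets_lebesgue) (auto simp: S_def)
  qed
  define g where "g t = (if t \<in> {0<..<T} - N then \<Psi> (t, vector_derivative x (at t)) else 0)" for t
  define f' where "f' k t = (if t \<in> {0<..<T} - N then f k t else 0)" for k t
  have Sm: "{0<..<T} - N \<in> sets (lebesgue_on S)"
  proof -
    have "{0<..<T} - N \<in> sets lebesgue"
      using N(1) by (intro sets.Diff) (auto simp: negligible_iff_null_sets)
    then show ?thesis by (subst sets_restrict_space_iff) (auto simp: S_def)
  qed
  have lim: "(\<lambda>k. f' k t) \<longlonglongrightarrow> g t" for t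
  proof (cases "t \<in> {0<..<T} - N")
    case True
    let ?D = "vector_derivative x (at t)"
    have "((\<lambda>h. norm (x (t + h) - x t - h *\<^sub>R ?D) / norm h) \<longlongrightarrow> 0) (at 0)"
      using N(2)[OF True] unfolding has_vector_derivative_def has_derivative_at by auto
    moreover have "filterlim (\<lambda>k. inverse (real (Suc k))) (at 0) sequentially"
      unfolding filterlim_at using LIMSEQ_inverse_real_of_nat by auto
    ultimately have l0: "(\<lambda>k. norm (x (t + inverse (real (Suc k))) - x t - inverse (real (Suc k)) *\<^sub>R ?D) / norm (inverse (real (Suc k)))) \<longlonglongrightarrow> 0"
      by (rule filterlim_compose)
    have eq: "norm (x (t + inverse (real (Suc k))) - x t - inverse (real (Suc k)) *\<^sub>R ?D) / norm (inverse (real (Suc k)))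
      = norm (real (Suc k) *\<^sub>R (x (t + inverse (real (Suc k))) - x t) - ?D)" for k
    proof -
      have "real (Suc k) *\<^sub>R (x (t + inverse (real (Suc k))) - x t) - ?D
        = real (Suc k) *\<^sub>R (x (t + inverse (real (Suc k))) - x t - inverse (real (Suc k)) *\<^sub>R ?D)"
        by (simp add: scaleR_diff_right del: of_nat_Suc)
      then show ?thesis by (simp add: divide_inverse mult.commute del: of_nat_Suc)
    qed
    have "(\<lambda>k. real (Suc k) *\<^sub>R (x (t + inverse (real (Suc k))) - x t)) \<longlonglongrightarrow> ?D"
      using l0 unfolding eq by (simp only: tendsto_norm_zero_iff LIM_zero_iff)
    moreover have "\<forall>\<^sub>F k in sequentially. real (Suc k) *\<^sub>R (x (t + inverse (real (Suc k))) - x t) = real (Suc k) *\<^sub>R (y (t + inverse (real (Suc k))) - y t)"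
    proof -
      have "\<forall>\<^sub>F k in sequentially. inverse (real (Suc k)) < T - t"
        using True by (intro order_tendstoD(2)[OF LIMSEQ_inverse_real_of_nat]) auto
      then show ?thesis
      proof eventually_elim
        case (elim k)
        have "t + inverse (real (Suc k)) \<ge> 0" using True by (intro add_nonneg_nonneg) auto
        then show ?case using elim True by (simp add: y_def del: of_nat_Suc)
      qed
    qed
    ultimately have "(\<lambda>k. real (Suc k) *\<^sub>R (y (t + inverse (real (Suc k))) - y t)) \<longlonglongrightarrow> ?D"
      by (rule Lim_transform_eventually)
    then have "(\<lambda>k. f k t) \<longlonglongrightarrow> \<Psi> (t, ?D)"
      unfolding f_def using True
      by (intro continuous_on_tendsto_compose[OF \<Psi>] tendsto_Pair tendsto_const) auto
    then show ?thesis using True by (simp add: f'_def g_def)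
  qed (auto simp: f'_def g_def)
  have "f' k \<in> borel_measurable (lebesgue_on S)" for k
    unfolding f'_def
    by (rule measurable_If_set[OF fk]) (use Sm sets.sets_into_space[OF Sm] in \<open>simp_all add: Int_absorb2\<close>)
  then have "g \<in> borel_measurable (lebesgue_on S)"
    by (rule borel_measurable_LIMSEQ_real[OF lim])
  then have "g measurable_on S" by (subst measurable_on_iff_borel_measurable) (auto simp: S_def)
  then have "(\<lambda>t. \<Psi> (t, vector_derivative x (at t))) measurable_on S"
    by (rule measurable_on_spike[of _ _ "N \<union> {0, T}"]) (use N(1) in \<open>auto simp: g_def S_def\<close>)
  then show ?thesis unfolding S_def
    by (subst (asm) measurable_on_iff_borel_measurable) auto
qed

lemma L2_AC_norm_derivative_integrable:
  fixes x :: "real \<Rightarrow> 'a::{real_inner, banach}"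
  assumes x: "L2_AC T x" "T > 0"
  shows "(\<lambda>t. norm (vector_derivative x (at t))) integrable_on {0..T}"
proof -
  have "(\<lambda>t. norm (snd (t, vector_derivative x (at t)))) \<in> borel_measurable (lebesgue_on {0..T})"
    by (rule L2_AC_measurable_derivative[OF x, of "\<lambda>z. norm (snd z)"]) (intro continuous_intros)
  from integrable_of_square_integrable[OF this] show ?thesis
    using L2_AC_derivative(2)[OF x] set_lebesgue_integral_eq_integral(1) by auto
qed

lemma L2_AC_norm_le_integral_derivative:
  fixes x :: "real \<Rightarrow> 'a::{real_inner, banach}"
  assumes x: "L2_AC T x" and st: "0 \<le> s" "s \<le> t" "t \<le> T"
  shows "norm (x t - x s) \<le> integral {s..t} (\<lambda>\<tau>. norm (vector_derivative x (at \<tau>)))"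
proof (cases "T > 0")
  case True
  note x = x True
  let ?D = "\<lambda>\<tau>. vector_derivative x (at \<tau>)"
  (* Testing the weak fundamental theorem with the increment itself yields its norm. *)
  define v where "v = x t - x s"
  have sub: "{s..t} \<subseteq> {0..T}" using st by auto
  have i: "(\<lambda>\<tau>. ?D \<tau> \<bullet> v) integrable_on {0..t}" using L2_AC_derivative(3)[OF x, of t v] st by auto
  have ni: "(\<lambda>\<tau>. norm (?D \<tau>)) integrable_on {s..t}"
    by (rule integrable_on_subinterval[OF L2_AC_norm_derivative_integrable[OF x] sub])
  have "integral {0..s} (\<lambda>\<tau>. ?D \<tau> \<bullet> v) + integral {s..t} (\<lambda>\<tau>. ?D \<tau> \<bullet> v) = integral {0..t} (\<lambda>\<tau>. ?D \<tau> \<bullet> v)"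
    using st by (intro Henstock_Kurzweil_Integration.integral_combine i)
  then have "integral {s..t} (\<lambda>\<tau>. ?D \<tau> \<bullet> v) = (x t - x 0) \<bullet> v - (x s - x 0) \<bullet> v"
    using integral_unique[OF L2_AC_derivative(3)[OF x, of t v]] integral_unique[OF L2_AC_derivative(3)[OF x, of s v]] st by simp
  also have "\<dots> = norm v * norm v" by (simp add: v_def inner_diff_left flip: power2_eq_square) (simp add: power2_norm_eq_inner inner_diff_left)
  finally have eq: "integral {s..t} (\<lambda>\<tau>. ?D \<tau> \<bullet> v) = norm v * norm v" .
  have "norm (integral {s..t} (\<lambda>\<tau>. ?D \<tau> \<bullet> v)) \<le> integral {s..t} (\<lambda>\<tau>. norm (?D \<tau>) * norm v)"
  proof (rule integral_norm_bound_integral)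
    show "(\<lambda>\<tau>. ?D \<tau> \<bullet> v) integrable_on {s..t}" using st by (intro integrable_on_subinterval[OF i]) auto
    show "(\<lambda>\<tau>. norm (?D \<tau>) * norm v) integrable_on {s..t}" by (rule integrable_on_mult_left[OF ni])
    show "norm (?D \<tau> \<bullet> v) \<le> norm (?D \<tau>) * norm v" for \<tau> using Cauchy_Schwarz_ineq2 by simp
  qed
  then have "norm v * norm v \<le> integral {s..t} (\<lambda>\<tau>. norm (?D \<tau>)) * norm v" by (simp add: eq)
  moreover have "0 \<le> integral {s..t} (\<lambda>\<tau>. norm (?D \<tau>))" by (rule integral_nonneg[OF ni]) simp
  ultimately show ?thesis unfolding v_def[symmetric] by (cases "norm v = 0") auto
next
  case False
  then have "s = t" using st by simp
  then show ?thesis by simp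
qed

lemma L2_AC_real_FTC:
  fixes h :: "real \<Rightarrow> real"
  assumes "L2_AC T h" "T > 0"
  shows "((\<lambda>t. vector_derivative h (at t)) has_integral h T - h 0) {0..T}"
  using L2_AC_derivative(3)[OF assms, of T 1] assms(2) by simp

section \<open>Lipschitz gradients and strongly monotone maps\<close>

text \<open>The increment of the gradient between \<open>z\<close> and \<open>z + h\<close>, paired with a vector \<open>k\<close> of the same length as
  \<open>h\<close> in its own direction, is a combination of three quadratic errors along \<open>h\<close>, \<open>k\<close> and \<open>h + k\<close>; these
  cost \<open>1 + 1 + 4\<close>.\<close>

lemma gradient_Lipschitz_if_quadratic_error:
  fixes f :: "'a::real_inner \<Rightarrow> real" and G :: "'a \<Rightarrow> 'a"
  assumes err: "\<And>z h. \<bar>f (z + h) - f z - G z \<bullet> h\<bar> \<le> K * (norm h)\<^sup>2"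
  shows "norm (G z - G w) \<le> 6 * K * norm (z - w)"
proof -
  have K: "0 \<le> K * (norm h)\<^sup>2" for h :: 'a using err[of 0 h] by linarith
  have main: "norm (G (z + h) - G z) * norm h \<le> 6 * K * norm h * norm h" if "G (z + h) \<noteq> G z" "h \<noteq> 0" for z h
  proof -
    define d where "d = G (z + h) - G z"
    define k where "k = (norm h / norm d) *\<^sub>R d"
    have d0: "norm d > 0" using that by (simp add: d_def)
    have nk: "norm k = norm h" using d0 by (simp add: k_def)
    have dk: "d \<bullet> k = norm d * norm h"
      using d0 by (simp add: k_def power2_norm_eq_inner[symmetric] power2_eq_square)
    have "norm (h + k) \<le> 2 * norm h" using norm_triangle_ineq[of h k] nk by simp
    then have "(norm (h + k))\<^sup>2 \<le> (2 * norm h)\<^sup>2" by (rule power_mono) simp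
    moreover have "0 \<le> K" using K[of h] that by (simp add: zero_le_mult_iff)
    ultimately have hk: "K * (norm (h + k))\<^sup>2 \<le> K * (4 * (norm h)\<^sup>2)"
      by (intro mult_left_mono) (simp_all add: power_mult_distrib)
    have "d \<bullet> k = (f (z + (h + k)) - f z - G z \<bullet> (h + k)) - (f (z + h) - f z - G z \<bullet> h)
        - (f ((z + h) + k) - f (z + h) - G (z + h) \<bullet> k)"
      by (simp add: d_def inner_diff_left inner_add_right add.assoc)
    also have "\<dots> \<le> K * (norm (h + k))\<^sup>2 + K * (norm h)\<^sup>2 + K * (norm k)\<^sup>2"
      using err[of z "h + k"] err[of z h] err[of "z + h" k] by linarith
    also have "\<dots> \<le> 6 * K * norm h * norm h"
      using hk by (simp add: nk power2_eq_square)
    finally show ?thesis unfolding dk by (simp add: d_def)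
  qed
  show ?thesis
  proof (cases "z = w \<or> G z = G w")
    case True
    then show ?thesis using K[of "z - w"] by (cases "z = w") (auto simp: zero_le_mult_iff)
  next
    case False
    then have "z - w \<noteq> 0" "G (w + (z - w)) \<noteq> G w" by auto
    from main[OF this(2,1)] show ?thesis using False by simp
  qed
qed

text \<open>A step \<open>u - s (A u - p)\<close> of gradient descent with \<open>s = m / \<Lambda>\<^sup>2\<close> is a contraction.\<close>

lemma strongly_monotone_Lipschitz_surj:
  fixes A :: "'a::{real_inner, banach} \<Rightarrow> 'a"
  assumes "m > 0" and mono: "\<And>u v. (A u - A v) \<bullet> (u - v) \<ge> m * (norm (u - v))\<^sup>2"
    and lip: "\<And>u v. norm (A u - A v) \<le> \<Lambda> * norm (u - v)" and "m \<le> \<Lambda>"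
  shows "\<exists>u. A u = p"
proof -
  have "\<Lambda> > 0" using assms by linarith
  define s where "s = m / \<Lambda>\<^sup>2"
  have s: "s > 0" using \<open>m > 0\<close> \<open>\<Lambda> > 0\<close> by (simp add: s_def)
  define c where "c = 1 - (m / \<Lambda>)\<^sup>2"
  have "m / \<Lambda> \<le> 1" "0 < m / \<Lambda>" using assms \<open>\<Lambda> > 0\<close> by auto
  then have c: "0 \<le> c" "c < 1" unfolding c_def by (auto simp: power_le_one)
  define f where "f u = u - s *\<^sub>R (A u - p)" for u
  have "dist (f u) (f v) \<le> sqrt c * dist u v" for u v
  proof -
    define w D where "w = u - v" and "D = A u - A v"
    have "(norm (f u - f v))\<^sup>2 = (norm (w - s *\<^sub>R D))\<^sup>2"
      by (simp add: f_def w_def D_def algebra_simps)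
    also have "\<dots> = (norm w)\<^sup>2 - 2 * s * (D \<bullet> w) + s\<^sup>2 * (norm D)\<^sup>2"
      unfolding power2_norm_eq_inner
      by (simp add: inner_simps inner_commute algebra_simps power2_eq_square)
    also have "\<dots> \<le> (norm w)\<^sup>2 - 2 * s * (m * (norm w)\<^sup>2) + s\<^sup>2 * (\<Lambda> * norm w)\<^sup>2"
      using mono[of u v] lip[of u v] s
      by (intro add_mono diff_mono mult_left_mono power_mono) (auto simp: w_def D_def)
    also have "\<dots> = c * (norm w)\<^sup>2"
      using \<open>\<Lambda> > 0\<close> by (simp add: s_def c_def power_mult_distrib power_divide algebra_simps power2_eq_square)
    finally have "norm (f u - f v) \<le> sqrt (c * (norm w)\<^sup>2)" by (rule real_le_rsqrt)
    then show ?thesis by (simp add: dist_norm real_sqrt_mult w_def)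
  qed
  then have "\<exists>!u. f u = u" using c by (intro banach_fix_type[of "sqrt c"]) auto
  then obtain u where "f u = u" by blast
  then show ?thesis using s by (auto simp: f_def)
qed

section \<open>Global solutions of Lipschitz differential equations\<close>

lemma has_integral_exp:
  fixes c :: real
  assumes "c \<noteq> 0" "a \<le> b"
  shows "((\<lambda>r. exp (c * r)) has_integral (exp (c * b) - exp (c * a)) / c) {a..b}"
proof -
  have "((\<lambda>r. exp (c * r)) has_integral exp (c * b) / c - exp (c * a) / c) {a..b}"
  proof (rule fundamental_theorem_of_calculus[OF assms(2)])
    show "((\<lambda>r. exp (c * r) / c) has_vector_derivative exp (c * r)) (at r within {a..b})" for r
      unfolding has_real_derivative_iff_has_vector_derivative[symmetric]
      using assms(1) by (auto intro!: derivative_eq_intros)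
  qed
  then show ?thesis by (simp add: diff_divide_distrib)
qed

text \<open>Banach's fixed point theorem for the Picard map. Writing \<open>z t = z0 + exp(l t) u t\<close> with \<open>u\<close> bounded
  amounts to an exponentially weighted norm, in which the Picard map contracts by the factor \<open>1/2\<close>
  on the whole half-line as soon as \<open>l > 2 \<bar>\<Lambda>\<bar>\<close>.\<close>

theorem global_Lipschitz_ODE:
  fixes F :: "'a::banach \<Rightarrow> 'a"
  assumes lip: "\<And>u v. norm (F u - F v) \<le> \<Lambda> * norm (u - v)"
  shows "\<exists>z. z 0 = z0 \<and> (\<forall>t\<ge>0. (z has_vector_derivative F (z t)) (at t within {0..}))"
proof -
  (* The added 1 keeps l positive when the Lipschitz constant vanishes. *)
  define l where "l = 2 * \<bar>\<Lambda>\<bar> + 1"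
  have l: "l > 0" "\<bar>\<Lambda>\<bar> / l \<le> 1 / 2" by (simp_all add: l_def divide_le_eq)
  have lip': "norm (F u - F v) \<le> \<bar>\<Lambda>\<bar> * norm (u - v)" for u v
    by (rule order_trans[OF lip mult_right_mono]) auto
  have Fc: "continuous_on UNIV F"
    by (rule lipschitz_on_continuous_on[of "\<bar>\<Lambda>\<bar>"], rule lipschitz_onI) (use lip' in \<open>auto simp: dist_norm\<close>)
  define Z where "Z u t = z0 + exp (l * t) *\<^sub>R apply_bcontfun u t" for u :: "real \<Rightarrow>\<^sub>C 'a" and t :: real
  have Zc: "continuous_on S (\<lambda>t. F (Z u t))" for u S
    unfolding Z_def by (intro continuous_on_compose2[OF Fc] continuous_intros) auto
  have Zi: "(\<lambda>t. F (Z u t)) integrable_on {0..s}" for u s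
    by (rule integrable_continuous_real[OF Zc])
  define P where "P u t = exp (- (l * max 0 t)) *\<^sub>R integral {0..max 0 t} (\<lambda>r. F (Z u r))" for u t
  have bound: "exp (- (l * s)) * integral {0..s} (\<lambda>r. B * exp (l * r)) \<le> B / l" if "s \<ge> 0" "B \<ge> 0" for s B :: real
  proof -
    have "integral {0..s} (\<lambda>r. B * exp (l * r)) = B * ((exp (l * s) - 1) / l)"
      using has_integral_mult_right[OF has_integral_exp[of l 0 s], of B] l that
      by (intro integral_unique) simp
    then have "exp (- (l * s)) * integral {0..s} (\<lambda>r. B * exp (l * r)) = B / l * (1 - exp (- (l * s)))"
      by (simp add: exp_minus field_simps)
    also have "\<dots> \<le> B / l * 1" using that l by (intro mult_left_mono) auto
    finally show ?thesis by simp
  qed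
  have bint: "(\<lambda>r. B * exp (l * r)) integrable_on {0..s}" for B s :: real
    by (intro integrable_continuous_real continuous_intros)
  have "continuous_on UNIV (P u)" for u
  proof -
    have "continuous_on {0..} (\<lambda>s. integral {0..s} (\<lambda>r. F (Z u r)))"
      unfolding continuous_on_eq_continuous_within
    proof
      fix s :: real assume s: "s \<in> {0..}"
      have "((\<lambda>s. integral {0..s} (\<lambda>r. F (Z u r))) has_vector_derivative F (Z u s)) (at s within {0..s + 1})"
        by (rule integral_has_vector_derivative[OF Zc]) (use s in auto)
      then have "continuous (at s within {0..s + 1}) (\<lambda>s. integral {0..s} (\<lambda>r. F (Z u r)))"
        by (rule has_vector_derivative_continuous)
      moreover have "at s within {0..s + 1} = at s within {0..}"
        by (rule at_within_nhd[of _ "{..<s + 1}"]) (use s in auto)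
      ultimately show "continuous (at s within {0..}) (\<lambda>s. integral {0..s} (\<lambda>r. F (Z u r)))" by simp
    qed
    then have "continuous_on UNIV (\<lambda>t. integral {0..max 0 t} (\<lambda>r. F (Z u r)))"
      by (rule continuous_on_compose2) (auto intro!: continuous_intros)
    then show ?thesis unfolding P_def by (intro continuous_intros)
  qed
  moreover have "norm (P u t) \<le> (norm (F z0) + \<bar>\<Lambda>\<bar> * norm u) / l" for u t
  proof -
    define s where "s = max 0 t"
    have "norm (integral {0..s} (\<lambda>r. F (Z u r))) \<le> integral {0..s} (\<lambda>r. (norm (F z0) + \<bar>\<Lambda>\<bar> * norm u) * exp (l * r))"
    proof (rule integral_norm_bound_integral[OF Zi bint])
      fix r assume r: "r \<in> {0..s}"
      have "norm (F (Z u r)) \<le> norm (F z0) + norm (F (Z u r) - F z0)" by (rule norm_triangle_sub)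
      also have "norm (F (Z u r) - F z0) \<le> \<bar>\<Lambda>\<bar> * (exp (l * r) * norm (apply_bcontfun u r))"
        using lip'[of "Z u r" z0] by (simp add: Z_def)
      also have "\<dots> \<le> \<bar>\<Lambda>\<bar> * (exp (l * r) * norm u)"
        by (intro mult_left_mono norm_bounded) auto
      finally have 1: "norm (F (Z u r)) \<le> norm (F z0) + \<bar>\<Lambda>\<bar> * (exp (l * r) * norm u)" by simp
      have "norm (F z0) * 1 \<le> norm (F z0) * exp (l * r)"
        using r l by (intro mult_left_mono) auto
      then show "norm (F (Z u r)) \<le> (norm (F z0) + \<bar>\<Lambda>\<bar> * norm u) * exp (l * r)"
        using 1 by (simp add: algebra_simps)
    qed
    then have "norm (P u t) \<le> exp (- (l * s)) * integral {0..s} (\<lambda>r. (norm (F z0) + \<bar>\<Lambda>\<bar> * norm u) * exp (l * r))"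
      by (simp add: P_def s_def)
    also have "\<dots> \<le> (norm (F z0) + \<bar>\<Lambda>\<bar> * norm u) / l" by (rule bound) (auto simp: s_def)
    finally show ?thesis .
  qed
  ultimately have Pb: "P u \<in> bcontfun" for u by (rule bcontfun_normI)
  define Q where "Q u = Bcontfun (P u)" for u
  have Q: "apply_bcontfun (Q u) = P u" for u unfolding Q_def by (rule Bcontfun_inverse[OF Pb])
  have "dist (Q u) (Q v) \<le> (1 / 2) * dist u v" for u v
  proof (rule dist_bound)
    fix t :: real
    define s where "s = max 0 t"
    have "norm (integral {0..s} (\<lambda>r. F (Z u r) - F (Z v r))) \<le> integral {0..s} (\<lambda>r. (\<bar>\<Lambda>\<bar> * dist u v) * exp (l * r))"
    proof (rule integral_norm_bound_integral[OF integrable_diff[OF Zi Zi] bint])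
      fix r
      have "norm (F (Z u r) - F (Z v r)) \<le> \<bar>\<Lambda>\<bar> * norm (exp (l * r) *\<^sub>R (apply_bcontfun u r - apply_bcontfun v r))"
        using lip'[of "Z u r" "Z v r"] by (simp add: Z_def scaleR_diff_right)
      also have "\<dots> = \<bar>\<Lambda>\<bar> * (exp (l * r) * dist (apply_bcontfun u r) (apply_bcontfun v r))"
        by (simp add: dist_norm)
      also have "\<dots> \<le> \<bar>\<Lambda>\<bar> * (exp (l * r) * dist u v)"
        by (intro mult_left_mono dist_bounded) auto
      finally show "norm (F (Z u r) - F (Z v r)) \<le> (\<bar>\<Lambda>\<bar> * dist u v) * exp (l * r)" by (simp add: algebra_simps)
    qed
    then have "norm (P u t - P v t) \<le> exp (- (l * s)) * integral {0..s} (\<lambda>r. (\<bar>\<Lambda>\<bar> * dist u v) * exp (l * r))"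
      by (simp add: P_def s_def Henstock_Kurzweil_Integration.integral_diff[OF Zi Zi] flip: scaleR_diff_right)
    also have "\<dots> \<le> (\<bar>\<Lambda>\<bar> * dist u v) / l" by (rule bound) (auto simp: s_def)
    also have "\<dots> = (\<bar>\<Lambda>\<bar> / l) * dist u v" by simp
    also have "\<dots> \<le> (1 / 2) * dist u v" using l by (intro mult_right_mono) auto
    finally show "dist (apply_bcontfun (Q u) t) (apply_bcontfun (Q v) t) \<le> (1 / 2) * dist u v"
      by (simp add: Q dist_norm)
  qed
  then have "\<exists>!u. Q u = u" by (intro banach_fix_type[of "1/2"]) auto
  then obtain u where u: "Q u = u" by blast
  have Zt: "Z u t = z0 + integral {0..t} (\<lambda>r. F (Z u r))" if "t \<ge> 0" for t
  proof -
    have "apply_bcontfun u t = exp (- (l * t)) *\<^sub>R integral {0..t} (\<lambda>r. F (Z u r))"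
      using Q[of u] that by (simp add: u P_def)
    then have "exp (l * t) *\<^sub>R apply_bcontfun u t = integral {0..t} (\<lambda>r. F (Z u r))"
      by (simp add: exp_minus)
    then show ?thesis by (simp add: Z_def)
  qed
  have "(Z u has_vector_derivative F (Z u t)) (at t within {0..})" if t: "t \<ge> 0" for t
  proof -
    have "((\<lambda>s. z0 + integral {0..s} (\<lambda>r. F (Z u r))) has_vector_derivative 0 + F (Z u t)) (at t within {0..t + 1})"
      by (intro has_vector_derivative_add has_vector_derivative_const integral_has_vector_derivative[OF Zc])
         (use t in auto)
    moreover have "at t within {0..t + 1} = at t within {0..}"
      by (rule at_within_nhd[of _ "{..<t + 1}"]) (use t in auto)
    ultimately have "((\<lambda>s. z0 + integral {0..s} (\<lambda>r. F (Z u r))) has_vector_derivative F (Z u t)) (at t within {0..})"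
      by simp
    then show ?thesis
      by (rule has_vector_derivative_transform[rotated 2]) (use t Zt in auto)
  qed
  moreover have "Z u 0 = z0" using Zt[of 0] by simp
  ultimately show ?thesis by blast
qed

section \<open>The Euler-Lagrange flow of a strongly convex Lagrangian\<close>

text \<open>The two-sided quadratic estimate around every point, and bounds at rest that do not depend on the
  position. \<open>Gx\<close> and \<open>Gv\<close> play the role of the partial gradients; the estimates determine them.\<close>

locale convex_lagrangian =
  fixes Lg :: "'a::{real_inner, banach} \<Rightarrow> 'a \<Rightarrow> real" and Gx Gv :: "'a \<Rightarrow> 'a \<Rightarrow> 'a"
    and K \<gamma> C b :: real
  assumes K_pos: "K > 0" and \<gamma>_pos: "\<gamma> > 0"
    and lower: "\<And>M N H1 H2. Lg M N + Gx M N \<bullet> H1 + Gv M N \<bullet> H2 + \<gamma> * (norm H2)\<^sup>2 - K * (norm H1)\<^sup>2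
      \<le> Lg (M + H1) (N + H2)"
    and upper: "\<And>M N H1 H2. Lg (M + H1) (N + H2)
      \<le> Lg M N + Gx M N \<bullet> H1 + Gv M N \<bullet> H2 + K * (norm H2)\<^sup>2 + K * (norm H1)\<^sup>2"
    and rest_nonneg: "\<And>M. 0 \<le> Lg M 0" and rest_le: "\<And>M. Lg M 0 \<le> C"
    and rest_grad: "\<And>M. norm (Gv M 0) \<le> b"
begin

definition \<Lambda> :: real where "\<Lambda> = 6 * K"

lemma \<Lambda>_pos: "\<Lambda> > 0" using K_pos by (simp add: \<Lambda>_def)

text \<open>Together the two estimates bound the error of the linearization by \<open>K\<close> times the square of the
  full increment.\<close>

lemma gradient_Lipschitz:
  "norm ((Gx M1 N1, Gv M1 N1) - (Gx M2 N2, Gv M2 N2)) \<le> \<Lambda> * norm ((M1, N1) - (M2, N2))"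
proof -
  have "norm ((\<lambda>z. (Gx (fst z) (snd z), Gv (fst z) (snd z))) (M1, N1) - (\<lambda>z. (Gx (fst z) (snd z), Gv (fst z) (snd z))) (M2, N2))
      \<le> 6 * K * norm ((M1, N1) - (M2, N2))"
  proof (rule gradient_Lipschitz_if_quadratic_error[where f = "\<lambda>z. Lg (fst z) (snd z)"])
    fix z h :: "'a \<times> 'a"
    obtain M N where z: "z = (M, N)" by (cases z)
    obtain H1 H2 where h: "h = (H1, H2)" by (cases h)
    have "0 \<le> K * (norm H2)\<^sup>2" "0 \<le> \<gamma> * (norm H2)\<^sup>2" using K_pos \<gamma>_pos by auto
    then show "\<bar>Lg (fst (z + h)) (snd (z + h)) - Lg (fst z) (snd z) - (Gx (fst z) (snd z), Gv (fst z) (snd z)) \<bullet> h\<bar> \<le> K * (norm h)\<^sup>2"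
      using lower[of M N H1 H2] upper[of M H1 N H2]
      by (simp add: z h norm_prod_def algebra_simps)
  qed
  then show ?thesis by (simp add: \<Lambda>_def)
qed

lemma norm_Pair_le: "norm (u, v) \<le> norm u + norm v" for u v :: 'a
  by (simp add: norm_prod_def sqrt_sum_squares_le_sum)

lemma
  shows Gx_Lipschitz: "norm (Gx M1 N1 - Gx M2 N2) \<le> \<Lambda> * (norm (M1 - M2) + norm (N1 - N2))"
    and Gv_Lipschitz: "norm (Gv M1 N1 - Gv M2 N2) \<le> \<Lambda> * (norm (M1 - M2) + norm (N1 - N2))"
proof -
  have "norm ((Gx M1 N1, Gv M1 N1) - (Gx M2 N2, Gv M2 N2)) \<le> \<Lambda> * norm ((M1, N1) - (M2, N2))"
    by (rule gradient_Lipschitz)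
  also have "\<dots> \<le> \<Lambda> * (norm (M1 - M2) + norm (N1 - N2))"
    using \<Lambda>_pos norm_Pair_le[of "M1 - M2" "N1 - N2"] by (intro mult_left_mono) auto
  finally have le: "norm ((Gx M1 N1, Gv M1 N1) - (Gx M2 N2, Gv M2 N2)) \<le> \<Lambda> * (norm (M1 - M2) + norm (N1 - N2))" .
  have "norm u \<le> norm (u, v)" "norm v \<le> norm (u, v)" for u v :: 'a
    by (simp_all add: norm_prod_def real_le_rsqrt)
  from order_trans[OF this(1) le[unfolded diff_Pair]] order_trans[OF this(2) le[unfolded diff_Pair]]
  show "norm (Gx M1 N1 - Gx M2 N2) \<le> \<Lambda> * (norm (M1 - M2) + norm (N1 - N2))"
    "norm (Gv M1 N1 - Gv M2 N2) \<le> \<Lambda> * (norm (M1 - M2) + norm (N1 - N2))" .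
qed

text \<open>Sum of the lower estimates at \<open>N1\<close> and \<open>N2\<close>.\<close>

lemma Gv_strongly_monotone:
  "(Gv M N1 - Gv M N2) \<bullet> (N1 - N2) \<ge> 2 * \<gamma> * (norm (N1 - N2))\<^sup>2"
  using lower[of M N1 0 "N2 - N1"] lower[of M N2 0 "N1 - N2"]
  by (simp add: inner_simps norm_minus_commute)

lemma continuous_on_Gx_Gv:
  assumes "continuous_on S f" "continuous_on S g"
  shows "continuous_on S (\<lambda>t. Gx (f t) (g t))" "continuous_on S (\<lambda>t. Gv (f t) (g t))"
proof -
  have lip: "continuous_on UNIV (\<lambda>z. (Gx (fst z) (snd z), Gv (fst z) (snd z)))"
    by (rule lipschitz_on_continuous_on[of \<Lambda>], rule lipschitz_onI)
       (use gradient_Lipschitz \<Lambda>_pos in \<open>auto simp: dist_norm\<close>)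
  have "continuous_on S (\<lambda>t. (Gx (f t) (g t), Gv (f t) (g t)))"
    using continuous_on_compose2[OF lip continuous_on_Pair[OF assms]] by simp
  from continuous_on_fst[OF this] continuous_on_snd[OF this]
  show "continuous_on S (\<lambda>t. Gx (f t) (g t))" "continuous_on S (\<lambda>t. Gv (f t) (g t))" by simp_all
qed

lemma continuous_on_Lg:
  assumes "continuous_on S f" "continuous_on S g"
  shows "continuous_on S (\<lambda>t. Lg (f t) (g t))"
proof -
  have "isCont (\<lambda>z. Lg (fst z) (snd z)) z" for z
  proof -
    define E where "E h = norm (Gx (fst z) (snd z)) * norm (fst h) + norm (Gv (fst z) (snd z)) * norm (snd h)
        + K * (norm (snd h))\<^sup>2 + K * (norm (fst h))\<^sup>2" for h :: "'a \<times> 'a"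
    have "(E \<longlongrightarrow> E 0) (at 0)"
      unfolding E_def by (intro tendsto_intros tendsto_fst tendsto_snd)
    then have E0: "(E \<longlongrightarrow> 0) (at 0)" by (simp add: E_def)
    have "((\<lambda>h. Lg (fst (z + h)) (snd (z + h)) - Lg (fst z) (snd z)) \<longlongrightarrow> 0) (at 0)"
    proof (rule Lim_null_comparison[OF _ E0], intro always_eventually allI)
      fix h :: "'a \<times> 'a"
      have "0 \<le> \<gamma> * (norm (snd h))\<^sup>2" "0 \<le> K * (norm (snd h))\<^sup>2" using \<gamma>_pos K_pos by auto
      then show "norm (Lg (fst (z + h)) (snd (z + h)) - Lg (fst z) (snd z)) \<le> E h"
        using lower[of "fst z" "snd z" "fst h" "snd h"] upper[of "fst z" "fst h" "snd z" "snd h"]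
          Cauchy_Schwarz_ineq2[of "Gx (fst z) (snd z)" "fst h"] Cauchy_Schwarz_ineq2[of "Gv (fst z) (snd z)" "snd h"]
        unfolding E_def real_norm_def by simp
    qed
    then have "((\<lambda>h. Lg (fst (z + h)) (snd (z + h))) \<longlongrightarrow> Lg (fst z) (snd z)) (at 0)"
      by (simp add: LIM_zero_iff)
    then show ?thesis by (simp add: isCont_iff)
  qed
  then have "continuous_on UNIV (\<lambda>z. Lg (fst z) (snd z))" by (simp add: continuous_at_imp_continuous_on)
  from continuous_on_compose2[OF this continuous_on_Pair[OF assms]] show ?thesis by simp
qed

definition floor_bound :: real where "floor_bound = b\<^sup>2 / (4 * \<gamma>)"

text \<open>Minimum over \<open>norm N\<close> of the quadratic lower bound at rest.\<close>

lemma Lg_lower_bound: "- floor_bound \<le> Lg M N"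
proof -
  have "- (b * norm N) \<le> - (norm (Gv M 0) * norm N)"
    using rest_grad[of M] by (simp add: mult_right_mono)
  also have "\<dots> \<le> Gv M 0 \<bullet> N" using Cauchy_Schwarz_ineq2[of "Gv M 0" N] by linarith
  finally have "- (b * norm N) \<le> Gv M 0 \<bullet> N" .
  then have 1: "- (b * norm N) + \<gamma> * (norm N)\<^sup>2 \<le> Lg M N"
    using lower[of M 0 0 N] rest_nonneg[of M] by simp
  have "0 \<le> \<gamma> * (norm N - b / (2 * \<gamma>))\<^sup>2" using \<gamma>_pos by simp
  also have "\<dots> = \<gamma> * (norm N)\<^sup>2 - b * norm N + floor_bound"
    using \<gamma>_pos by (simp add: floor_bound_def power2_eq_square field_simps)
  finally show ?thesis using 1 by linarith
qed

lemma floor_bound_nonneg: "0 \<le> floor_bound"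
  using \<gamma>_pos by (simp add: floor_bound_def)

text \<open>The Legendre transform of the velocity gradient: the velocity with a given momentum.\<close>

definition velocity :: "'a \<Rightarrow> 'a \<Rightarrow> 'a"
  where "velocity M p = (SOME N. Gv M N = p)"

lemma Gv_velocity: "Gv M (velocity M p) = p"
proof -
  have "\<exists>N. Gv M N = p"
  (* The Lipschitz constant is enlarged so that it dominates the monotonicity constant. *)
  proof (rule strongly_monotone_Lipschitz_surj[of "2 * \<gamma>" "Gv M" "\<Lambda> + 2 * \<gamma>"])
    fix u v
    have "norm (Gv M u - Gv M v) \<le> \<Lambda> * norm (u - v)" using Gv_Lipschitz[of M u M v] by simp
    also have "\<dots> \<le> (\<Lambda> + 2 * \<gamma>) * norm (u - v)" using \<gamma>_pos by (intro mult_right_mono) auto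
    finally show "norm (Gv M u - Gv M v) \<le> (\<Lambda> + 2 * \<gamma>) * norm (u - v)" .
  qed (use \<gamma>_pos \<Lambda>_pos Gv_strongly_monotone in auto)
  then show ?thesis unfolding velocity_def by (rule someI_ex)
qed

lemma velocity_Lipschitz:
  "norm (velocity M1 p1 - velocity M2 p2) \<le> (norm (p1 - p2) + \<Lambda> * norm (M1 - M2)) / (2 * \<gamma>)"
proof -
  define N1 N2 where "N1 = velocity M1 p1" and "N2 = velocity M2 p2"
  have g: "Gv M1 N1 = p1" "Gv M2 N2 = p2" by (simp_all add: N1_def N2_def Gv_velocity)
  have "2 * \<gamma> * (norm (N1 - N2))\<^sup>2 \<le> (Gv M1 N1 - Gv M1 N2) \<bullet> (N1 - N2)"
    by (rule Gv_strongly_monotone)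
  also have "\<dots> \<le> norm (Gv M1 N1 - Gv M1 N2) * norm (N1 - N2)" by (rule norm_cauchy_schwarz)
  also have "\<dots> \<le> (norm (p1 - p2) + \<Lambda> * norm (M1 - M2)) * norm (N1 - N2)"
  proof (rule mult_right_mono)
    have "norm (Gv M1 N1 - Gv M1 N2) \<le> norm (p1 - p2) + norm (Gv M2 N2 - Gv M1 N2)"
      using norm_triangle_ineq[of "p1 - p2" "Gv M2 N2 - Gv M1 N2"] by (simp add: g)
    also have "norm (Gv M2 N2 - Gv M1 N2) \<le> \<Lambda> * norm (M1 - M2)"
      using Gv_Lipschitz[of M2 N2 M1 N2] by (simp add: norm_minus_commute)
    finally show "norm (Gv M1 N1 - Gv M1 N2) \<le> norm (p1 - p2) + \<Lambda> * norm (M1 - M2)" by simp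
  qed simp
  finally have *: "(2 * \<gamma> * norm (N1 - N2)) * norm (N1 - N2) \<le> (norm (p1 - p2) + \<Lambda> * norm (M1 - M2)) * norm (N1 - N2)"
    by (simp add: power2_eq_square)
  have "2 * \<gamma> * norm (N1 - N2) \<le> norm (p1 - p2) + \<Lambda> * norm (M1 - M2)"
  proof (cases "norm (N1 - N2) = 0")
    case True
    then show ?thesis using \<Lambda>_pos by simp
  next
    case False
    then have "norm (N1 - N2) > 0" by simp
    then show ?thesis using * by (simp only: mult_le_cancel_right_pos)
  qed
  then show ?thesis using \<gamma>_pos by (simp add: N1_def N2_def le_divide_eq mult.commute)
qed

text \<open>With \<open>p = Gv x x'\<close>, the equation \<open>(exp(- \<epsilon> t) p)' = exp(- \<epsilon> t) Gx x x'\<close> reads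
  \<open>p' = \<epsilon> p + Gx x x'\<close>.\<close>

theorem euler_lagrange_flow:
  "\<exists>x p. x 0 = M \<and> p 0 = q \<and> continuous_on {0..} (\<lambda>t. velocity (x t) (p t)) \<and>
    (\<forall>t\<ge>0. (x has_vector_derivative velocity (x t) (p t)) (at t within {0..})) \<and>
    (\<forall>t\<ge>0. (p has_vector_derivative \<epsilon> *\<^sub>R p t + Gx (x t) (velocity (x t) (p t))) (at t within {0..}))"
proof -
  define F where "F z = (velocity (fst z) (snd z), \<epsilon> *\<^sub>R snd z + Gx (fst z) (velocity (fst z) (snd z)))" for z
  define c where "c = (1 + \<Lambda>) / (2 * \<gamma>)"
  have c0: "c \<ge> 0" using \<Lambda>_pos \<gamma>_pos by (simp add: c_def)
  have comp: "norm (fst z) \<le> norm z" "norm (snd z) \<le> norm z" for z :: "'a \<times> 'a"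
    by (simp_all add: norm_prod_def real_le_rsqrt)
  have vel: "norm (velocity (fst z) (snd z) - velocity (fst w) (snd w)) \<le> c * norm (z - w)" for z w
  proof -
    have "norm (velocity (fst z) (snd z) - velocity (fst w) (snd w))
        \<le> (norm (snd z - snd w) + \<Lambda> * norm (fst z - fst w)) / (2 * \<gamma>)" by (rule velocity_Lipschitz)
    also have "\<dots> \<le> (norm (z - w) + \<Lambda> * norm (z - w)) / (2 * \<gamma>)"
      using comp[of "z - w"] \<Lambda>_pos \<gamma>_pos by (intro divide_right_mono add_mono mult_left_mono) auto
    finally show ?thesis by (simp add: c_def algebra_simps)
  qed
  have "norm (F z - F w) \<le> (c + (\<bar>\<epsilon>\<bar> + \<Lambda> * (1 + c))) * norm (z - w)" for z w
  proof -
    define V W where "V = velocity (fst z) (snd z)" and "W = velocity (fst w) (snd w)"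
    have "norm (Gx (fst z) V - Gx (fst w) W) \<le> \<Lambda> * (norm (z - w) + c * norm (z - w))"
      using vel[of z w] comp[of "z - w"] \<Lambda>_pos
      by (intro order_trans[OF Gx_Lipschitz] mult_left_mono add_mono) (auto simp: V_def W_def)
    moreover have "norm (\<epsilon> *\<^sub>R (snd z - snd w)) \<le> \<bar>\<epsilon>\<bar> * norm (z - w)"
      using comp(2)[of "z - w"] by (simp add: mult_left_mono)
    moreover have "norm ((\<epsilon> *\<^sub>R snd z + Gx (fst z) V) - (\<epsilon> *\<^sub>R snd w + Gx (fst w) W))
        \<le> norm (\<epsilon> *\<^sub>R (snd z - snd w)) + norm (Gx (fst z) V - Gx (fst w) W)"
      using norm_triangle_ineq[of "\<epsilon> *\<^sub>R (snd z - snd w)" "Gx (fst z) V - Gx (fst w) W"]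
      by (simp add: algebra_simps)
    moreover have "norm (F z - F w) \<le> norm (V - W) + norm ((\<epsilon> *\<^sub>R snd z + Gx (fst z) V) - (\<epsilon> *\<^sub>R snd w + Gx (fst w) W))"
      using norm_Pair_le by (simp add: F_def V_def W_def)
    ultimately show ?thesis using vel[of z w] by (simp add: V_def[symmetric] W_def[symmetric] algebra_simps)
  qed
  from global_Lipschitz_ODE[of F, OF this] obtain z where z0: "z 0 = (M, q)"
    and z: "\<And>t. t \<ge> 0 \<Longrightarrow> (z has_vector_derivative F (z t)) (at t within {0..})" by blast
  have zc: "continuous_on {0..} z"
    unfolding continuous_on_eq_continuous_within using has_vector_derivative_continuous[OF z] by auto
  have Vc: "continuous_on UNIV (\<lambda>z. velocity (fst z) (snd z))"
    by (rule lipschitz_on_continuous_on[of c], rule lipschitz_onI) (use vel c0 in \<open>auto simp: dist_norm\<close>)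
  have "continuous_on {0..} (\<lambda>t. velocity (fst (z t)) (snd (z t)))"
    by (rule continuous_on_compose2[OF Vc zc]) simp
  moreover have "((\<lambda>t. fst (z t)) has_vector_derivative velocity (fst (z t)) (snd (z t))) (at t within {0..})"
      "((\<lambda>t. snd (z t)) has_vector_derivative \<epsilon> *\<^sub>R snd (z t) + Gx (fst (z t)) (velocity (fst (z t)) (snd (z t)))) (at t within {0..})"
    if "t \<ge> 0" for t
    using bounded_linear.has_vector_derivative[OF bounded_linear_fst z[OF that]]
      bounded_linear.has_vector_derivative[OF bounded_linear_snd z[OF that]] by (simp_all add: F_def)
  ultimately show ?thesis
    by (intro exI[of _ "\<lambda>t. fst (z t)"] exI[of _ "\<lambda>t. snd (z t)"]) (use z0 in auto)
qed

end

section \<open>Discounted cost and value function\<close>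

text \<open>Admissible curves normalized to take their initial value at time \<open>0\<close>. Changing the value of a curve at
  \<open>0\<close> affects neither admissibility nor cost.\<close>

definition curve_from :: "'a::real_normed_vector \<Rightarrow> (real \<Rightarrow> 'a) \<Rightarrow> bool"
  where "curve_from M x \<longleftrightarrow> x 0 = M \<and> (\<forall>T. L2_AC T x)"

lemma vector_derivative_cong_eventually:
  assumes "eventually (\<lambda>s. x s = y s) (nhds t)"
  shows "vector_derivative x (at t) = vector_derivative y (at t)"
  by (rule vector_derivative_cong_eq) (use assms in \<open>auto elim: eventually_mono\<close>)

lemma vector_derivative_fun_upd0:
  fixes t :: real assumes "t > 0"
  shows "vector_derivative (x(0 := M)) (at t) = vector_derivative x (at t)"
proof (rule vector_derivative_cong_eventually)
  have "\<forall>\<^sub>F s in nhds t. s \<in> {0<..}" using assms by (intro eventually_nhds_in_open) auto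
  then show "\<forall>\<^sub>F s in nhds t. (x(0 := M)) s = x s" by eventually_elim simp
qed

lemma admissible_imp_curve_from:
  assumes "x \<in> admissible M"
  shows "curve_from M (x(0 := M))"
  unfolding curve_from_def
proof (intro conjI allI)
  fix T :: real
  have "AC2 (max T 0 + 1) x" using assms by (simp add: admissible_def AC2_loc_def)
  then show "L2_AC T (x(0 := M))"
    by (rule AC2_imp_L2_AC) (use assms in \<open>auto simp: admissible_def\<close>)
qed simp

lemma curve_from_continuous:
  fixes x :: "real \<Rightarrow> 'a::{real_inner, banach}"
  assumes "curve_from M x" shows "continuous_on {0..T} x"
proof (cases "T > 0")
  case True
  then show ?thesis using assms L2_AC_derivative(4)[of T x] by (simp add: curve_from_def)
next
  case False
  then have "{0..T} \<subseteq> {0}" by auto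
  then show ?thesis by (rule continuous_on_subset[rotated]) simp
qed

lemma curve_from_imp_admissible:
  fixes x :: "real \<Rightarrow> 'a::{real_inner, banach}"
  assumes "curve_from M x" shows "x \<in> admissible M"
proof -
  have "((\<lambda>t. x t) \<longlongrightarrow> x 0) (at 0 within {0..1})"
    using curve_from_continuous[OF assms, of 1] by (simp add: continuous_on)
  moreover have "at_right 0 = at 0 within {0..(1::real)}"
    unfolding at_within_Icc_at_right[OF zero_less_one] ..
  ultimately show ?thesis
    using assms L2_AC_imp_AC2 by (auto simp: admissible_def AC2_loc_def curve_from_def)
qed

lemma discounted_cost_fun_upd0: "discounted_cost \<epsilon> L (x(0 := M)) = discounted_cost \<epsilon> L x"
proof -
  have "(\<integral>\<^sup>+t\<in>{0<..}. ennreal (s * (exp (- (\<epsilon> * t)) * L ((x(0 := M)) t) (vector_derivative (x(0 := M)) (at t)))) \<partial>lborel)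
     = (\<integral>\<^sup>+t\<in>{0<..}. ennreal (s * (exp (- (\<epsilon> * t)) * L (x t) (vector_derivative x (at t)))) \<partial>lborel)" for s
    by (rule nn_integral_cong) (auto simp: indicator_def vector_derivative_fun_upd0)
  from this[of 1] this[of "-1"] show ?thesis by (simp add: discounted_cost_def)
qed

locale discounted_problem = convex_lagrangian Lg Gx Gv K \<gamma> C b
  for Lg :: "'d::finite l2 \<Rightarrow> 'd l2 \<Rightarrow> real" and Gx Gv :: "'d l2 \<Rightarrow> 'd l2 \<Rightarrow> 'd l2"
    and K \<gamma> C b :: real +
  fixes \<epsilon> :: real
  assumes \<epsilon>_pos: "\<epsilon> > 0"
begin

definition running :: "(real \<Rightarrow> 'd l2) \<Rightarrow> real \<Rightarrow> real"
  where "running x t = exp (- (\<epsilon> * t)) * Lg (x t) (vector_derivative x (at t))"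

lemma running_lower: "- (floor_bound * exp (- (\<epsilon> * t))) \<le> running x t"
proof -
  have "exp (- (\<epsilon> * t)) * - floor_bound \<le> running x t"
    unfolding running_def by (intro mult_left_mono Lg_lower_bound) simp
  then show ?thesis by (simp add: mult.commute)
qed

lemma discount_has_integral: "((\<lambda>t. exp (- (\<epsilon> * t))) has_integral 1 / \<epsilon>) {0<..}"
proof -
  have "((\<lambda>t. exp (- \<epsilon> * t)) has_integral exp (- \<epsilon> * 0) / \<epsilon>) {0..}"
    by (rule has_integral_exp_minus_to_infinity[OF \<epsilon>_pos])
  then have "((\<lambda>t. exp (- (\<epsilon> * t))) has_integral 1 / \<epsilon>) {0..}" by simp
  then show ?thesis
    by (subst has_integral_spike_set_eq[of "{0<..}" "{0..}"]) (auto intro: negligible_subset[of "{0}"])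
qed

lemma floor_integrable: "(\<lambda>t. floor_bound * exp (- (\<epsilon> * t))) absolutely_integrable_on {0<..}"
  using discount_has_integral floor_bound_nonneg
  by (intro nonnegative_absolutely_integrable_1 integrable_on_mult_right) auto

lemma nn_integral_neg_running:
  "(\<integral>\<^sup>+t\<in>{0<..}. ennreal (- running x t) \<partial>lborel) \<le> ennreal (floor_bound / \<epsilon>)"
proof -
  have "(\<integral>\<^sup>+t\<in>{0<..}. ennreal (- running x t) \<partial>lborel) \<le> (\<integral>\<^sup>+t\<in>{0<..}. ennreal (floor_bound * exp (- (\<epsilon> * t))) \<partial>lborel)"
    using running_lower[of _ x] by (intro nn_integral_mono mult_right_mono ennreal_leI) (auto simp: minus_le_iff)
  also have "\<dots> = ennreal (floor_bound * (1 / \<epsilon>))"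
  proof (rule nn_integral_has_integral_lebesgue')
    show "((\<lambda>t. floor_bound * exp (- (\<epsilon> * t))) has_integral floor_bound * (1 / \<epsilon>)) {0<..}"
      by (rule has_integral_mult_right[OF discount_has_integral])
  qed (use floor_bound_nonneg in auto)
  finally show ?thesis by simp
qed

lemma cost_running: "discounted_cost \<epsilon> Lg x =
  enn2ereal (\<integral>\<^sup>+t\<in>{0<..}. ennreal (running x t) \<partial>lborel) - enn2ereal (\<integral>\<^sup>+t\<in>{0<..}. ennreal (- running x t) \<partial>lborel)"
  by (simp add: discounted_cost_def running_def)

lemma cost_lower: "ereal (- (floor_bound / \<epsilon>)) \<le> discounted_cost \<epsilon> Lg x"
proof -
  have "enn2ereal (\<integral>\<^sup>+t\<in>{0<..}. ennreal (- running x t) \<partial>lborel) \<le> enn2ereal (ennreal (floor_bound / \<epsilon>))"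
    using nn_integral_neg_running[of x] by (simp only: less_eq_ennreal.rep_eq)
  also have "\<dots> = ereal (floor_bound / \<epsilon>)"
    using floor_bound_nonneg \<epsilon>_pos by (simp add: enn2ereal_ennreal)
  finally have "0 - ereal (floor_bound / \<epsilon>) \<le> discounted_cost \<epsilon> Lg x"
    unfolding cost_running by (intro ereal_minus_mono) auto
  then show ?thesis by simp
qed

text \<open>For an integrable integrand the difference of the two nonnegative integrals is the integral.\<close>

lemma cost_eq_integral:
  assumes "running x absolutely_integrable_on {0<..}"
  shows "discounted_cost \<epsilon> Lg x = ereal (integral {0<..} (running x))"
proof -
  define f where "f t = indicator {0<..} t *\<^sub>R running x t" for t
  have f: "integrable lebesgue f" using assms by (simp add: f_def[abs_def] set_integrable_def)
  have P: "(\<integral>\<^sup>+t\<in>{0<..}. ennreal (running x t) \<partial>lborel) = (\<integral>\<^sup>+t. ennreal (f t) \<partial>lebesgue)"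
    unfolding nn_integral_completion by (rule nn_integral_cong) (auto simp: f_def indicator_def)
  have N: "(\<integral>\<^sup>+t\<in>{0<..}. ennreal (- running x t) \<partial>lborel) = (\<integral>\<^sup>+t. ennreal (- f t) \<partial>lebesgue)"
    unfolding nn_integral_completion by (rule nn_integral_cong) (auto simp: f_def indicator_def)
  have e: "enn2ereal r = ereal (enn2real r)" if "r < \<infinity>" for r :: ennreal
    using that by (cases r) (auto simp: enn2ereal_ennreal)
  have fin: "(\<integral>\<^sup>+t. ennreal (f t) \<partial>lebesgue) < \<infinity>" "(\<integral>\<^sup>+t. ennreal (- f t) \<partial>lebesgue) < \<infinity>"
    using f unfolding real_integrable_def by (auto simp: top.not_eq_extremum)
  have "integral {0<..} (running x) = integral\<^sup>L lebesgue f"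
    using set_lebesgue_integral_eq_integral(2)[OF assms] by (simp add: set_lebesgue_integral_def f_def[abs_def])
  also have "\<dots> = enn2real (\<integral>\<^sup>+t. ennreal (f t) \<partial>lebesgue) - enn2real (\<integral>\<^sup>+t. ennreal (- f t) \<partial>lebesgue)"
    by (rule real_lebesgue_integral_def[OF f])
  finally show ?thesis unfolding cost_running P N using e[OF fin(1)] e[OF fin(2)] by simp
qed

lemma running_measurable_interval:
  assumes "curve_from M x" "T > 0"
  shows "running x \<in> borel_measurable (lebesgue_on {0..T})"
proof -
  have "(\<lambda>t. (\<lambda>z. exp (- (\<epsilon> * fst z)) * Lg (x (fst z)) (snd z)) (t, vector_derivative x (at t))) \<in> borel_measurable (lebesgue_on {0..T})"
  proof (rule L2_AC_measurable_derivative)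
    show "continuous_on ({0..T} \<times> UNIV) (\<lambda>z. exp (- (\<epsilon> * fst z)) * Lg (x (fst z)) (snd z))"
      by (intro continuous_intros continuous_on_Lg continuous_on_compose2[OF curve_from_continuous[OF assms(1), of T]]) auto
  qed (use assms in \<open>auto simp: curve_from_def\<close>)
  then show ?thesis by (simp add: running_def[abs_def])
qed

lemma running_measurable:
  assumes "curve_from M x"
  shows "running x \<in> borel_measurable (lebesgue_on {0<..})"
proof -
  have "(\<lambda>t. if t \<in> {0<..real (Suc n)} then running x t else 0) \<in> borel_measurable lebesgue" for n
    by (intro borel_measurable_if_I measurable_restrict_mono[OF running_measurable_interval[OF assms, of "real (Suc n)"]]) auto
  then have "(\<lambda>t. if t \<in> {0<..} then running x t else 0) \<in> borel_measurable lebesgue"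
  proof (rule borel_measurable_LIMSEQ_real[rotated])
    fix t :: real
    have "\<forall>\<^sub>F n in sequentially. t \<le> real (Suc n)"
      using eventually_ge_at_top[of "nat \<lceil>t\<rceil>"] by eventually_elim linarith
    then have "\<forall>\<^sub>F n in sequentially. (if t \<in> {0<..real (Suc n)} then running x t else 0) = (if t \<in> {0<..} then running x t else 0)"
      by eventually_elim auto
    then show "(\<lambda>n. if t \<in> {0<..real (Suc n)} then running x t else 0) \<longlonglongrightarrow> (if t \<in> {0<..} then running x t else 0)"
      by (rule tendsto_eventually)
  qed
  then show ?thesis by (rule borel_measurable_if_D)
qed

text \<open>The negative part always has finite integral, so finite cost leaves no room for an infinite
  positive part.\<close>

lemma finite_cost_integrable:
  assumes x: "curve_from M x" and fin: "discounted_cost \<epsilon> Lg x < \<infinity>"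
  shows "running x absolutely_integrable_on {0<..}"
proof -
  define f where "f t = indicator {0<..} t *\<^sub>R running x t" for t
  have f_meas: "f \<in> borel_measurable lebesgue"
  proof -
    have "(\<lambda>t. if t \<in> {0<..} then running x t else 0) \<in> borel_measurable lebesgue"
      by (rule borel_measurable_if_I[OF running_measurable[OF x]]) auto
    moreover have "(\<lambda>t. if t \<in> {0<..} then running x t else 0) = f" by (auto simp: f_def indicator_def)
    ultimately show ?thesis by simp
  qed
  have P: "(\<integral>\<^sup>+t\<in>{0<..}. ennreal (running x t) \<partial>lborel) = (\<integral>\<^sup>+t. ennreal (f t) \<partial>lebesgue)"
    unfolding nn_integral_completion by (rule nn_integral_cong) (auto simp: f_def indicator_def)
  have N: "(\<integral>\<^sup>+t\<in>{0<..}. ennreal (- running x t) \<partial>lborel) = (\<integral>\<^sup>+t. ennreal (- f t) \<partial>lebesgue)"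
    unfolding nn_integral_completion by (rule nn_integral_cong) (auto simp: f_def indicator_def)
  have N_fin: "(\<integral>\<^sup>+t. ennreal (- f t) \<partial>lebesgue) < \<infinity>"
    using nn_integral_neg_running[of x] unfolding N by (rule le_less_trans) simp
  moreover have "(\<integral>\<^sup>+t. ennreal (f t) \<partial>lebesgue) \<noteq> \<infinity>"
  proof
    assume inf: "(\<integral>\<^sup>+t. ennreal (f t) \<partial>lebesgue) = \<infinity>"
    obtain r where "enn2ereal (\<integral>\<^sup>+t. ennreal (- f t) \<partial>lebesgue) = ereal r"
      using N_fin by (cases "\<integral>\<^sup>+t. ennreal (- f t) \<partial>lebesgue") (auto simp: enn2ereal_ennreal)
    then have "discounted_cost \<epsilon> Lg x = \<infinity>" unfolding cost_running P N inf by simp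
    then show False using fin by simp
  qed
  ultimately have "integrable lebesgue f" using f_meas by (auto simp: real_integrable_def)
  then show ?thesis by (simp add: f_def[abs_def] set_integrable_def)
qed

abbreviation V :: "'d l2 \<Rightarrow> real" where "V \<equiv> value_fn \<epsilon> Lg"

lemma curve_from_const: "curve_from M (\<lambda>t. M)"
  by (simp add: curve_from_def L2_AC_const)

text \<open>The lower bound of the running cost bounds all costs from below, and resting at \<open>M\<close> has finite cost.\<close>

lemma value_finite: "value_ereal \<epsilon> Lg M = ereal (V M)"
proof -
  have "ereal (- (floor_bound / \<epsilon>)) \<le> value_ereal \<epsilon> Lg M"
    unfolding value_ereal_def by (intro INF_greatest cost_lower)
  moreover have "value_ereal \<epsilon> Lg M \<le> ereal (integral {0<..} (running (\<lambda>t. M)))"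
  proof -
    have "running (\<lambda>t. M) = (\<lambda>t. Lg M 0 * exp (- (\<epsilon> * t)))"
      by (auto simp: running_def)
    moreover have "(\<lambda>t. Lg M 0 * exp (- (\<epsilon> * t))) absolutely_integrable_on {0<..}"
      using discount_has_integral rest_nonneg
      by (intro nonnegative_absolutely_integrable_1 integrable_on_mult_right) auto
    ultimately have "discounted_cost \<epsilon> Lg (\<lambda>t. M) = ereal (integral {0<..} (running (\<lambda>t. M)))"
      by (intro cost_eq_integral) simp
    moreover have "value_ereal \<epsilon> Lg M \<le> discounted_cost \<epsilon> Lg (\<lambda>t. M)"
      unfolding value_ereal_def by (intro INF_lower curve_from_imp_admissible curve_from_const)
    ultimately show ?thesis by simp
  qed
  ultimately show ?thesis unfolding value_fn_def
    by (cases "value_ereal \<epsilon> Lg M") auto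
qed

lemma value_le_integral:
  assumes "curve_from M x" "running x absolutely_integrable_on {0<..}"
  shows "V M \<le> integral {0<..} (running x)"
proof -
  have "value_ereal \<epsilon> Lg M \<le> discounted_cost \<epsilon> Lg x"
    unfolding value_ereal_def by (intro INF_lower curve_from_imp_admissible assms)
  then show ?thesis by (simp add: value_finite cost_eq_integral[OF assms(2)])
qed

lemma near_minimizer_exists:
  assumes "\<delta> > 0"
  obtains y where "curve_from M y" "running y absolutely_integrable_on {0<..}" "integral {0<..} (running y) \<le> V M + \<delta>"
proof -
  have "value_ereal \<epsilon> Lg M < ereal (V M + \<delta>)" using assms by (simp add: value_finite)
  then obtain x where x: "x \<in> admissible M" "discounted_cost \<epsilon> Lg x < ereal (V M + \<delta>)"
    unfolding value_ereal_def by (auto simp: INF_less_iff)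
  have y: "curve_from M (x(0 := M))" by (rule admissible_imp_curve_from[OF x(1)])
  have c: "discounted_cost \<epsilon> Lg (x(0 := M)) < ereal (V M + \<delta>)" using x(2) by (simp only: discounted_cost_fun_upd0)
  have i: "running (x(0 := M)) absolutely_integrable_on {0<..}"
    by (rule finite_cost_integrable[OF y]) (use c in \<open>auto intro: less_trans\<close>)
  show ?thesis by (rule that[OF y i]) (use c cost_eq_integral[OF i] in simp)
qed

end

section \<open>Extremals and their competitors\<close>

lemma L2_AC_norm_le_integral:
  fixes x :: "real \<Rightarrow> 'a::{real_inner, banach}"
  assumes x: "L2_AC T x" "T > 0" and N: "negligible N"
    and d: "\<And>t. t \<in> {0<..<T} - N \<Longrightarrow> (x has_vector_derivative g t) (at t)"
  shows "(\<lambda>t. norm (g t)) integrable_on {0..T}"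
    and "(\<lambda>t. (norm (g t))\<^sup>2) integrable_on {0..T}"
    and "0 \<le> s \<Longrightarrow> s \<le> t \<Longrightarrow> t \<le> T \<Longrightarrow> norm (x t - x s) \<le> integral {s..t} (\<lambda>\<tau>. norm (g \<tau>))"
proof -
  have N': "negligible (N \<union> {0, T})" using N by simp
  have eq: "g t = vector_derivative x (at t)" if "t \<in> {0..T} - (N \<union> {0, T})" for t
    by (rule vector_derivative_at[symmetric, OF d]) (use that in auto)
  show "(\<lambda>t. norm (g t)) integrable_on {0..T}"
    by (rule integrable_spike[OF L2_AC_norm_derivative_integrable[OF x] N']) (simp add: eq)
  show "(\<lambda>t. (norm (g t))\<^sup>2) integrable_on {0..T}"
    by (rule integrable_spike[OF L2_AC_derivative(2)[OF x] N']) (simp add: eq)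
  assume st: "0 \<le> s" "s \<le> t" "t \<le> T"
  have "integral {s..t} (\<lambda>\<tau>. norm (g \<tau>)) = integral {s..t} (\<lambda>\<tau>. norm (vector_derivative x (at \<tau>)))"
    by (rule integral_spike[OF N']) (use st in \<open>simp add: eq\<close>)
  then show "norm (x t - x s) \<le> integral {s..t} (\<lambda>\<tau>. norm (g \<tau>))"
    using L2_AC_norm_le_integral_derivative[OF x(1) st] by simp
qed

text \<open>Cauchy-Schwarz for the splitting \<open>a = exp(c \<tau> / 2) * (exp(- c \<tau> / 2) a)\<close>.\<close>

lemma weighted_Cauchy_Schwarz:
  fixes a :: "real \<Rightarrow> real"
  assumes "c \<noteq> 0" "s \<le> t"
    and a: "a integrable_on {s..t}" and a2: "(\<lambda>\<tau>. exp (- (c * \<tau>)) * (a \<tau>)\<^sup>2) integrable_on {s..t}"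
  shows "(integral {s..t} a)\<^sup>2 \<le> (exp (c * t) - exp (c * s)) / c * integral {s..t} (\<lambda>\<tau>. exp (- (c * \<tau>)) * (a \<tau>)\<^sup>2)"
proof -
  have e: "(exp (c * \<tau> / 2))\<^sup>2 = exp (c * \<tau>)" "exp (c * \<tau> / 2) * exp (- (c * \<tau> / 2)) = 1" "(exp (- (c * \<tau> / 2)))\<^sup>2 = exp (- (c * \<tau>))" for \<tau>
    by (simp_all flip: exp_double exp_add)
  have "(integral {s..t} (\<lambda>\<tau>. exp (c * \<tau> / 2) * (exp (- (c * \<tau> / 2)) * a \<tau>)))\<^sup>2
     \<le> integral {s..t} (\<lambda>\<tau>. (exp (c * \<tau> / 2))\<^sup>2) * integral {s..t} (\<lambda>\<tau>. (exp (- (c * \<tau> / 2)) * a \<tau>)\<^sup>2)"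
  proof (rule Cauchy_Schwarz_integral)
    show "(\<lambda>\<tau>. (exp (c * \<tau> / 2))\<^sup>2) integrable_on {s..t}"
      by (intro integrable_continuous_real continuous_intros) auto
    show "(\<lambda>\<tau>. (exp (- (c * \<tau> / 2)) * a \<tau>)\<^sup>2) integrable_on {s..t}"
      using a2 by (simp add: power_mult_distrib e)
    show "(\<lambda>\<tau>. exp (c * \<tau> / 2) * (exp (- (c * \<tau> / 2)) * a \<tau>)) integrable_on {s..t}"
      using a by (simp add: e mult.assoc[symmetric])
  qed
  moreover have "integral {s..t} (\<lambda>\<tau>. exp (c * \<tau>)) = (exp (c * t) - exp (c * s)) / c"
    by (rule integral_unique[OF has_integral_exp[OF assms(1,2)]])
  ultimately show ?thesis by (simp add: power_mult_distrib e mult.assoc[symmetric])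
qed

text \<open>A solution \<open>x\<close> of the Euler-Lagrange equation with velocity \<open>x'\<close> and initial momentum \<open>- q\<close>. In the
  application \<open>q\<close> is the gradient of the value function at \<open>M\<close>.\<close>

locale extremal = discounted_problem Lg Gx Gv K \<gamma> C b \<epsilon>
  for Lg :: "'d::finite l2 \<Rightarrow> 'd l2 \<Rightarrow> real" and Gx Gv K \<gamma> C b \<epsilon> +
  fixes x x' :: "real \<Rightarrow> 'd l2" and M q :: "'d l2"
  assumes x0: "x 0 = M"
    and x_deriv: "\<And>t. t \<ge> 0 \<Longrightarrow> (x has_vector_derivative x' t) (at t within {0..})"
    and x'_cont: "continuous_on {0..} x'"
    and momentum: "\<And>t. t \<ge> 0 \<Longrightarrow> ((\<lambda>t. exp (- (\<epsilon> * t)) *\<^sub>R Gv (x t) (x' t)) has_vector_derivative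
        exp (- (\<epsilon> * t)) *\<^sub>R Gx (x t) (x' t)) (at t within {0..})"
    and init: "Gv M (x' 0) = - q"
begin

lemma x_cont: "continuous_on {0..} x"
  unfolding continuous_on_eq_continuous_within using has_vector_derivative_continuous[OF x_deriv] by auto

lemma x_deriv_at: "t > 0 \<Longrightarrow> (x has_vector_derivative x' t) (at t)"
  using x_deriv[of t] at_within_interior[of t "{0..}"] by simp

lemma x_curve: "curve_from M x"
  unfolding curve_from_def
proof (intro conjI allI)
  fix T :: real
  show "L2_AC T x"
  proof (rule L2_AC_C1)
    show "(x has_vector_derivative x' t) (at t within {0..T})" if "t \<in> {0..T}" for t
      by (rule has_vector_derivative_within_subset[OF x_deriv]) (use that in auto)
    show "continuous_on {0..T} x'" by (rule continuous_on_subset[OF x'_cont]) auto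
  qed
qed (rule x0)

definition mom :: "real \<Rightarrow> 'd l2" where "mom t = exp (- (\<epsilon> * t)) *\<^sub>R Gv (x t) (x' t)"

definition force :: "real \<Rightarrow> 'd l2" where "force t = exp (- (\<epsilon> * t)) *\<^sub>R Gx (x t) (x' t)"

lemma mom_deriv: "t \<ge> 0 \<Longrightarrow> (mom has_vector_derivative force t) (at t within {0..})"
  using momentum[of t] unfolding mom_def[abs_def] force_def .

lemma mom_deriv_at: "t > 0 \<Longrightarrow> (mom has_vector_derivative force t) (at t)"
  using mom_deriv[of t] at_within_interior[of t "{0..}"] by simp

lemma mom_cont: "continuous_on {0..} mom"
  unfolding continuous_on_eq_continuous_within using has_vector_derivative_continuous[OF mom_deriv] by auto

lemma force_cont: "continuous_on {0..} force"
  unfolding force_def by (intro continuous_intros continuous_on_Gx_Gv x_cont x'_cont)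

text \<open>The first variation of the cost at the extremal in a direction that vanishes at time \<open>T\<close>. It is the
  fundamental theorem for \<open>t \<mapsto> mom t \<bullet> \<psi> t\<close>, whose derivative is the integrand; only the boundary term
  at \<open>0\<close> remains.\<close>

lemma weak_euler_lagrange:
  assumes "T > 0" and \<psi>: "L2_AC T \<psi>" "\<psi> T = 0" and N: "negligible N"
    and d: "\<And>t. t \<in> {0<..<T} - N \<Longrightarrow> (\<psi> has_vector_derivative \<psi>' t) (at t)"
  shows "((\<lambda>t. force t \<bullet> \<psi> t + mom t \<bullet> \<psi>' t) has_integral q \<bullet> \<psi> 0) {0..T}"
proof -
  define h where "h t = mom t \<bullet> \<psi> t" for t
  have \<psi>c: "continuous_on {0..T} \<psi>" by (rule L2_AC_derivative(4)[OF \<psi>(1) \<open>T > 0\<close>])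
  obtain B1 where B1: "B1 > 0" "\<And>t. t \<in> {0..T} \<Longrightarrow> norm (mom t) \<le> B1"
    by (rule bounded_on_interval[OF continuous_on_subset[OF mom_cont, of "{0..T}"]]) auto
  obtain B2 where B2: "B2 > 0" "\<And>t. t \<in> {0..T} \<Longrightarrow> norm (\<psi> t) \<le> B2"
    by (rule bounded_on_interval[OF \<psi>c]) auto
  obtain B3 where B3: "B3 > 0"
    and mom_lip: "\<And>s t. 0 \<le> s \<Longrightarrow> s \<le> t \<Longrightarrow> t \<le> T \<Longrightarrow> norm (mom t - mom s) \<le> B3 * (t - s)"
  proof (rule C1_Lipschitz_on_interval)
    show "(mom has_vector_derivative force t) (at t within {0..T})" if "t \<in> {0..T}" for t
      by (rule has_vector_derivative_within_subset[OF mom_deriv]) (use that in auto)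
    show "continuous_on {0..T} force" by (rule continuous_on_subset[OF force_cont]) auto
  qed blast
  have hAC: "L2_AC T h"
  proof (rule L2_AC_Lipschitz_bound[OF \<psi>(1), of "B2 * B3" B1])
    fix s t assume st: "0 \<le> s" "s \<le> t" "t \<le> T"
    have "norm (h t - h s) = norm (mom t \<bullet> (\<psi> t - \<psi> s) + (mom t - mom s) \<bullet> \<psi> s)"
      by (simp add: h_def inner_simps)
    also have "\<dots> \<le> norm (mom t) * norm (\<psi> t - \<psi> s) + norm (mom t - mom s) * norm (\<psi> s)"
      by (rule norm_triangle_le) (simp add: Cauchy_Schwarz_ineq2 add_mono)
    also have "\<dots> \<le> B1 * norm (\<psi> t - \<psi> s) + (B3 * (t - s)) * B2"
      using B1 B2 B3 mom_lip[OF st] st by (intro add_mono mult_mono) auto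
    finally show "norm (h t - h s) \<le> B1 * norm (\<psi> t - \<psi> s) + B2 * B3 * (t - s)" by (simp add: algebra_simps)
  qed (use B1 B2 B3 in auto)
  have "((\<lambda>t. vector_derivative h (at t)) has_integral h T - h 0) {0..T}"
    by (rule L2_AC_real_FTC[OF hAC \<open>T > 0\<close>])
  then have "((\<lambda>t. force t \<bullet> \<psi> t + mom t \<bullet> \<psi>' t) has_integral h T - h 0) {0..T}"
  proof (rule has_integral_spike[rotated 2])
    show "negligible (N \<union> {0, T})" using N by simp
    fix t assume t: "t \<in> {0..T} - (N \<union> {0, T})"
    then have t': "t \<in> {0<..<T} - N" "t > 0" by auto
    have "(h has_derivative (\<lambda>k. mom t \<bullet> (k *\<^sub>R \<psi>' t) + (k *\<^sub>R force t) \<bullet> \<psi> t)) (at t)"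
      unfolding h_def[abs_def]
      by (rule has_derivative_inner) (use d[OF t'(1)] mom_deriv_at[OF t'(2)] in \<open>auto simp: has_vector_derivative_def\<close>)
    then have "(h has_vector_derivative force t \<bullet> \<psi> t + mom t \<bullet> \<psi>' t) (at t)"
      unfolding has_vector_derivative_def by (rule has_derivative_eq_rhs) (simp add: fun_eq_iff algebra_simps)
    then show "force t \<bullet> \<psi> t + mom t \<bullet> \<psi>' t = vector_derivative h (at t)"
      by (rule vector_derivative_at[symmetric])
  qed
  moreover have "h T - h 0 = q \<bullet> \<psi> 0" using \<psi>(2) init by (simp add: h_def mom_def x0)
  ultimately show ?thesis by simp
qed

end

text \<open>A curve of finite cost from the same initial point, compared with the extremal on \<open>[0,T]\<close> with the
  exponential weight \<open>exp(- \<mu> t)\<close>.\<close>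

locale competitor = extremal Lg Gx Gv K \<gamma> C b \<epsilon> x x' M q
  for Lg :: "'d::finite l2 \<Rightarrow> 'd l2 \<Rightarrow> real" and Gx Gv K \<gamma> C b \<epsilon> x x' M q +
  fixes y :: "real \<Rightarrow> 'd l2" and T \<mu> :: real
  assumes y: "curve_from M y" and T: "T > 0" and \<mu>: "\<mu> \<ge> 1"
    and y_int: "running y absolutely_integrable_on {0<..}"
begin

definition w :: "real \<Rightarrow> 'd l2" where "w t = y t - x t"

definition a :: "real \<Rightarrow> 'd l2" where "a t = vector_derivative y (at t) - x' t"

text \<open>A primitive of \<open>exp(- \<mu> t) w'\<close>. Integrating by parts moves the derivative off \<open>w\<close>, so that only
  the integral of a continuous function is needed.\<close>

definition \<psi>0 :: "real \<Rightarrow> 'd l2"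
  where "\<psi>0 t = exp (- (\<mu> * t)) *\<^sub>R w t + \<mu> *\<^sub>R integral {0..t} (\<lambda>s. exp (- (\<mu> * s)) *\<^sub>R w s)"

text \<open>The variation: it satisfies \<open>\<psi>' = exp(- \<mu> t) w'\<close> almost everywhere on \<open>[0,T]\<close> and vanishes from time \<open>T\<close> on.\<close>

definition \<psi> :: "real \<Rightarrow> 'd l2" where "\<psi> t = \<psi>0 (min t T) - \<psi>0 T"

definition J :: real where "J = integral {0..T} (\<lambda>t. exp (- (\<mu> * t)) * (norm (a t))\<^sup>2)"

lemma w_AC: "L2_AC T' w"
  unfolding w_def using y x_curve by (intro L2_AC_diff) (auto simp: curve_from_def)

lemma w_0: "w 0 = 0" using y by (simp add: w_def x0 curve_from_def)

lemma w_cont: "continuous_on {0..T'} w"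
  unfolding w_def by (intro continuous_intros curve_from_continuous[OF y] curve_from_continuous[OF x_curve])

lemma ew_cont: "continuous_on {0..T'} (\<lambda>s. exp (- (\<mu> * s)) *\<^sub>R w s)"
  by (intro continuous_intros w_cont)

lemma w_deriv: "\<exists>N. negligible N \<and> (\<forall>t\<in>{0<..<T} - N. (y has_vector_derivative vector_derivative y (at t)) (at t)
    \<and> (w has_vector_derivative a t) (at t))"
proof -
  have "L2_AC T y" using y by (simp add: curve_from_def)
  from L2_AC_derivative(1)[OF this T] obtain N where N: "negligible N"
    "\<forall>t\<in>{0<..<T} - N. (y has_vector_derivative vector_derivative y (at t)) (at t)" by blast
  show ?thesis
  proof (intro exI[of _ N] conjI ballI)
    fix t assume t: "t \<in> {0<..<T} - N"
    show "(w has_vector_derivative a t) (at t)"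
      unfolding w_def[abs_def] a_def
      by (intro has_vector_derivative_diff x_deriv_at) (use N(2) t in auto)
  qed (use N in auto)
qed

lemma \<psi>0_deriv:
  assumes t: "0 < t" "t < T" and d: "(w has_vector_derivative a t) (at t)"
  shows "(\<psi>0 has_vector_derivative exp (- (\<mu> * t)) *\<^sub>R a t) (at t)"
proof -
  have "((\<lambda>t. integral {0..t} (\<lambda>s. exp (- (\<mu> * s)) *\<^sub>R w s)) has_vector_derivative exp (- (\<mu> * t)) *\<^sub>R w t) (at t within {0..T})"
    by (rule integral_has_vector_derivative[OF ew_cont]) (use t in auto)
  then have i: "((\<lambda>t. integral {0..t} (\<lambda>s. exp (- (\<mu> * s)) *\<^sub>R w s)) has_vector_derivative exp (- (\<mu> * t)) *\<^sub>R w t) (at t)"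
    using t by (simp add: at_within_Icc_at)
  have e: "((\<lambda>t. exp (- (\<mu> * t))) has_real_derivative - \<mu> * exp (- (\<mu> * t))) (at t)"
    by (auto intro!: derivative_eq_intros)
  have "(\<psi>0 has_vector_derivative ((exp (- (\<mu> * t)) *\<^sub>R a t + (- \<mu> * exp (- (\<mu> * t))) *\<^sub>R w t) + \<mu> *\<^sub>R (exp (- (\<mu> * t)) *\<^sub>R w t))) (at t)"
    unfolding \<psi>0_def[abs_def]
    by (intro has_vector_derivative_add has_vector_derivative_scaleR[OF e d]
        bounded_linear.has_vector_derivative[OF bounded_linear_scaleR_right i])
  then show ?thesis by simp
qed

lemma \<psi>_deriv:
  assumes t: "0 < t" "t < T" and d: "(w has_vector_derivative a t) (at t)"
  shows "(\<psi> has_vector_derivative exp (- (\<mu> * t)) *\<^sub>R a t) (at t)"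
proof -
  have "((\<lambda>t. \<psi>0 t - \<psi>0 T) has_vector_derivative exp (- (\<mu> * t)) *\<^sub>R a t - 0) (at t)"
    by (intro has_vector_derivative_diff has_vector_derivative_const \<psi>0_deriv assms)
  then have "((\<lambda>t. \<psi>0 t - \<psi>0 T) has_vector_derivative exp (- (\<mu> * t)) *\<^sub>R a t) (at t)" by simp
  then show ?thesis
    unfolding has_vector_derivative_def
    by (rule has_derivative_transform_within_open[of _ _ t UNIV "{..<T}"]) (use t in \<open>auto simp: \<psi>_def\<close>)
qed

lemma \<psi>0_AC: "L2_AC T \<psi>0"
proof -
  obtain B where B: "B > 0" "\<And>t. t \<in> {0..T} \<Longrightarrow> norm (w t) \<le> B"
    by (rule bounded_on_interval[OF w_cont]) auto
  show ?thesis
  proof (rule L2_AC_Lipschitz_bound[OF w_AC, of "2 * \<mu> * B" 1])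
    fix s t assume st: "0 \<le> s" "s \<le> t" "t \<le> T"
    have int: "(\<lambda>s. exp (- (\<mu> * s)) *\<^sub>R w s) integrable_on {0..t}"
      by (rule integrable_continuous_real[OF ew_cont])
    have "integral {0..s} (\<lambda>s. exp (- (\<mu> * s)) *\<^sub>R w s) + integral {s..t} (\<lambda>s. exp (- (\<mu> * s)) *\<^sub>R w s)
        = integral {0..t} (\<lambda>s. exp (- (\<mu> * s)) *\<^sub>R w s)"
      using st by (intro Henstock_Kurzweil_Integration.integral_combine int)
    then have eq: "\<psi>0 t - \<psi>0 s = exp (- (\<mu> * t)) *\<^sub>R (w t - w s) + (exp (- (\<mu> * t)) - exp (- (\<mu> * s))) *\<^sub>R w s
        + \<mu> *\<^sub>R integral {s..t} (\<lambda>s. exp (- (\<mu> * s)) *\<^sub>R w s)"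
      by (simp add: \<psi>0_def algebra_simps flip: scaleR_add_right)
    have e1: "0 < exp (- (\<mu> * r)) \<and> exp (- (\<mu> * r)) \<le> 1" if "0 \<le> r" for r using \<mu> that by simp
    have 1: "norm (exp (- (\<mu> * t)) *\<^sub>R (w t - w s)) \<le> 1 * norm (w t - w s)"
      unfolding norm_scaleR using e1[of t] st by (intro mult_right_mono) auto
    have "exp (- (\<mu> * s)) - exp (- (\<mu> * t)) = exp (- (\<mu> * s)) * (1 - exp (- (\<mu> * (t - s))))"
      by (simp add: algebra_simps flip: exp_add)
    also have "\<dots> \<le> 1 * (\<mu> * (t - s))"
      using e1[of s] e1[of "t - s"] st exp_ge_add_one_self[of "- (\<mu> * (t - s))"] \<mu>
      by (intro mult_mono) auto
    finally have "\<bar>exp (- (\<mu> * t)) - exp (- (\<mu> * s))\<bar> \<le> \<mu> * (t - s)"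
      using st \<mu> by (auto simp: abs_if mult_left_mono)
    then have 2: "norm ((exp (- (\<mu> * t)) - exp (- (\<mu> * s))) *\<^sub>R w s) \<le> (\<mu> * (t - s)) * B"
      unfolding norm_scaleR using B(2)[of s] st \<mu> by (intro mult_mono) auto
    have "norm (integral {s..t} (\<lambda>s. exp (- (\<mu> * s)) *\<^sub>R w s)) \<le> B * (t - s)"
    proof (rule integral_bound)
      show "continuous_on {s..t} (\<lambda>s. exp (- (\<mu> * s)) *\<^sub>R w s)"
        by (rule continuous_on_subset[OF ew_cont[of t]]) (use st in auto)
      show "norm (exp (- (\<mu> * r)) *\<^sub>R w r) \<le> B" if "r \<in> {s..t}" for r
      proof -
        have "exp (- (\<mu> * r)) * norm (w r) \<le> 1 * B"
          using e1[of r] B(2)[of r] that st by (intro mult_mono) auto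
        then show ?thesis by simp
      qed
    qed (use st in auto)
    then have 3: "norm (\<mu> *\<^sub>R integral {s..t} (\<lambda>s. exp (- (\<mu> * s)) *\<^sub>R w s)) \<le> \<mu> * (B * (t - s))"
      using \<mu> by (simp add: mult_left_mono)
    have "norm (\<psi>0 t - \<psi>0 s) \<le> 1 * norm (w t - w s) + (\<mu> * (t - s)) * B + \<mu> * (B * (t - s))"
      unfolding eq by (intro norm_triangle_le[OF add_mono] norm_triangle_le[OF add_mono] 1 2 3)
    then show "norm (\<psi>0 t - \<psi>0 s) \<le> 1 * norm (w t - w s) + 2 * \<mu> * B * (t - s)" by (simp add: algebra_simps)
  qed (use \<mu> B in auto)
qed

lemma \<psi>_AC: "L2_AC T' \<psi>"
proof -
  obtain \<beta> where \<beta>: "\<beta> \<in> borel_measurable borel" "\<forall>t. 0 \<le> \<beta> t" "\<beta> integrable_on {0..T}"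
    "(\<lambda>t. (\<beta> t)\<^sup>2) integrable_on {0..T}"
    "\<forall>s t. 0 \<le> s \<and> s \<le> t \<and> t \<le> T \<longrightarrow> norm (\<psi>0 t - \<psi>0 s) \<le> integral {s..t} \<beta>"
    using \<psi>0_AC unfolding L2_AC_def by blast
  define \<alpha> where "\<alpha> t = (if t \<in> {0..T} then \<beta> t else 0)" for t
  have U: "\<alpha> integrable_on S" if "S \<in> sets lebesgue" for S
  proof -
    have "\<alpha> integrable_on UNIV" unfolding \<alpha>_def using \<beta>(3) by (simp only: integrable_restrict_UNIV)
    then have "\<alpha> absolutely_integrable_on UNIV"
      by (intro nonnegative_absolutely_integrable_1) (use \<beta>(2) in \<open>auto simp: \<alpha>_def\<close>)
    then have "\<alpha> absolutely_integrable_on S" by (rule set_integrable_subset) (use that in auto)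
    then show ?thesis using set_lebesgue_integral_eq_integral(1) by blast
  qed
  have "(\<lambda>t. (\<alpha> t)\<^sup>2) integrable_on UNIV"
  proof -
    have "(\<lambda>t. (\<alpha> t)\<^sup>2) = (\<lambda>t. if t \<in> {0..T} then (\<beta> t)\<^sup>2 else 0)" by (auto simp: \<alpha>_def)
    then show ?thesis using \<beta>(4) integrable_restrict_UNIV by metis
  qed
  then have "(\<lambda>t. (\<alpha> t)\<^sup>2) absolutely_integrable_on UNIV"
    by (intro nonnegative_absolutely_integrable_1) auto
  then have "(\<lambda>t. (\<alpha> t)\<^sup>2) absolutely_integrable_on {0..T'}" by (rule set_integrable_subset) auto
  then have U2: "(\<lambda>t. (\<alpha> t)\<^sup>2) integrable_on {0..T'}" using set_lebesgue_integral_eq_integral(1) by blast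
  have "norm (\<psi> t - \<psi> s) \<le> integral {s..t} \<alpha>" if st: "0 \<le> s" "s \<le> t" for s t
  proof (cases "s < T")
    case True
    have "norm (\<psi> t - \<psi> s) \<le> integral {s..min t T} \<beta>"
      using \<beta>(5) st True by (simp add: \<psi>_def min_def)
    also have "\<dots> = integral {s..min t T} \<alpha>"
      by (rule integral_cong) (use st in \<open>simp add: \<alpha>_def\<close>)
    also have "\<dots> \<le> integral {s..t} \<alpha>"
      by (rule integral_subset_le) (use \<beta>(2) in \<open>auto intro!: U simp: \<alpha>_def\<close>)
    finally show ?thesis .
  next
    case False
    then have "min t T = T" "min s T = T" using st by auto
    then have "\<psi> t - \<psi> s = 0" by (simp add: \<psi>_def)
    moreover have "0 \<le> integral {s..t} \<alpha>" by (rule integral_nonneg) (use \<beta>(2) in \<open>auto intro!: U simp: \<alpha>_def\<close>)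
    ultimately show ?thesis by simp
  qed
  then show ?thesis unfolding L2_AC_def using \<beta>(1,2) U[of "{0..T'}"] U2
    by (intro exI[of _ \<alpha>]) (auto simp: \<alpha>_def[abs_def])
qed

lemma \<psi>_T: "\<psi> T = 0" "t \<ge> T \<Longrightarrow> \<psi> t = 0"
  by (auto simp: \<psi>_def)

lemma a_int: "(\<lambda>t. norm (a t)) integrable_on {0..T}" "(\<lambda>t. (norm (a t))\<^sup>2) integrable_on {0..T}"
proof -
  obtain N where N: "negligible N" "\<forall>t\<in>{0<..<T} - N. (w has_vector_derivative a t) (at t)" using w_deriv by blast
  show "(\<lambda>t. norm (a t)) integrable_on {0..T}" "(\<lambda>t. (norm (a t))\<^sup>2) integrable_on {0..T}"
    by (rule L2_AC_norm_le_integral[OF w_AC T N(1)]; use N(2) in simp)+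
qed

lemma exp_mult_integrable:
  fixes f :: "real \<Rightarrow> real"
  assumes f: "f integrable_on {0..T}" and nonneg: "\<And>t. f t \<ge> 0" and "c \<ge> 0"
  shows "(\<lambda>t. exp (- (c * t)) * f t) integrable_on {0..T}"
proof (rule measurable_bounded_by_integrable_imp_integrable[OF _ f])
  show "(\<lambda>t. exp (- (c * t)) * f t) \<in> borel_measurable (lebesgue_on {0..T})"
    by (intro borel_measurable_times borel_measurable_lebesgue_onI integrable_imp_measurable[OF f]) measurable
  fix t assume "t \<in> {0..T}"
  then have "exp (- (c * t)) * f t \<le> 1 * f t"
    using nonneg \<open>c \<ge> 0\<close> by (intro mult_right_mono) auto
  then show "norm (exp (- (c * t)) * f t) \<le> f t" using nonneg[of t] by simp
qed simp

lemma J_int: "(\<lambda>t. exp (- (\<mu> * t)) * (norm (a t))\<^sup>2) integrable_on {0..T}"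
  using \<mu> by (intro exp_mult_integrable a_int) auto

lemma J_nonneg: "0 \<le> J"
  unfolding J_def by (rule integral_nonneg[OF J_int]) simp

text \<open>This bound and the next one gain the factor \<open>1 / \<mu>\<close>, which makes \<open>w\<close> and \<open>\<psi>\<close> lower order terms compared
  with \<open>w'\<close>.\<close>

lemma w_bound:
  assumes t: "t \<in> {0..T}" shows "(norm (w t))\<^sup>2 \<le> exp (\<mu> * t) * (J / \<mu>)"
proof -
  obtain N where N: "negligible N" "\<forall>t\<in>{0<..<T} - N. (w has_vector_derivative a t) (at t)" using w_deriv by blast
  have sub: "{0..t} \<subseteq> {0..T}" using t by auto
  have "norm (w t - w 0) \<le> integral {0..t} (\<lambda>\<tau>. norm (a \<tau>))"
    by (rule L2_AC_norm_le_integral(3)[OF w_AC T N(1)]) (use N(2) t in auto)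
  then have "(norm (w t))\<^sup>2 \<le> (integral {0..t} (\<lambda>\<tau>. norm (a \<tau>)))\<^sup>2"
    by (intro power_mono) (auto simp: w_0)
  also have "\<dots> \<le> (exp (\<mu> * t) - exp (\<mu> * 0)) / \<mu> * integral {0..t} (\<lambda>\<tau>. exp (- (\<mu> * \<tau>)) * (norm (a \<tau>))\<^sup>2)"
    by (rule weighted_Cauchy_Schwarz)
       (use \<mu> t integrable_on_subinterval[OF a_int(1) sub] integrable_on_subinterval[OF J_int sub] in auto)
  also have "\<dots> \<le> (exp (\<mu> * t) / \<mu>) * J"
  proof (rule mult_mono)
    show "integral {0..t} (\<lambda>\<tau>. exp (- (\<mu> * \<tau>)) * (norm (a \<tau>))\<^sup>2) \<le> J"
      unfolding J_def by (rule integral_subset_le[OF sub integrable_on_subinterval[OF J_int sub] J_int]) simp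
    show "0 \<le> integral {0..t} (\<lambda>\<tau>. exp (- (\<mu> * \<tau>)) * (norm (a \<tau>))\<^sup>2)"
      by (rule integral_nonneg[OF integrable_on_subinterval[OF J_int sub]]) simp
  qed (use \<mu> in \<open>auto intro: divide_right_mono\<close>)
  finally show ?thesis by simp
qed

lemma \<psi>_bound:
  assumes t: "t \<in> {0..T}" shows "(norm (\<psi> t))\<^sup>2 \<le> exp (- (\<mu> * t)) * (J / \<mu>)"
proof -
  obtain N where N: "negligible N" "\<forall>t\<in>{0<..<T} - N. (w has_vector_derivative a t) (at t)" using w_deriv by blast
  have sub: "{t..T} \<subseteq> {0..T}" using t by auto
  define \<alpha> where "\<alpha> \<tau> = exp (- (\<mu> * \<tau>)) * norm (a \<tau>)" for \<tau>
  have \<alpha>: "\<alpha> integrable_on {0..T}"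
    unfolding \<alpha>_def using \<mu> by (intro exp_mult_integrable a_int) auto
  have "norm (\<psi>0 T - \<psi>0 t) \<le> integral {t..T} (\<lambda>\<tau>. norm (exp (- (\<mu> * \<tau>)) *\<^sub>R a \<tau>))"
    by (rule L2_AC_norm_le_integral(3)[OF \<psi>0_AC T N(1) \<psi>0_deriv]) (use N(2) t in auto)
  then have "norm (\<psi> t) \<le> integral {t..T} \<alpha>"
    using t by (simp add: \<psi>_def \<alpha>_def[abs_def] norm_minus_commute min_def)
  then have "(norm (\<psi> t))\<^sup>2 \<le> (integral {t..T} \<alpha>)\<^sup>2" by (rule power_mono) simp
  also have "\<dots> \<le> (exp (- \<mu> * T) - exp (- \<mu> * t)) / (- \<mu>) * integral {t..T} (\<lambda>\<tau>. exp (- (- \<mu> * \<tau>)) * (\<alpha> \<tau>)\<^sup>2)"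
  proof (rule weighted_Cauchy_Schwarz)
    have "exp (- (- \<mu> * \<tau>)) * (\<alpha> \<tau>)\<^sup>2 = exp (- (\<mu> * \<tau>)) * (norm (a \<tau>))\<^sup>2" for \<tau>
      by (simp add: \<alpha>_def power_mult_distrib power2_eq_square[of "exp _"] mult.assoc[symmetric] flip: exp_add)
    then show "(\<lambda>\<tau>. exp (- (- \<mu> * \<tau>)) * (\<alpha> \<tau>)\<^sup>2) integrable_on {t..T}"
      using integrable_on_subinterval[OF J_int sub] by simp
  qed (use \<mu> t integrable_on_subinterval[OF \<alpha> sub] in auto)
  also have "\<dots> = (exp (- (\<mu> * t)) - exp (- (\<mu> * T))) / \<mu> * integral {t..T} (\<lambda>\<tau>. exp (- (\<mu> * \<tau>)) * (norm (a \<tau>))\<^sup>2)"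
  proof -
    have "exp (- (- \<mu> * \<tau>)) * (\<alpha> \<tau>)\<^sup>2 = exp (- (\<mu> * \<tau>)) * (norm (a \<tau>))\<^sup>2" for \<tau>
      by (simp add: \<alpha>_def power_mult_distrib power2_eq_square[of "exp _"] mult.assoc[symmetric] flip: exp_add)
    moreover have "(exp (- \<mu> * T) - exp (- \<mu> * t)) / (- \<mu>) = (exp (- (\<mu> * t)) - exp (- (\<mu> * T))) / \<mu>"
      by (simp add: divide_simps)
    ultimately show ?thesis by simp
  qed
  also have "\<dots> \<le> (exp (- (\<mu> * t)) / \<mu>) * J"
  proof (rule mult_mono)
    show "integral {t..T} (\<lambda>\<tau>. exp (- (\<mu> * \<tau>)) * (norm (a \<tau>))\<^sup>2) \<le> J"
      unfolding J_def by (rule integral_subset_le[OF sub integrable_on_subinterval[OF J_int sub] J_int]) simp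
    show "0 \<le> integral {t..T} (\<lambda>\<tau>. exp (- (\<mu> * \<tau>)) * (norm (a \<tau>))\<^sup>2)"
      by (rule integral_nonneg[OF integrable_on_subinterval[OF J_int sub]]) simp
  qed (use \<mu> in \<open>auto intro: divide_right_mono\<close>)
  finally show ?thesis by simp
qed

end

section \<open>Monotonicity of the first variation\<close>

context convex_lagrangian
begin

definition error_const :: real where "error_const = \<Lambda>\<^sup>2 / \<gamma> + \<Lambda>"

lemma error_const_nonneg: "error_const \<ge> 0"
  using \<Lambda>_pos \<gamma>_pos by (simp add: error_const_def)

text \<open>In the estimate \<open>error_const\<close> collects what is left of the Lipschitz terms after Young's
  inequality has absorbed half of the monotonicity. Here \<open>h\<close> is the square root of the weight and \<open>j\<close> the common bound
  of the weighted \<open>y - x\<close> and \<open>\<psi>\<close>.\<close>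

lemma weighted_monotonicity:
  assumes h: "h > 0" and j: "j \<ge> 0" and w: "norm (y - x) * h \<le> j" and \<psi>: "norm \<psi> \<le> h * j"
  shows "\<gamma> * (h * norm (N1 - N2))\<^sup>2 - error_const * j\<^sup>2
    \<le> (Gx y N1 - Gx x N2) \<bullet> \<psi> + h\<^sup>2 * ((Gv y N1 - Gv x N2) \<bullet> (N1 - N2))"
proof -
  define A where "A = h * norm (N1 - N2)"
  define W where "W = norm (y - x) * h"
  have A: "A \<ge> 0" using h by (simp add: A_def)
  have W: "0 \<le> W" "W \<le> j" using w h by (simp_all add: W_def)
  have "(Gv y N1 - Gv x N2) \<bullet> (N1 - N2) = (Gv y N1 - Gv y N2) \<bullet> (N1 - N2) + (Gv y N2 - Gv x N2) \<bullet> (N1 - N2)"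
    by (simp add: inner_simps)
  moreover have "2 * \<gamma> * (norm (N1 - N2))\<^sup>2 \<le> (Gv y N1 - Gv y N2) \<bullet> (N1 - N2)"
    by (rule Gv_strongly_monotone)
  moreover have "- (\<Lambda> * norm (y - x) * norm (N1 - N2)) \<le> (Gv y N2 - Gv x N2) \<bullet> (N1 - N2)"
  proof -
    have "norm (Gv y N2 - Gv x N2) * norm (N1 - N2) \<le> (\<Lambda> * norm (y - x)) * norm (N1 - N2)"
      using Gv_Lipschitz[of y N2 x N2] by (intro mult_right_mono) auto
    then show ?thesis using Cauchy_Schwarz_ineq2[of "Gv y N2 - Gv x N2" "N1 - N2"] by linarith
  qed
  ultimately have "2 * \<gamma> * (norm (N1 - N2))\<^sup>2 - \<Lambda> * norm (y - x) * norm (N1 - N2) \<le> (Gv y N1 - Gv x N2) \<bullet> (N1 - N2)"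
    by linarith
  then have "h\<^sup>2 * (2 * \<gamma> * (norm (N1 - N2))\<^sup>2 - \<Lambda> * norm (y - x) * norm (N1 - N2)) \<le> h\<^sup>2 * ((Gv y N1 - Gv x N2) \<bullet> (N1 - N2))"
    by (intro mult_left_mono) auto
  moreover have "h\<^sup>2 * (2 * \<gamma> * (norm (N1 - N2))\<^sup>2 - \<Lambda> * norm (y - x) * norm (N1 - N2)) = 2 * \<gamma> * A\<^sup>2 - \<Lambda> * (W * A)"
    by (simp add: A_def W_def power2_eq_square algebra_simps)
  moreover have "\<Lambda> * (W * A) \<le> \<Lambda> * (j * A)"
    using W A \<Lambda>_pos by (intro mult_left_mono mult_right_mono) auto
  ultimately have X: "2 * \<gamma> * A\<^sup>2 - \<Lambda> * (j * A) \<le> h\<^sup>2 * ((Gv y N1 - Gv x N2) \<bullet> (N1 - N2))" by linarith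
  have "norm (Gx y N1 - Gx x N2) * norm \<psi> \<le> (\<Lambda> * (norm (y - x) + norm (N1 - N2))) * (h * j)"
    using Gx_Lipschitz[of y N1 x N2] \<psi> \<Lambda>_pos by (intro mult_mono) auto
  also have "\<dots> = \<Lambda> * ((W + A) * j)" by (simp add: W_def A_def algebra_simps)
  also have "\<dots> \<le> \<Lambda> * ((j + A) * j)"
    using W j \<Lambda>_pos by (intro mult_left_mono mult_right_mono) auto
  finally have Y: "- (\<Lambda> * ((j + A) * j)) \<le> (Gx y N1 - Gx x N2) \<bullet> \<psi>"
    using Cauchy_Schwarz_ineq2[of "Gx y N1 - Gx x N2" \<psi>] by linarith
  have "0 \<le> \<gamma> * (A - \<Lambda> * j / \<gamma>)\<^sup>2" using \<gamma>_pos by simp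
  also have "\<dots> = \<gamma> * A\<^sup>2 - 2 * (\<Lambda> * (j * A)) + \<Lambda>\<^sup>2 / \<gamma> * j\<^sup>2"
    using \<gamma>_pos by (simp add: power2_eq_square field_simps)
  finally have young: "2 * (\<Lambda> * (j * A)) \<le> \<gamma> * A\<^sup>2 + \<Lambda>\<^sup>2 / \<gamma> * j\<^sup>2" by simp
  have "\<Lambda> * ((j + A) * j) = \<Lambda> * j\<^sup>2 + \<Lambda> * (j * A)" by (simp add: power2_eq_square algebra_simps)
  moreover have "error_const * j\<^sup>2 = \<Lambda>\<^sup>2 / \<gamma> * j\<^sup>2 + \<Lambda> * j\<^sup>2" by (simp add: error_const_def algebra_simps)
  ultimately show ?thesis using X Y young unfolding A_def[symmetric] by linarith
qed

end

context competitor
begin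

text \<open>Pointwise comparison of the first variations at the competitor and at the extremal.\<close>

lemma first_variation_lower:
  assumes t: "t \<in> {0..T}"
  shows "force t \<bullet> \<psi> t + mom t \<bullet> (exp (- (\<mu> * t)) *\<^sub>R a t)
      + \<gamma> * exp (- (\<epsilon> * T)) * (exp (- (\<mu> * t)) * (norm (a t))\<^sup>2) - error_const * (J / \<mu>)
    \<le> exp (- (\<epsilon> * t)) * (Gx (y t) (vector_derivative y (at t)) \<bullet> \<psi> t
        + exp (- (\<mu> * t)) * (Gv (y t) (vector_derivative y (at t)) \<bullet> a t))"
proof -
  define h where "h = exp (- (\<mu> * t) / 2)"
  have h: "h > 0" "h\<^sup>2 = exp (- (\<mu> * t))" unfolding h_def by (simp_all flip: exp_double)
  define j where "j = sqrt (J / \<mu>)"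
  have j: "j \<ge> 0" "j\<^sup>2 = J / \<mu>" using J_nonneg \<mu> by (simp_all add: j_def)
  have "(norm (y t - x t) * h)\<^sup>2 \<le> (exp (\<mu> * t) * (J / \<mu>)) * h\<^sup>2"
    unfolding power_mult_distrib using w_bound[OF t] by (intro mult_right_mono) (auto simp: w_def)
  also have "\<dots> = j\<^sup>2" by (simp add: h(2) j(2) exp_minus)
  finally have 1: "norm (y t - x t) * h \<le> j" using j(1) by (rule power2_le_imp_le)
  have "(norm (\<psi> t))\<^sup>2 \<le> (h * j)\<^sup>2"
    using \<psi>_bound[OF t] by (simp add: power_mult_distrib h(2) j(2))
  then have 2: "norm (\<psi> t) \<le> h * j" by (rule power2_le_imp_le) (use h j in simp)
  define X where "X = \<gamma> * (exp (- (\<mu> * t)) * (norm (a t))\<^sup>2)"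
  define D where "D = (Gx (y t) (vector_derivative y (at t)) - Gx (x t) (x' t)) \<bullet> \<psi> t
      + exp (- (\<mu> * t)) * ((Gv (y t) (vector_derivative y (at t)) - Gv (x t) (x' t)) \<bullet> a t)"
  have D: "X - error_const * (J / \<mu>) \<le> D"
    using weighted_monotonicity[OF h(1) j(1) 1 2, of "vector_derivative y (at t)" "x' t"]
    by (simp add: power_mult_distrib h(2) j(2) a_def X_def D_def)
  have e: "0 < exp (- (\<epsilon> * t))" "exp (- (\<epsilon> * t)) \<le> 1" "exp (- (\<epsilon> * T)) \<le> exp (- (\<epsilon> * t))"
    using t \<epsilon>_pos by (auto intro: mult_left_mono)
  have "X \<ge> 0" using \<gamma>_pos by (simp add: X_def)
  then have "exp (- (\<epsilon> * T)) * X \<le> exp (- (\<epsilon> * t)) * X" using e by (intro mult_right_mono) auto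
  moreover have "exp (- (\<epsilon> * t)) * (error_const * (J / \<mu>)) \<le> 1 * (error_const * (J / \<mu>))"
    using e error_const_nonneg J_nonneg \<mu> by (intro mult_right_mono mult_nonneg_nonneg) auto
  moreover have "exp (- (\<epsilon> * t)) * (X - error_const * (J / \<mu>)) \<le> exp (- (\<epsilon> * t)) * D"
    using D e by (intro mult_left_mono) auto
  ultimately have "exp (- (\<epsilon> * T)) * X - error_const * (J / \<mu>) \<le> exp (- (\<epsilon> * t)) * D"
    by (simp add: right_diff_distrib)
  moreover have "exp (- (\<epsilon> * t)) * D + force t \<bullet> \<psi> t + mom t \<bullet> (exp (- (\<mu> * t)) *\<^sub>R a t)
    = exp (- (\<epsilon> * t)) * (Gx (y t) (vector_derivative y (at t)) \<bullet> \<psi> t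
        + exp (- (\<mu> * t)) * (Gv (y t) (vector_derivative y (at t)) \<bullet> a t))"
    by (simp add: D_def force_def mom_def inner_diff_left algebra_simps)
  ultimately show ?thesis by (simp add: X_def algebra_simps)
qed

text \<open>The curve \<open>y - r \<psi>\<close> starts at \<open>M - r \<psi>(0)\<close>. Its running cost is estimated by the upper quadratic
  estimate around \<open>y\<close>, and the first variation at \<open>y\<close> by that at \<open>x\<close>, which integrates to
  \<open>q \<bullet> \<psi> 0\<close>. After time \<open>T\<close> it coincides with \<open>y\<close>.\<close>

theorem value_along_variation:
  assumes r: "r > 0"
  shows "V (M - r *\<^sub>R \<psi> 0) \<le> integral {0<..} (running y) - r * (q \<bullet> \<psi> 0)
    - r * (\<gamma> * exp (- (\<epsilon> * T)) * J - error_const * (J / \<mu>) * T) + K * r\<^sup>2 * ((T + 1) * J)"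
proof -
  define z where "z t = y t - r *\<^sub>R \<psi> t" for t
  define U where "U t = - r * (force t \<bullet> \<psi> t + mom t \<bullet> (exp (- (\<mu> * t)) *\<^sub>R a t))
     - r * (\<gamma> * exp (- (\<epsilon> * T)) * (exp (- (\<mu> * t)) * (norm (a t))\<^sup>2) - error_const * (J / \<mu>))
     + K * r\<^sup>2 * (J + exp (- (\<mu> * t)) * (norm (a t))\<^sup>2)" for t
  define IU where "IU = - r * (q \<bullet> \<psi> 0) - r * (\<gamma> * exp (- (\<epsilon> * T)) * J - error_const * (J / \<mu>) * T) + K * r\<^sup>2 * (J * T + J)"
  obtain N where N: "negligible N" and dy: "\<And>t. t \<in> {0<..<T} - N \<Longrightarrow> (y has_vector_derivative vector_derivative y (at t)) (at t)"
    and dw: "\<And>t. t \<in> {0<..<T} - N \<Longrightarrow> (w has_vector_derivative a t) (at t)" using w_deriv by blast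
  have d\<psi>: "(\<psi> has_vector_derivative exp (- (\<mu> * t)) *\<^sub>R a t) (at t)" if "t \<in> {0<..<T} - N" for t
    using \<psi>_deriv[of t] dw[OF that] that by auto
  have z: "curve_from (M - r *\<^sub>R \<psi> 0) z"
    unfolding curve_from_def z_def using y by (auto simp: curve_from_def intro!: L2_AC_diff L2_AC_scaleR \<psi>_AC)
  have U: "(U has_integral IU) {0..T}"
  proof -
    have 1: "((\<lambda>t. force t \<bullet> \<psi> t + mom t \<bullet> (exp (- (\<mu> * t)) *\<^sub>R a t)) has_integral q \<bullet> \<psi> 0) {0..T}"
      by (rule weak_euler_lagrange[OF T \<psi>_AC \<psi>_T(1) N d\<psi>])
    have 2: "((\<lambda>t. exp (- (\<mu> * t)) * (norm (a t))\<^sup>2) has_integral J) {0..T}"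
      unfolding J_def by (rule integrable_integral[OF J_int])
    have 3: "((\<lambda>t. c) has_integral c * T) {0..T}" for c :: real
      using has_integral_const_real[of c 0 T] T by (simp add: mult.commute)
    show ?thesis unfolding U_def IU_def
      by (rule has_integral_add[OF has_integral_diff[OF has_integral_mult_right[OF 1]
            has_integral_mult_right[OF has_integral_diff[OF has_integral_mult_right[OF 2] 3]]]
            has_integral_mult_right[OF has_integral_add[OF 3 2]]])
  qed
  define R where "R t = running y t + (if t \<in> {0..T} then U t else 0)" for t
  have R: "(R has_integral integral {0<..} (running y) + IU) {0<..}"
    unfolding R_def
  proof (rule has_integral_add)
    show "(running y has_integral integral {0<..} (running y)) {0<..}"
      using set_lebesgue_integral_eq_integral(1)[OF y_int] by (rule integrable_integral)
    have "((\<lambda>t. if t \<in> {0..T} then U t else 0) has_integral IU) UNIV"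
      using U by (simp only: has_integral_restrict_UNIV)
    then show "((\<lambda>t. if t \<in> {0..T} then U t else 0) has_integral IU) {0<..}"
      by (subst has_integral_spike_set_eq[of "{0<..}" UNIV]) (auto intro: negligible_subset[of "{0}"])
  qed
  have le: "running z t \<le> R t" if t: "t \<in> {0<..} - (N \<union> {T})" for t
  proof (cases "t < T")
    case True
    then have t': "t \<in> {0<..<T} - N" "t \<in> {0..T}" using t by auto
    let ?D = "vector_derivative y (at t)"
    let ?E = "exp (- (\<mu> * t))"
    have "(z has_vector_derivative ?D - r *\<^sub>R (?E *\<^sub>R a t)) (at t)"
      unfolding z_def[abs_def]
      by (intro has_vector_derivative_diff dy[OF t'(1)] bounded_linear.has_vector_derivative[OF bounded_linear_scaleR_right d\<psi>[OF t'(1)]])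
    then have Dz: "vector_derivative z (at t) = ?D - r *\<^sub>R (?E *\<^sub>R a t)" by (rule vector_derivative_at)
    have "Lg (y t + - (r *\<^sub>R \<psi> t)) (?D + - (r *\<^sub>R (?E *\<^sub>R a t)))
      \<le> Lg (y t) ?D + Gx (y t) ?D \<bullet> - (r *\<^sub>R \<psi> t) + Gv (y t) ?D \<bullet> - (r *\<^sub>R (?E *\<^sub>R a t))
        + K * (norm (- (r *\<^sub>R (?E *\<^sub>R a t))))\<^sup>2 + K * (norm (- (r *\<^sub>R \<psi> t)))\<^sup>2"
      by (rule upper)
    also have "\<dots> = Lg (y t) ?D - r * (Gx (y t) ?D \<bullet> \<psi> t + ?E * (Gv (y t) ?D \<bullet> a t))
        + K * r\<^sup>2 * ((norm (\<psi> t))\<^sup>2 + ?E\<^sup>2 * (norm (a t))\<^sup>2)"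
      by (simp add: power_mult_distrib algebra_simps)
    finally have L1: "Lg (z t) (vector_derivative z (at t)) \<le> Lg (y t) ?D - r * (Gx (y t) ?D \<bullet> \<psi> t + ?E * (Gv (y t) ?D \<bullet> a t))
        + K * r\<^sup>2 * ((norm (\<psi> t))\<^sup>2 + ?E\<^sup>2 * (norm (a t))\<^sup>2)"
      by (simp add: z_def Dz)
    have E: "0 < ?E" "?E \<le> 1" using t' \<mu> by auto
    have e: "0 < exp (- (\<epsilon> * t))" "exp (- (\<epsilon> * t)) \<le> 1" using t' \<epsilon>_pos by auto
    have "(norm (\<psi> t))\<^sup>2 \<le> ?E * (J / \<mu>)" using \<psi>_bound t' by auto
    also have "\<dots> \<le> 1 * (J / 1)"
      using E J_nonneg \<mu> by (intro mult_mono divide_left_mono) auto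
    finally have b1: "(norm (\<psi> t))\<^sup>2 \<le> J" by simp
    have b2: "?E\<^sup>2 * (norm (a t))\<^sup>2 \<le> ?E * (norm (a t))\<^sup>2"
      using E by (intro mult_right_mono) (auto simp: power2_eq_square mult_le_one)
    have b3: "exp (- (\<epsilon> * t)) * (K * r\<^sup>2 * ((norm (\<psi> t))\<^sup>2 + ?E\<^sup>2 * (norm (a t))\<^sup>2)) \<le> 1 * (K * r\<^sup>2 * (J + ?E * (norm (a t))\<^sup>2))"
      using e K_pos by (intro mult_mono mult_left_mono[OF add_mono[OF b1 b2]]) auto
    have "running z t \<le> exp (- (\<epsilon> * t)) * (Lg (y t) ?D - r * (Gx (y t) ?D \<bullet> \<psi> t + ?E * (Gv (y t) ?D \<bullet> a t))
        + K * r\<^sup>2 * ((norm (\<psi> t))\<^sup>2 + ?E\<^sup>2 * (norm (a t))\<^sup>2))"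
      unfolding running_def using L1 by (intro mult_left_mono) auto
    also have "\<dots> = running y t - r * (exp (- (\<epsilon> * t)) * (Gx (y t) ?D \<bullet> \<psi> t + ?E * (Gv (y t) ?D \<bullet> a t)))
        + exp (- (\<epsilon> * t)) * (K * r\<^sup>2 * ((norm (\<psi> t))\<^sup>2 + ?E\<^sup>2 * (norm (a t))\<^sup>2))"
      by (simp add: running_def algebra_simps)
    finally have L2: "running z t \<le> running y t - r * (exp (- (\<epsilon> * t)) * (Gx (y t) ?D \<bullet> \<psi> t + ?E * (Gv (y t) ?D \<bullet> a t)))
        + exp (- (\<epsilon> * t)) * (K * r\<^sup>2 * ((norm (\<psi> t))\<^sup>2 + ?E\<^sup>2 * (norm (a t))\<^sup>2))" .
    have "r * (force t \<bullet> \<psi> t + mom t \<bullet> (?E *\<^sub>R a t)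
      + \<gamma> * exp (- (\<epsilon> * T)) * (?E * (norm (a t))\<^sup>2) - error_const * (J / \<mu>))
      \<le> r * (exp (- (\<epsilon> * t)) * (Gx (y t) ?D \<bullet> \<psi> t + ?E * (Gv (y t) ?D \<bullet> a t)))"
      using first_variation_lower[OF t'(2)] r by (intro mult_left_mono) auto
    moreover have "R t = running y t - r * (force t \<bullet> \<psi> t + mom t \<bullet> (?E *\<^sub>R a t)
      + \<gamma> * exp (- (\<epsilon> * T)) * (?E * (norm (a t))\<^sup>2) - error_const * (J / \<mu>)) + K * r\<^sup>2 * (J + ?E * (norm (a t))\<^sup>2)"
      using t' by (simp add: R_def U_def algebra_simps)
    ultimately show ?thesis using L2 b3 by linarith
  next
    case False
    then have t': "t > T" using t by auto
    have "vector_derivative z (at t) = vector_derivative y (at t)"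
    proof (rule vector_derivative_cong_eventually)
      have "\<forall>\<^sub>F s in nhds t. s \<in> {T<..}" using t' by (intro eventually_nhds_in_open) auto
      then show "\<forall>\<^sub>F s in nhds t. z s = y s" by eventually_elim (simp add: z_def \<psi>_T)
    qed
    then have "running z t = running y t" using t' by (simp add: running_def z_def \<psi>_T)
    then show ?thesis using t' by (simp add: R_def)
  qed
  have neg: "negligible (N \<union> {T})" using N by simp
  have z_int: "running z absolutely_integrable_on {0<..}"
  proof (rule measurable_bounded_by_integrable_imp_absolutely_integrable[OF running_measurable[OF z]])
    (* From - F <= running z <= R follows |running z| <= R + 2 F. *)
    let ?F = "\<lambda>t. floor_bound * exp (- (\<epsilon> * t))"
    have "(\<lambda>t. R t + 2 * ?F t) integrable_on {0<..}"
      by (rule integrable_add[OF has_integral_integrable[OF R]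
            integrable_on_mult_right[OF set_lebesgue_integral_eq_integral(1)[OF floor_integrable]]])
    then show "(\<lambda>t. if t \<in> N \<union> {T} then \<bar>running z t\<bar> else R t + 2 * ?F t) integrable_on {0<..}"
      by (rule integrable_spike[OF _ neg]) simp
    fix t :: real assume t: "t \<in> {0<..}"
    have "0 \<le> ?F t" using floor_bound_nonneg by simp
    then show "norm (running z t) \<le> (if t \<in> N \<union> {T} then \<bar>running z t\<bar> else R t + 2 * ?F t)"
      using le[of t] running_lower[of t z] t by auto
  qed simp
  have "V (M - r *\<^sub>R \<psi> 0) \<le> integral {0<..} (running z)" by (rule value_le_integral[OF z z_int])
  also have "\<dots> \<le> integral {0<..} (running y) + IU"
  proof (rule has_integral_le)
    show "(running z has_integral integral {0<..} (running z)) {0<..}"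
      using set_lebesgue_integral_eq_integral(1)[OF z_int] by (rule integrable_integral)
    show "((\<lambda>t. if t \<in> N \<union> {T} then running z t else R t) has_integral integral {0<..} (running y) + IU) {0<..}"
      by (rule has_integral_spike[OF neg _ R]) simp
    show "running z t \<le> (if t \<in> N \<union> {T} then running z t else R t)" if "t \<in> {0<..}" for t
      using le that by auto
  qed
  finally show ?thesis by (simp add: IU_def algebra_simps)
qed

end

section \<open>Convergence of near-minimizers\<close>

lemma GDERIV_if_quadratic_error:
  fixes f :: "'a::real_inner \<Rightarrow> real"
  assumes err: "\<And>h. \<bar>f (z + h) - f z - G \<bullet> h\<bar> \<le> c * (norm h)\<^sup>2"
  shows "GDERIV f z :> G"
  unfolding gderiv_def has_derivative_at_alt
proof (intro conjI allI impI)
  show "bounded_linear (\<lambda>h. h \<bullet> G)" by (rule bounded_linear_inner_left)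
  fix e :: real assume "e > 0"
  show "\<exists>d>0. \<forall>y. norm (y - z) < d \<longrightarrow> norm (f y - f z - (y - z) \<bullet> G) \<le> e * norm (y - z)"
  proof (intro exI[of _ "e / (\<bar>c\<bar> + 1)"] conjI allI impI)
    show "e / (\<bar>c\<bar> + 1) > 0" using \<open>e > 0\<close> by simp
    fix y assume y: "norm (y - z) < e / (\<bar>c\<bar> + 1)"
    have "norm (f y - f z - (y - z) \<bullet> G) \<le> c * (norm (y - z))\<^sup>2"
      using err[of "y - z"] by (simp add: inner_commute)
    also have "\<dots> \<le> (\<bar>c\<bar> + 1) * (norm (y - z))\<^sup>2" by (intro mult_right_mono) auto
    also have "\<dots> = ((\<bar>c\<bar> + 1) * norm (y - z)) * norm (y - z)" by (simp add: power2_eq_square)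
    also have "\<dots> \<le> e * norm (y - z)"
      using y by (intro mult_right_mono) (auto simp: field_simps)
    finally show "norm (f y - f z - (y - z) \<bullet> G) \<le> e * norm (y - z)" .
  qed
qed

context competitor
begin

lemma w_le_integral: "t \<in> {0..T} \<Longrightarrow> norm (w t) \<le> integral {0..T} (\<lambda>\<tau>. norm (a \<tau>))"
proof -
  assume t: "t \<in> {0..T}"
  obtain N where N: "negligible N" "\<forall>t\<in>{0<..<T} - N. (w has_vector_derivative a t) (at t)" using w_deriv by blast
  have "norm (w t - w 0) \<le> integral {0..t} (\<lambda>\<tau>. norm (a \<tau>))"
    by (rule L2_AC_norm_le_integral(3)[OF w_AC T N(1)]) (use N(2) t in auto)
  also have "\<dots> \<le> integral {0..T} (\<lambda>\<tau>. norm (a \<tau>))"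
    using t by (intro integral_subset_le integrable_on_subinterval[OF a_int(1)] a_int) auto
  finally show ?thesis by (simp add: w_0)
qed

lemma integral_a_le: "(integral {0..T} (\<lambda>\<tau>. norm (a \<tau>)))\<^sup>2 \<le> T * integral {0..T} (\<lambda>\<tau>. (norm (a \<tau>))\<^sup>2)"
proof -
  have "(integral {0..T} (\<lambda>\<tau>. 1 * norm (a \<tau>)))\<^sup>2 \<le> integral {0..T} (\<lambda>\<tau>. 1\<^sup>2) * integral {0..T} (\<lambda>\<tau>. (norm (a \<tau>))\<^sup>2)"
    by (rule Cauchy_Schwarz_integral) (use a_int integrable_const_ivl[of "1::real" 0 T] in simp_all)
  then show ?thesis using T by simp
qed

lemma J_ge: "integral {0..T} (\<lambda>\<tau>. (norm (a \<tau>))\<^sup>2) \<le> exp (\<mu> * T) * J"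
proof -
  have "integral {0..T} (\<lambda>\<tau>. (norm (a \<tau>))\<^sup>2) \<le> integral {0..T} (\<lambda>t. exp (\<mu> * T) * (exp (- (\<mu> * t)) * (norm (a t))\<^sup>2))"
  proof (rule integral_le[OF a_int(2) integrable_on_mult_right[OF J_int]])
    fix t assume "t \<in> {0..T}"
    then have "1 \<le> exp (\<mu> * T) * exp (- (\<mu> * t))" using \<mu> by (simp flip: exp_add)
    then have "1 * (norm (a t))\<^sup>2 \<le> (exp (\<mu> * T) * exp (- (\<mu> * t))) * (norm (a t))\<^sup>2"
      by (rule mult_right_mono) simp
    then show "(norm (a t))\<^sup>2 \<le> exp (\<mu> * T) * (exp (- (\<mu> * t)) * (norm (a t))\<^sup>2)" by simp
  qed
  then show ?thesis by (simp add: J_def)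
qed

lemma \<psi>_0_le: "norm (\<psi> 0) \<le> sqrt J"
proof (rule real_le_rsqrt)
  have "(norm (\<psi> 0))\<^sup>2 \<le> J / \<mu>" using \<psi>_bound[of 0] T by simp
  also have "\<dots> \<le> J / 1" using \<mu> J_nonneg by (intro divide_left_mono) auto
  finally show "(norm (\<psi> 0))\<^sup>2 \<le> J" by simp
qed

end

context extremal
begin

text \<open>Differentiability bounds \<open>V (M - r \<psi>(0))\<close> from below by its linearization up to \<open>\<omega> r norm (\<psi> 0)\<close>.
  Combined with \<open>value_along_variation\<close>, and with \<open>r = \<rho> / sqrt J\<close>, this reads
  \<open>\<kappa> \<rho> sqrt J \<le> \<delta> + \<omega> \<rho> + K (T + 1) \<rho>\<^sup>2\<close>. The parameters \<open>\<omega>\<close>, \<open>\<rho>\<close>, \<open>\<delta>\<close> are chosen in this order, so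
  that each term on the right is at most \<open>\<kappa> \<rho> d / 4\<close>, where \<open>d\<close> is the desired bound of \<open>sqrt J\<close>.\<close>

lemma near_minimizers_converge:
  assumes grad: "GDERIV V M :> q" and T: "T > 0" and e: "e > 0"
  shows "\<exists>\<delta>>0. \<forall>y. curve_from M y \<longrightarrow> running y absolutely_integrable_on {0<..} \<longrightarrow>
    integral {0<..} (running y) \<le> V M + \<delta> \<longrightarrow>
    integral {0..T} (\<lambda>t. (norm (vector_derivative y (at t) - x' t))\<^sup>2) \<le> e"
proof -
  define \<kappa> where "\<kappa> = \<gamma> / 2 * exp (- (\<epsilon> * T))"
  have \<kappa>: "\<kappa> > 0" using \<gamma>_pos by (simp add: \<kappa>_def)
  (* Half of the monotonicity constant absorbs the error terms; the rest is kappa. *)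
  define \<mu> where "\<mu> = error_const * T / \<kappa> + 1"
  have \<mu>: "\<mu> \<ge> 1" using error_const_nonneg T \<kappa> by (simp add: \<mu>_def)
  have absorb: "error_const * T \<le> \<kappa> * \<mu>" using \<kappa> by (simp add: \<mu>_def distrib_left)
  define d where "d = sqrt (e * exp (- (\<mu> * T)))"
  have d: "d > 0" "d\<^sup>2 = e * exp (- (\<mu> * T))" using e by (simp_all add: d_def)
  define \<omega> where "\<omega> = \<kappa> * d / 4"
  have \<omega>: "\<omega> > 0" using \<kappa> d by (simp add: \<omega>_def)
  obtain s where s: "s > 0" "\<And>y. norm (y - M) < s \<Longrightarrow> norm (V y - V M - (y - M) \<bullet> q) \<le> \<omega> * norm (y - M)"
    using grad \<omega> unfolding gderiv_def has_derivative_at_alt by blast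
  define \<rho> where "\<rho> = min (s / 2) (\<kappa> * d / (4 * (K * (T + 1))))"
  have KT: "K * (T + 1) > 0" using K_pos T by simp
  have \<rho>: "\<rho> > 0" "\<rho> < s" "K * (T + 1) * \<rho> \<le> \<kappa> * d / 4"
  proof -
    show "\<rho> > 0" using s \<kappa> d KT by (simp add: \<rho>_def)
    have "\<rho> \<le> s / 2" by (simp add: \<rho>_def)
    then show "\<rho> < s" using s by linarith
    have "K * (T + 1) * \<rho> \<le> K * (T + 1) * (\<kappa> * d / (4 * (K * (T + 1))))"
      using KT by (intro mult_left_mono) (auto simp: \<rho>_def)
    also have "\<dots> = \<kappa> * d / 4"
    proof -
      have "c * (\<kappa> * d / (4 * c)) = \<kappa> * d / 4" if "c > 0" for c :: real using that by simp
      from this[OF KT] show ?thesis .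
    qed
    finally show "K * (T + 1) * \<rho> \<le> \<kappa> * d / 4" .
  qed
  define \<delta> where "\<delta> = \<rho> * (\<kappa> * d / 4)"
  have "\<delta> > 0" using \<rho> \<kappa> d by (simp add: \<delta>_def)
  moreover have "integral {0..T} (\<lambda>t. (norm (vector_derivative y (at t) - x' t))\<^sup>2) \<le> e"
    if near: "curve_from M y" "running y absolutely_integrable_on {0<..}" "integral {0<..} (running y) \<le> V M + \<delta>" for y
  proof -
    interpret competitor Lg Gx Gv K \<gamma> C b \<epsilon> x x' M q y T \<mu>
      by unfold_locales (use near T \<mu> in auto)
    have "J \<le> d\<^sup>2"
    proof (rule ccontr)
      assume "\<not> J \<le> d\<^sup>2"
      then have sJ: "d < sqrt J" using d by (simp add: real_less_rsqrt)
      then have sJ0: "sqrt J > 0" using d by linarith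
      define r where "r = \<rho> / sqrt J"
      have r: "r > 0" "r * sqrt J = \<rho>" using \<rho> sJ0 by (simp_all add: r_def)
      have rJ: "r * J = \<rho> * sqrt J" "r\<^sup>2 * J = \<rho>\<^sup>2"
      proof -
        have "J = sqrt J * sqrt J" using J_nonneg by simp
        then show "r * J = \<rho> * sqrt J" using r(2) by (metis mult.assoc)
        show "r\<^sup>2 * J = \<rho>\<^sup>2" using r(2) J_nonneg by (metis power_mult_distrib real_sqrt_pow2)
      qed
      have n: "norm (r *\<^sub>R \<psi> 0) \<le> \<rho>"
        using \<psi>_0_le r by (simp flip: r(2))
      have "norm (V (M - r *\<^sub>R \<psi> 0) - V M - (M - r *\<^sub>R \<psi> 0 - M) \<bullet> q) \<le> \<omega> * norm (M - r *\<^sub>R \<psi> 0 - M)"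
        using n \<rho>(2) by (intro s(2)) simp
      also have "\<dots> \<le> \<omega> * \<rho>" using n \<omega> by (intro mult_left_mono) auto
      finally have "V M - r * (q \<bullet> \<psi> 0) - \<omega> * \<rho> \<le> V (M - r *\<^sub>R \<psi> 0)"
        by (simp add: inner_commute abs_le_iff)
      moreover have "V (M - r *\<^sub>R \<psi> 0) \<le> V M + \<delta> - r * (q \<bullet> \<psi> 0)
          - r * (\<gamma> * exp (- (\<epsilon> * T)) * J - error_const * (J / \<mu>) * T) + K * r\<^sup>2 * ((T + 1) * J)"
        using value_along_variation[OF r(1)] near(3) by linarith
      moreover have "r * (\<kappa> * J) \<le> r * (\<gamma> * exp (- (\<epsilon> * T)) * J - error_const * (J / \<mu>) * T)"
      proof (rule mult_left_mono)
        have \<kappa>_double: "\<gamma> * exp (- (\<epsilon> * T)) * J = 2 * (\<kappa> * J)" by (simp add: \<kappa>_def)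
        have "error_const * (J / \<mu>) * T = (error_const * T) * (J / \<mu>)" by simp
        also have "\<dots> \<le> (\<kappa> * \<mu>) * (J / \<mu>)" using absorb J_nonneg \<mu> by (intro mult_right_mono) auto
        also have "\<dots> = \<kappa> * J" using \<mu> by simp
        finally show "\<kappa> * J \<le> \<gamma> * exp (- (\<epsilon> * T)) * J - error_const * (J / \<mu>) * T"
          using \<kappa>_double by linarith
      qed (use r in simp)
      moreover have "r * (\<kappa> * J) = \<rho> * (\<kappa> * sqrt J)" using rJ(1) by (simp add: algebra_simps)
      moreover have "K * r\<^sup>2 * ((T + 1) * J) = \<rho> * (K * (T + 1) * \<rho>)"
      proof -
        have "K * r\<^sup>2 * ((T + 1) * J) = K * (T + 1) * (r\<^sup>2 * J)" by (simp add: algebra_simps)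
        then show ?thesis unfolding rJ(2) by (simp add: power2_eq_square algebra_simps)
      qed
      moreover have "\<rho> * (K * (T + 1) * \<rho>) \<le> \<rho> * (\<kappa> * d / 4)" using \<rho> by (intro mult_left_mono) auto
      moreover have "\<rho> * (\<kappa> * d) < \<rho> * (\<kappa> * sqrt J)" using \<rho> \<kappa> sJ by simp
      moreover have "\<omega> * \<rho> = \<rho> * (\<kappa> * d / 4)" by (simp add: \<omega>_def)
      moreover have "\<rho> * (\<kappa> * d / 4) = \<rho> * (\<kappa> * d) / 4" "0 < \<rho> * (\<kappa> * d)" using \<rho> \<kappa> d by auto
      ultimately show False unfolding \<delta>_def by linarith
    qed
    then have "exp (\<mu> * T) * J \<le> exp (\<mu> * T) * (e * exp (- (\<mu> * T)))" by (simp add: d(2))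
    also have "\<dots> = e" by (simp add: exp_minus)
    finally show ?thesis using J_ge by (simp add: a_def)
  qed
  ultimately show ?thesis by blast
qed

definition optimal_running :: "real \<Rightarrow> real"
  where "optimal_running t = exp (- (\<epsilon> * t)) * Lg (x t) (x' t)"

lemma running_x: "t > 0 \<Longrightarrow> running x t = optimal_running t"
  by (simp add: running_def optimal_running_def vector_derivative_at[OF x_deriv_at])

lemma optimal_running_cont: "continuous_on {0..T} optimal_running"
  unfolding optimal_running_def
  by (intro continuous_intros continuous_on_Lg continuous_on_subset[OF x_cont] continuous_on_subset[OF x'_cont]) auto

lemma optimal_running_lower: "0 \<le> optimal_running t + floor_bound * exp (- (\<epsilon> * t))"
proof -
  have "exp (- (\<epsilon> * t)) * - floor_bound \<le> optimal_running t"
    unfolding optimal_running_def by (intro mult_left_mono Lg_lower_bound) simp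
  then show ?thesis by (simp add: mult.commute)
qed

text \<open>Near-minimizers are close to the extremal on \<open>[0,T]\<close>, and the lower quadratic estimate around the
  extremal turns this into an upper bound of its cost on \<open>[0,T]\<close>. Adding the lower bound of the running cost
  makes all integrands nonnegative, so that the cost of a near-minimizer after time \<open>T\<close> can be dropped.\<close>

lemma cost_on_interval_le:
  assumes grad: "GDERIV V M :> q" and T: "T > 0"
  shows "integral {0..T} (\<lambda>t. optimal_running t + floor_bound * exp (- (\<epsilon> * t))) \<le> V M + floor_bound / \<epsilon>"
proof (rule field_le_epsilon)
  fix \<eta> :: real assume \<eta>: "\<eta> > 0"
  let ?F = "\<lambda>t. floor_bound * exp (- (\<epsilon> * t))"
  obtain B1 where B1: "B1 > 0" "\<And>t. t \<in> {0..T} \<Longrightarrow> norm (mom t) \<le> B1"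
    by (rule bounded_on_interval[OF continuous_on_subset[OF mom_cont, of "{0..T}"]]) auto
  obtain B2 where B2: "B2 > 0" "\<And>t. t \<in> {0..T} \<Longrightarrow> norm (force t) \<le> B2"
    by (rule bounded_on_interval[OF continuous_on_subset[OF force_cont, of "{0..T}"]]) auto
  define Q where "Q = T * B2 + B1 + K * T"
  have Q: "Q > 0" using B1 B2 K_pos T by (simp add: Q_def add_pos_pos)
  (* s bounds both the distance of y to x on [0,T] and the integral of the speed difference. *)
  define s where "s = min 1 (\<eta> / (2 * Q))"
  have s: "s > 0" "s \<le> 1" "Q * s \<le> \<eta> / 2"
  proof -
    show "s > 0" "s \<le> 1" using \<eta> Q by (simp_all add: s_def)
    have "Q * s \<le> Q * (\<eta> / (2 * Q))" using Q by (intro mult_left_mono) (auto simp: s_def)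
    then show "Q * s \<le> \<eta> / 2" using Q by simp
  qed
  have "s\<^sup>2 / T > 0" using s T by simp
  from near_minimizers_converge[OF grad T this] obtain \<delta> where \<delta>: "\<delta> > 0"
    "\<And>y. curve_from M y \<Longrightarrow> running y absolutely_integrable_on {0<..} \<Longrightarrow> integral {0<..} (running y) \<le> V M + \<delta> \<Longrightarrow>
      integral {0..T} (\<lambda>t. (norm (vector_derivative y (at t) - x' t))\<^sup>2) \<le> s\<^sup>2 / T" by blast
  obtain y where near: "curve_from M y" "running y absolutely_integrable_on {0<..}" "integral {0<..} (running y) \<le> V M + min \<delta> (\<eta> / 2)"
    by (rule near_minimizer_exists[of "min \<delta> (\<eta> / 2)"]) (use \<delta> \<eta> in auto)
  interpret competitor Lg Gx Gv K \<gamma> C b \<epsilon> x x' M q y T 1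
    by unfold_locales (use near T in auto)
  define A where "A = integral {0..T} (\<lambda>\<tau>. norm (a \<tau>))"
  have "integral {0..T} (\<lambda>\<tau>. (norm (a \<tau>))\<^sup>2) \<le> s\<^sup>2 / T" unfolding a_def by (rule \<delta>(2)[OF near(1,2)]) (use near(3) in simp)
  then have "T * integral {0..T} (\<lambda>\<tau>. (norm (a \<tau>))\<^sup>2) \<le> T * (s\<^sup>2 / T)" using T by (intro mult_left_mono) auto
  then have "A\<^sup>2 \<le> s\<^sup>2" unfolding A_def using integral_a_le T by simp
  then have A: "A \<le> s" by (rule power2_le_imp_le) (use s in simp)
  have A0: "A \<ge> 0" unfolding A_def by (rule integral_nonneg[OF a_int(1)]) simp
  have F_int: "?F integrable_on {0<..}" using set_lebesgue_integral_eq_integral(1)[OF floor_integrable] .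
  have y_F: "(\<lambda>t. running y t + ?F t) integrable_on {0<..}"
    using set_lebesgue_integral_eq_integral(1)[OF y_int] F_int by (rule integrable_add)
  have y_F0: "0 \<le> running y t + ?F t" for t using running_lower[of t y] by linarith
  have y_F': "(\<lambda>t. running y t + ?F t) integrable_on {0<..T}"
  proof -
    have "(\<lambda>t. running y t + ?F t) absolutely_integrable_on {0<..}"
      by (rule nonnegative_absolutely_integrable_1[OF y_F y_F0])
    then have "(\<lambda>t. running y t + ?F t) absolutely_integrable_on {0<..T}" by (rule set_integrable_subset) auto
    then show ?thesis using set_lebesgue_integral_eq_integral(1) by blast
  qed
  have spike0: "(f has_integral i) {0<..T} \<longleftrightarrow> (f has_integral i) {0..T}" for f :: "real \<Rightarrow> real" and i
    by (rule has_integral_spike_set_eq) (auto intro: negligible_subset[of "{0}"])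
  have y_F1: "((\<lambda>t. running y t + ?F t) has_integral integral {0<..T} (\<lambda>t. running y t + ?F t)) {0..T}"
    using integrable_integral[OF y_F'] unfolding spike0 .
  have bound: "optimal_running t + ?F t \<le> (running y t + ?F t) + ((B2 * s + K * s) + B1 * norm (a t))" if t: "t \<in> {0<..T}" for t
  proof -
    let ?e = "exp (- (\<epsilon> * t))"
    have "Lg (x t) (x' t) + Gx (x t) (x' t) \<bullet> w t + Gv (x t) (x' t) \<bullet> a t + \<gamma> * (norm (a t))\<^sup>2 - K * (norm (w t))\<^sup>2
        \<le> Lg (x t + w t) (x' t + a t)" by (rule lower)
    then have "Lg (x t) (x' t) + Gx (x t) (x' t) \<bullet> w t + Gv (x t) (x' t) \<bullet> a t - K * (norm (w t))\<^sup>2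
        \<le> Lg (y t) (vector_derivative y (at t))"
    proof -
      have xy: "x t + w t = y t" "x' t + a t = vector_derivative y (at t)" by (simp_all add: w_def a_def)
      have "0 \<le> \<gamma> * (norm (a t))\<^sup>2" using \<gamma>_pos by simp
      then show ?thesis using \<open>_ \<le> Lg (x t + w t) (x' t + a t)\<close> unfolding xy by linarith
    qed
    then have "?e * (Lg (x t) (x' t) + Gx (x t) (x' t) \<bullet> w t + Gv (x t) (x' t) \<bullet> a t - K * (norm (w t))\<^sup>2)
        \<le> running y t" unfolding running_def by (intro mult_left_mono) auto
    moreover have "?e * (Lg (x t) (x' t) + Gx (x t) (x' t) \<bullet> w t + Gv (x t) (x' t) \<bullet> a t - K * (norm (w t))\<^sup>2)
        = optimal_running t + force t \<bullet> w t + mom t \<bullet> a t - ?e * (K * (norm (w t))\<^sup>2)"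
      by (simp add: optimal_running_def force_def mom_def algebra_simps)
    moreover have wt: "norm (w t) \<le> s" using w_le_integral[of t] t A by (simp add: A_def)
    have "norm (force t) * norm (w t) \<le> B2 * s" using B2(2)[of t] wt t B2 by (intro mult_mono) auto
    then have "- (B2 * s) \<le> force t \<bullet> w t" using Cauchy_Schwarz_ineq2[of "force t" "w t"] by linarith
    moreover have "norm (mom t) * norm (a t) \<le> B1 * norm (a t)" using B1(2)[of t] t by (intro mult_right_mono) auto
    then have "- (B1 * norm (a t)) \<le> mom t \<bullet> a t" using Cauchy_Schwarz_ineq2[of "mom t" "a t"] by linarith
    moreover have "?e * (K * (norm (w t))\<^sup>2) \<le> 1 * (K * s)"
    proof (intro mult_mono mult_left_mono)
      have "(norm (w t))\<^sup>2 \<le> s\<^sup>2" using wt by (rule power_mono) simp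
      also have "\<dots> \<le> s" using s by (simp add: power2_eq_square mult_left_le)
      finally show "(norm (w t))\<^sup>2 \<le> s" .
    qed (use t \<epsilon>_pos K_pos in auto)
    ultimately show ?thesis by simp
  qed
  have rhs: "((\<lambda>t. (running y t + ?F t) + ((B2 * s + K * s) + B1 * norm (a t))) has_integral
      integral {0<..T} (\<lambda>t. running y t + ?F t) + ((B2 * s + K * s) * T + B1 * A)) {0..T}"
    using has_integral_const_real[of "B2 * s + K * s" 0 T] T unfolding A_def
    by (intro has_integral_add[OF y_F1 has_integral_add[OF _ has_integral_mult_right[OF integrable_integral[OF a_int(1)]]]])
       (simp add: mult.commute)
  have "(\<lambda>t. optimal_running t + ?F t) integrable_on {0..T}"
    by (intro integrable_continuous_real continuous_intros optimal_running_cont)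
  then have lhs: "((\<lambda>t. optimal_running t + ?F t) has_integral integral {0..T} (\<lambda>t. optimal_running t + ?F t)) {0..T}"
    by (rule integrable_integral)
  have "integral {0..T} (\<lambda>t. optimal_running t + ?F t) \<le> integral {0<..T} (\<lambda>t. running y t + ?F t) + ((B2 * s + K * s) * T + B1 * A)"
    by (rule has_integral_le[OF lhs[folded spike0] rhs[folded spike0] bound])
  also have "integral {0<..T} (\<lambda>t. running y t + ?F t) \<le> integral {0<..} (\<lambda>t. running y t + ?F t)"
    by (rule integral_subset_le[OF _ y_F' y_F]) (use y_F0 in auto)
  also have "integral {0<..} (\<lambda>t. running y t + ?F t) = integral {0<..} (running y) + floor_bound / \<epsilon>"
  proof -
    have "integral {0<..} ?F = floor_bound * (1 / \<epsilon>)"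
      by (rule integral_unique[OF has_integral_mult_right[OF discount_has_integral]])
    then show ?thesis
      using Henstock_Kurzweil_Integration.integral_add[OF set_lebesgue_integral_eq_integral(1)[OF y_int] F_int] by simp
  qed
  also have "\<dots> + ((B2 * s + K * s) * T + B1 * A) \<le> V M + floor_bound / \<epsilon> + \<eta>"
  proof -
    have "B1 * A \<le> B1 * s" using A B1 by (intro mult_left_mono) auto
    moreover have "(B2 * s + K * s) * T + B1 * s = Q * s" by (simp add: Q_def algebra_simps)
    ultimately show ?thesis using s(3) near(3) by linarith
  qed
  finally show "integral {0..T} (\<lambda>t. optimal_running t + ?F t) \<le> V M + floor_bound / \<epsilon> + \<eta>" by simp
qed

text \<open>Monotone convergence as \<open>T\<close> tends to infinity.\<close>

lemma extremal_optimal: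
  assumes grad: "GDERIV V M :> q"
  shows "running x absolutely_integrable_on {0<..}" "integral {0<..} (running x) \<le> V M"
proof -
  let ?F = "\<lambda>t. floor_bound * exp (- (\<epsilon> * t))"
  define g where "g t = optimal_running t + ?F t" for t
  have g0: "0 \<le> g t" for t unfolding g_def by (rule optimal_running_lower)
  define f where "f k t = (if t \<in> {0..real k} then g t else 0)" for k :: nat and t
  have fk: "(f k has_integral integral {0..real k} g) {0<..}" for k
  proof -
    have "g integrable_on {0..real k}"
      unfolding g_def by (intro integrable_continuous_real continuous_intros optimal_running_cont)
    then have "(f k has_integral integral {0..real k} g) UNIV"
      unfolding f_def by (simp only: has_integral_restrict_UNIV integrable_integral)
    then show ?thesis
      by (subst has_integral_spike_set_eq[of "{0<..}" UNIV]) (auto simp: f_def intro: negligible_subset[of "{0}"])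
  qed
  have le: "integral {0<..} (f k) \<le> max 0 (V M + floor_bound / \<epsilon>)" for k
    using cost_on_interval_le[OF grad, of "real k"] unfolding integral_unique[OF fk] g_def
    by (cases k) auto
  have nonneg: "0 \<le> integral {0<..} (f k)" for k
    using fk g0 by (intro integral_nonneg) (auto simp: f_def)
  have mc: "g integrable_on {0<..} \<and> (\<lambda>k. integral {0<..} (f k)) \<longlonglongrightarrow> integral {0<..} g"
  proof (rule monotone_convergence_increasing)
    show "f k integrable_on {0<..}" for k using fk by blast
    show "f k t \<le> f (Suc k) t" for k t using g0 by (simp add: f_def)
    show "(\<lambda>k. f k t) \<longlonglongrightarrow> g t" if "t \<in> {0<..}" for t
    proof (rule tendsto_eventually)
      show "\<forall>\<^sub>F k in sequentially. f k t = g t"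
        using eventually_ge_at_top[of "nat \<lceil>t\<rceil>"]
      proof eventually_elim
        case (elim k)
        then have "t \<le> real k" by linarith
        then show ?case using that by (simp add: f_def)
      qed
    qed
    show "bounded (range (\<lambda>k. integral {0<..} (f k)))"
      unfolding bounded_iff using le nonneg by (intro exI[of _ "max 0 (V M + floor_bound / \<epsilon>)"]) (simp add: abs_of_nonneg)
  qed
  have F_int: "?F integrable_on {0<..}" using set_lebesgue_integral_eq_integral(1)[OF floor_integrable] .
  have "g absolutely_integrable_on {0<..}"
    using mc g0 by (intro nonnegative_absolutely_integrable_1) auto
  then have "(\<lambda>t. g t - ?F t) absolutely_integrable_on {0<..}"
    using floor_integrable by (rule set_integral_diff(1))
  then show "running x absolutely_integrable_on {0<..}"
    by (rule absolutely_integrable_spike[of _ _ "{}"]) (auto simp: g_def running_x)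
  have "integral {0<..} g \<le> V M + floor_bound / \<epsilon>"
  proof (rule LIMSEQ_le_const2[OF conjunct2[OF mc]], intro exI[of _ 1] allI impI)
    fix k :: nat assume "1 \<le> k"
    then show "integral {0<..} (f k) \<le> V M + floor_bound / \<epsilon>"
      using cost_on_interval_le[OF grad, of "real k"] unfolding integral_unique[OF fk] g_def by simp
  qed
  moreover have "integral {0<..} (running x) = integral {0<..} (\<lambda>t. g t - ?F t)"
    by (rule integral_cong) (simp add: g_def running_x)
  moreover have "integral {0<..} (\<lambda>t. g t - ?F t) = integral {0<..} g - integral {0<..} ?F"
    using mc F_int by (intro Henstock_Kurzweil_Integration.integral_diff) auto
  moreover have "integral {0<..} ?F = floor_bound * (1 / \<epsilon>)"
    by (rule integral_unique[OF has_integral_mult_right[OF discount_has_integral]])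
  ultimately show "integral {0<..} (running x) \<le> V M" by simp
qed

theorem extremal_is_minimizer:
  assumes grad: "GDERIV V M :> q"
  shows "is_minimizer \<epsilon> Lg M x"
proof -
  have adm: "x \<in> admissible M" by (rule curve_from_imp_admissible[OF x_curve])
  have "discounted_cost \<epsilon> Lg x \<le> value_ereal \<epsilon> Lg M"
    using extremal_optimal[OF grad] by (simp add: cost_eq_integral value_finite)
  moreover have "value_ereal \<epsilon> Lg M \<le> discounted_cost \<epsilon> Lg x"
    unfolding value_ereal_def by (rule INF_lower[OF adm])
  ultimately show ?thesis using adm by (simp add: is_minimizer_def)
qed

text \<open>A minimizer is a near-minimizer for every \<open>\<delta>\<close>, so its velocity agrees with that of \<open>x\<close>.\<close>

theorem minimizer_unique:
  assumes grad: "GDERIV V M :> q" and min: "is_minimizer \<epsilon> Lg M y" and t: "t > 0"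
  shows "y t = x t"
proof -
  define z where "z = y(0 := M)"
  have adm: "y \<in> admissible M" and cost: "discounted_cost \<epsilon> Lg z = ereal (V M)"
    using min by (simp_all add: is_minimizer_def z_def discounted_cost_fun_upd0 value_finite)
  have z: "curve_from M z" unfolding z_def by (rule admissible_imp_curve_from[OF adm])
  have z_int: "running z absolutely_integrable_on {0<..}"
    by (rule finite_cost_integrable[OF z]) (simp add: cost)
  have z_val: "integral {0<..} (running z) = V M" using cost cost_eq_integral[OF z_int] by simp
  interpret competitor Lg Gx Gv K \<gamma> C b \<epsilon> x x' M q z t 1
    by unfold_locales (use z z_int t in auto)
  have "integral {0..t} (\<lambda>\<tau>. (norm (a \<tau>))\<^sup>2) \<le> 0"
  proof (rule field_le_epsilon)
    fix e :: real assume "e > 0"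
    from near_minimizers_converge[OF grad t this] show "integral {0..t} (\<lambda>\<tau>. (norm (a \<tau>))\<^sup>2) \<le> 0 + e"
      using z z_int z_val by (auto simp: a_def)
  qed
  then have "t * integral {0..t} (\<lambda>\<tau>. (norm (a \<tau>))\<^sup>2) \<le> 0" using t by (simp add: mult_le_0_iff)
  then have "(integral {0..t} (\<lambda>\<tau>. norm (a \<tau>)))\<^sup>2 \<le> 0" using integral_a_le by linarith
  then have "integral {0..t} (\<lambda>\<tau>. norm (a \<tau>)) = 0" by simp
  then have "w t = 0" using w_le_integral[of t] t by simp
  then have "z t = x t" by (simp only: w_def right_minus_eq)
  then show ?thesis using t by (simp add: z_def)
qed

end

section \<open>The velocity as derivative of the Hamiltonian\<close>

text \<open>Strong convexity makes \<open>N0\<close> maximal for the momentum \<open>- g\<close>, and for the momentum \<open>- g + k\<close> it leaves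
  a gain between \<open>0\<close> and \<open>norm k ^ 2 / (4 \<gamma>)\<close> over the value at \<open>N0\<close>.\<close>

lemma GDERIV_hamiltonian:
  fixes L :: "'d::finite l2 \<Rightarrow> 'd l2 \<Rightarrow> real"
  assumes "\<gamma> > 0"
    and convex: "\<And>N. L M N0 + g \<bullet> (N - N0) + \<gamma> * (norm (N - N0))\<^sup>2 \<le> L M N"
  shows "GDERIV (hamiltonian L M) (- g) :> - N0"
proof (rule GDERIV_if_quadratic_error)
  fix k :: "'d l2"
  have ub: "- ((- g + k) \<bullet> N) - L M N \<le> - (- g \<bullet> N0) - L M N0 - k \<bullet> N0 + (norm k)\<^sup>2 / (4 * \<gamma>)" for N k
  proof -
    have "0 \<le> (norm (k + (2 * \<gamma>) *\<^sub>R (N - N0)))\<^sup>2 / (4 * \<gamma>)" using \<open>\<gamma> > 0\<close> by simp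
    also have "\<dots> = ((norm k)\<^sup>2 + 4 * \<gamma> * (k \<bullet> (N - N0)) + 4 * \<gamma>\<^sup>2 * (norm (N - N0))\<^sup>2) / (4 * \<gamma>)"
      unfolding power2_norm_eq_inner
      by (simp add: inner_commute inner_add_left inner_add_right power2_eq_square algebra_simps)
    also have "\<dots> = (norm k)\<^sup>2 / (4 * \<gamma>) + k \<bullet> (N - N0) + \<gamma> * (norm (N - N0))\<^sup>2"
      using \<open>\<gamma> > 0\<close> by (simp add: add_divide_distrib power2_eq_square)
    finally show ?thesis using convex[of N] by (simp add: inner_simps)
  qed
  have bdd: "bdd_above (range (\<lambda>N. - ((- g + k) \<bullet> N) - L M N))" for k
    using ub by (intro bdd_aboveI) auto
  have le: "hamiltonian L M (- g + k) \<le> - (- g \<bullet> N0) - L M N0 - k \<bullet> N0 + (norm k)\<^sup>2 / (4 * \<gamma>)" for k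
    unfolding hamiltonian_def by (rule cSUP_least) (use ub in auto)
  have ge: "- ((- g + k) \<bullet> N0) - L M N0 \<le> hamiltonian L M (- g + k)" for k
    unfolding hamiltonian_def by (rule cSUP_upper[OF _ bdd]) simp
  have "hamiltonian L M (- g) = - (- g \<bullet> N0) - L M N0"
    using le[of 0] ge[of 0] by simp
  moreover have "0 \<le> (norm k)\<^sup>2 / (4 * \<gamma>)" using \<open>\<gamma> > 0\<close> by simp
  ultimately show "\<bar>hamiltonian L M (- g + k) - hamiltonian L M (- g) - - N0 \<bullet> k\<bar> \<le> 1 / (4 * \<gamma>) * (norm k)\<^sup>2"
    using le[of k] ge[of k] by (simp add: inner_simps inner_commute[of N0 k])
qed

section \<open>Existence and uniqueness of the minimizer\<close>

text \<open>The quadratic estimates pass from \<open>L\<close> to the tilted Lagrangian with gradients \<open>D_x L\<close> and \<open>D_v L + c\<close>.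
  The bound of \<open>D_v L\<close> at rest, uniform in the position, comes from the growth condition on \<open>DL\<close> and the
  bound of \<open>L\<close> at rest.\<close>

theorem theorem1p1:
  fixes L :: "'d::finite l2 \<Rightarrow> 'd l2 \<Rightarrow> real"
    and DL :: "'d l2 \<times> 'd l2 \<Rightarrow> ('d l2 \<times> 'd l2) \<Rightarrow>\<^sub>L real"
    and C K \<gamma> \<epsilon> :: real and c :: "real ^ 'd" and M :: "'d l2"
  assumes "C > 0" and "K > 0" and "\<gamma> > 0"
    and i: "\<And>M N Z. integer_valued Z \<Longrightarrow> L (M + Z) N = L M N"
    and ii: "\<And>M N G. G \<in> cube_automorphisms \<Longrightarrow> L (compose_l2 M G) (compose_l2 N G) = L M N"
    and iii: "\<And>M N. L M N \<ge> 0"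
    and iv_deriv: "\<And>M N. ((\<lambda>(M, N). L M N) has_derivative blinfun_apply (DL (M, N))) (at (M, N))"
    and iv_C1: "continuous_on UNIV DL"
    and iv_L: "locally_uniformly_continuous (\<lambda>(M, N). L M N)"
    and iv_DL: "locally_uniformly_continuous DL"
    and v: "\<And>M N. L M N \<le> C * (1 + (norm M)\<^sup>2 + (norm N)\<^sup>2)" "\<And>M. \<bar>L M 0\<bar> \<le> C"
    and vi: "\<And>M N. norm (DL (M, N)) \<le> C + C * L M N"
    and vii: "\<And>M N H1 H2. L (M + H1) (N + H2) - L M N - D_x L M N \<bullet> H1 - D_v L M N \<bullet> H2
        \<ge> \<gamma> * (norm H2)\<^sup>2 - K * (norm H1)\<^sup>2"
    and viii: "\<And>M N H1 H2. L (M + H1) (N + H2) - L M N - D_x L M N \<bullet> H1 - D_v L M N \<bullet> H2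
        \<le> K * (norm H2)\<^sup>2 + K * (norm H1)\<^sup>2"
    and "\<epsilon> > 0"
    and diff: "value_fn \<epsilon> (tilted L c) differentiable (at M)"
  shows "\<exists>x x'. is_minimizer \<epsilon> (tilted L c) M x \<and> x 0 = M
      \<and> (\<forall>t\<ge>0. (x has_vector_derivative x' t) (at t within {0..}))
      \<and> continuous_on {0..} x'
      \<and> (\<forall>y. is_minimizer \<epsilon> (tilted L c) M y \<longrightarrow> (\<forall>t>0. y t = x t))
      \<and> x' 0 = - D_p (shifted_hamiltonian L c) M (grad (value_fn \<epsilon> (tilted L c)) M)
      \<and> (\<forall>s\<ge>0. ((\<lambda>s. exp (- (\<epsilon> * s)) *\<^sub>R D_v (tilted L c) (x s) (x' s))
            has_vector_derivative exp (- (\<epsilon> * s)) *\<^sub>R D_x (tilted L c) (x s) (x' s))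
            (at s within {0..}))"
proof -
  have L_lower: "L M N + D_x L M N \<bullet> H1 + D_v L M N \<bullet> H2 + \<gamma> * (norm H2)\<^sup>2 - K * (norm H1)\<^sup>2 \<le> L (M + H1) (N + H2)"
    for M N H1 H2 using vii[where M = M and N = N and ?H1.0 = H1 and ?H2.0 = H2] by linarith
  have L_upper: "L (M + H1) (N + H2) \<le> L M N + D_x L M N \<bullet> H1 + D_v L M N \<bullet> H2 + K * (norm H2)\<^sup>2 + K * (norm H1)\<^sup>2"
    for M N H1 H2 using viii[where M = M and N = N and ?H1.0 = H1 and ?H2.0 = H2] by linarith
  have tilt: "tilted L c M N = L M N + const_l2 c \<bullet> N" for M N
    by (simp add: tilted_def inner_const_l2)
  define Gx where "Gx = D_x L"
  define Gv where "Gv M N = D_v L M N + const_l2 c" for M N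
  have D_v_rest: "norm (D_v L M 0) \<le> C + C * C" for M
  proof -
    let ?g = "D_v L M 0"
    have "((\<lambda>N. (M, N)) has_derivative (\<lambda>k. (0, k))) (at 0)"
      by (auto intro!: derivative_eq_intros)
    from has_derivative_compose[OF this iv_deriv[of M 0]]
    have 1: "((\<lambda>N. L M N) has_derivative (\<lambda>k. blinfun_apply (DL (M, 0)) (0, k))) (at 0)" by simp
    have "GDERIV (\<lambda>N. L M N) 0 :> ?g"
    proof (rule GDERIV_if_quadratic_error)
      fix h :: "'d l2"
      have "0 \<le> \<gamma> * (norm h)\<^sup>2" "0 \<le> K * (norm h)\<^sup>2" using \<open>\<gamma> > 0\<close> \<open>K > 0\<close> by auto
      then show "\<bar>L M (0 + h) - L M 0 - ?g \<bullet> h\<bar> \<le> K * (norm h)\<^sup>2"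
        using L_lower[of M 0 0 h] L_upper[of M 0 0 h] by (simp add: abs_le_iff)
    qed
    then have "(\<lambda>k. blinfun_apply (DL (M, 0)) (0, k)) = (\<lambda>k. k \<bullet> ?g)"
      using has_derivative_unique[OF 1] unfolding gderiv_def by blast
    then have "(norm ?g)\<^sup>2 = blinfun_apply (DL (M, 0)) (0, ?g)"
      by (metis power2_norm_eq_inner)
    also have "\<dots> \<le> norm (DL (M, 0)) * norm (0 :: 'd l2, ?g)"
      using norm_blinfun[of "DL (M, 0)" "(0, ?g)"] by simp
    also have "norm (0 :: 'd l2, ?g) = norm ?g" by (simp add: norm_prod_def)
    finally have "norm ?g * norm ?g \<le> norm (DL (M, 0)) * norm ?g" by (simp add: power2_eq_square)
    then have "norm ?g \<le> norm (DL (M, 0))"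
      by (cases "norm ?g = 0") auto
    also have "\<dots> \<le> C + C * L M 0" by (rule vi)
    also have "\<dots> \<le> C + C * C" using v(2)[of M] \<open>C > 0\<close> by (simp add: abs_le_iff)
    finally show ?thesis .
  qed
  interpret discounted_problem "tilted L c" Gx Gv K \<gamma> C "C + C * C + norm (const_l2 c)" \<epsilon>
  proof unfold_locales
    fix M N H1 H2
    show "tilted L c M N + Gx M N \<bullet> H1 + Gv M N \<bullet> H2 + \<gamma> * (norm H2)\<^sup>2 - K * (norm H1)\<^sup>2 \<le> tilted L c (M + H1) (N + H2)"
      using L_lower[of M N H1 H2] by (simp add: tilt Gx_def Gv_def inner_add_left inner_add_right)
    show "tilted L c (M + H1) (N + H2) \<le> tilted L c M N + Gx M N \<bullet> H1 + Gv M N \<bullet> H2 + K * (norm H2)\<^sup>2 + K * (norm H1)\<^sup>2"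
      using L_upper[of M H1 N H2] by (simp add: tilt Gx_def Gv_def inner_add_left inner_add_right)
    show "0 \<le> tilted L c M 0" "tilted L c M 0 \<le> C" using iii[of M 0] v(2)[of M] by (simp_all add: tilt abs_le_iff)
    show "norm (Gv M 0) \<le> C + C * C + norm (const_l2 c)"
      unfolding Gv_def by (rule norm_triangle_le) (use D_v_rest in simp)
  qed (use assms in auto)
  have Dx: "D_x (tilted L c) M N = Gx M N" for M N
    unfolding D_x_def
  proof (rule grad_eq, rule GDERIV_if_quadratic_error)
    fix h :: "'d l2"
    show "\<bar>tilted L c (M + h) N - tilted L c M N - Gx M N \<bullet> h\<bar> \<le> K * (norm h)\<^sup>2"
      using lower[of M N h 0] upper[of M h N 0] by (simp add: abs_le_iff)
  qed
  have Dv: "D_v (tilted L c) M N = Gv M N" for M N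
    unfolding D_v_def
  proof (rule grad_eq, rule GDERIV_if_quadratic_error)
    fix h :: "'d l2"
    have "0 \<le> \<gamma> * (norm h)\<^sup>2" "0 \<le> K * (norm h)\<^sup>2" using \<open>\<gamma> > 0\<close> \<open>K > 0\<close> by auto
    then show "\<bar>tilted L c M (N + h) - tilted L c M N - Gv M N \<bullet> h\<bar> \<le> K * (norm h)\<^sup>2"
      using lower[of M N 0 h] upper[of M 0 N h] by (simp add: abs_le_iff)
  qed
  define q where "q = grad (value_fn \<epsilon> (tilted L c)) M"
  have gradV: "GDERIV (value_fn \<epsilon> (tilted L c)) M :> q"
    unfolding q_def by (rule GDERIV_grad[OF diff])
  obtain x p where x0: "x 0 = M" and p0: "p 0 = - q" and vc: "continuous_on {0..} (\<lambda>t. velocity (x t) (p t))"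
    and dx: "\<forall>t\<ge>0. (x has_vector_derivative velocity (x t) (p t)) (at t within {0..})"
    and dp: "\<forall>t\<ge>0. (p has_vector_derivative \<epsilon> *\<^sub>R p t + Gx (x t) (velocity (x t) (p t))) (at t within {0..})"
    using euler_lagrange_flow[of M "- q" \<epsilon>] by blast
  define x' where "x' t = velocity (x t) (p t)" for t
  have p: "Gv (x t) (x' t) = p t" for t by (simp add: x'_def Gv_velocity)
  have mom: "((\<lambda>t. exp (- (\<epsilon> * t)) *\<^sub>R Gv (x t) (x' t)) has_vector_derivative exp (- (\<epsilon> * t)) *\<^sub>R Gx (x t) (x' t)) (at t within {0..})"
    if t: "t \<ge> 0" for t
  proof -
    have e: "((\<lambda>t. exp (- (\<epsilon> * t))) has_real_derivative - \<epsilon> * exp (- (\<epsilon> * t))) (at t within {0..})"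
      by (auto intro!: derivative_eq_intros)
    have "((\<lambda>t. exp (- (\<epsilon> * t)) *\<^sub>R p t) has_vector_derivative
        exp (- (\<epsilon> * t)) *\<^sub>R (\<epsilon> *\<^sub>R p t + Gx (x t) (velocity (x t) (p t))) + (- \<epsilon> * exp (- (\<epsilon> * t))) *\<^sub>R p t) (at t within {0..})"
      by (rule has_vector_derivative_scaleR[OF e]) (use dp t in blast)
    moreover have "exp (- (\<epsilon> * t)) *\<^sub>R (\<epsilon> *\<^sub>R p t + Gx (x t) (velocity (x t) (p t))) + (- \<epsilon> * exp (- (\<epsilon> * t))) *\<^sub>R p t
        = exp (- (\<epsilon> * t)) *\<^sub>R Gx (x t) (x' t)"
      by (simp add: x'_def scaleR_add_right mult.commute)
    ultimately show ?thesis unfolding p by simp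
  qed
  interpret extremal "tilted L c" Gx Gv K \<gamma> C "C + C * C + norm (const_l2 c)" \<epsilon> x x' M q
  proof unfold_locales
    show "(x has_vector_derivative x' t) (at t within {0..})" if "t \<ge> 0" for t using dx that by (simp add: x'_def)
    show "continuous_on {0..} x'" using vc by (simp add: x'_def[abs_def])
    show "Gv M (x' 0) = - q" using p[of 0] by (simp add: x0 p0)
  qed (use x0 mom in auto)
  have H: "x' 0 = - D_p (shifted_hamiltonian L c) M q"
  proof -
    have "GDERIV (hamiltonian L M) (- D_v L M (x' 0)) :> - x' 0"
    proof (rule GDERIV_hamiltonian[OF \<open>\<gamma> > 0\<close>])
      fix N
      show "L M (x' 0) + D_v L M (x' 0) \<bullet> (N - x' 0) + \<gamma> * (norm (N - x' 0))\<^sup>2 \<le> L M N"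
        using L_lower[of M "x' 0" 0 "N - x' 0"] by simp
    qed
    moreover have "- D_v L M (x' 0) = q + const_l2 c"
      using init unfolding Gv_def by (metis add_diff_cancel_right' diff_minus_eq_add minus_diff_eq uminus_add_conv_diff)
    ultimately have "(hamiltonian L M has_derivative (\<lambda>h. h \<bullet> - x' 0)) (at (q + const_l2 c))"
      by (simp add: gderiv_def)
    moreover have "((\<lambda>P. P + const_l2 c) has_derivative (\<lambda>h. h)) (at q)"
      by (auto intro!: derivative_eq_intros)
    ultimately have "((\<lambda>P. hamiltonian L M (P + const_l2 c)) has_derivative (\<lambda>h. h \<bullet> - x' 0)) (at q)"
      using has_derivative_compose by fastforce
    then have "GDERIV (\<lambda>P. shifted_hamiltonian L c M P) q :> - x' 0"
      by (simp add: gderiv_def shifted_hamiltonian_def)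
    then show ?thesis unfolding D_p_def by (simp add: grad_eq)
  qed
  show ?thesis
    unfolding Dx Dv q_def[symmetric]
  proof (rule exI[of _ x], rule exI[of _ x'], intro conjI allI impI)
    show "is_minimizer \<epsilon> (tilted L c) M x" by (rule extremal_is_minimizer[OF gradV])
    show "x 0 = M" by (rule x0)
    show "continuous_on {0..} x'" by (rule x'_cont)
    show "x' 0 = - D_p (shifted_hamiltonian L c) M q" by (rule H)
    show "y t = x t" if "is_minimizer \<epsilon> (tilted L c) M y" "t > 0" for y t
      by (rule minimizer_unique[OF gradV that])
    show "(x has_vector_derivative x' t) (at t within {0..})" if "t \<ge> 0" for t by (rule x_deriv[OF that])
    show "((\<lambda>s. exp (- (\<epsilon> * s)) *\<^sub>R Gv (x s) (x' s)) has_vector_derivative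
        exp (- (\<epsilon> * s)) *\<^sub>R Gx (x s) (x' s)) (at s within {0..})" if "s \<ge> 0" for s by (rule mom[OF that])
  qed
qed

end
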